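(* Let $U$ be a unicyclic graph whose unique cycle is $C_n$ (a cycle on $n$ vertices), let $m\ge 3$, and let $d$ be a positive integer with $m\mid d$. If $d/m=n$, then $$\mathrm{Tr}_d(U^m)=\sum_{k=1}^{n} n\,(m-1)^{(m-1)(|E(U)|-k)-1}\,m^{k(m-2)+1}\sum_{\hat T\in\mathbf T_k}\tilde c_n(\hat T)\,N_U(\hat T)+2n(n+1)(m-1)^{(m-1)(|E(U)|-n)}\,m^{n(m-2)}.$$ If $d/m<n$, then $$\mathrm{Tr}_d(U^m)=\sum_{k=1}^{d/m} d\,(m-1)^{(m-1)(|E(U)|-k)-1}\,m^{k(m-2)}\sum_{\hat T\in\mathbf T_k}\tilde c_{d/m}(\hat T)\,N_U(\hat T).$$
   Context: Graphs are finite, simple and undirected; a unicyclic graph is a connected graph containing exactly one cycle. For a graph $G=(V,E)$ and $m\ge 2$, the $m$-th power $G^m$ is the $m$-uniform hypergraph obtained by enlarging every edge $e\in E$ by $m-2$ new vertices $i_{e,1},\dots,i_{e,m-2}$ (new vertices for different edges being distinct). The adjacency tensor of an $m$-uniform hypergraph $\mathcal H$ on vertices $v_1,\dots,v_N$ is the order-$m$ dimension-$N$ tensor $\mathcal A=(a_{i_1\dots i_m})$ with $a_{i_1\dots i_m}=\frac1{(m-1)!}$ if $\{v_{i_1},\dots,v_{i_m}\}\in E(\mathcal H)$ and $0$ otherwise. With $(\mathcal A x^{m-1})_i=\sum_{i_2,\dots,i_m}a_{ii_2\dots i_m}x_{i_2}\cdots x_{i_m}$, the eigenvalues of $\mathcal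 A$ are the $\lambda\in\mathbb C$ for which $\mathcal A x^{m-1}=\lambda x^{[m-1]}$, where $x^{[m-1]}=(x_1^{m-1},\dots,x_N^{m-1})$, has a nonzero solution $x\in\mathbb C^N$; counted with multiplicity they are the $N(m-1)^{N-1}$ roots of the characteristic polynomial, i.e. the resultant of the system $\lambda x^{[m-1]}-\mathcal A x^{m-1}=0$. $\mathrm{Tr}_d(\mathcal H)$, the $d$-th trace of $\mathcal H$, is the $d$-th (Morozov–Shakirov) trace of $\mathcal A$, which equals the sum of the $d$-th powers of all eigenvalues of $\mathcal A$ counted with multiplicity. $\mathbf T_k$ is the set of trees with exactly $k$ edges up to isomorphism, and $N_G(\hat T)$ is the number of (not necessarily induced) subgraphs of $G$ isomorphic to $\hat T$. For a tree $\hat T$ and $\omega:E(\hat T)\to\mathbb Z^+$ put $\omega(\hat T)=\sum_{e}\omega(e)$, $d_v(\hat T(\omega))=\sum_{e\ni v}\omega(e)$, $r_v(\hat T(\omega))=\prod_{e\ni v}\omega(e)!$, and $$\tilde c_\ell(\hat T)=\sum_{\omega:\ \omega(\hat T)=\ell}\ \prod_{e\in E(\hat T)}\omega(e)\prod_{v\in V(\hat T)}\frac{(d_v(\hat T(\omega))-1)!}{r_v(\hat T(\omega))}.$$ *)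

theory Defs
  imports Complex_Main "HOL-Library.FuncSet" "HOL-Library.Poly_Mapping"
begin

section \<open>Graphs and hypergraphs\<close>

datatype 'a hypergraph = Hypergraph (verts: "'a set") (edges: "'a set set")

definition uniform_hypergraph :: "nat \<Rightarrow> 'a hypergraph \<Rightarrow> bool" where
  "uniform_hypergraph m H \<longleftrightarrow>
     finite (verts H) \<and> (\<forall>e\<in>edges H. e \<subseteq> verts H \<and> card e = m)"

abbreviation simple_graph :: "'a hypergraph \<Rightarrow> bool" where
  "simple_graph \<equiv> uniform_hypergraph 2"

definition subgraph :: "'a hypergraph \<Rightarrow> 'a hypergraph \<Rightarrow> bool" where
  "subgraph H G \<longleftrightarrow> simple_graph H \<and> verts H \<subseteq> verts G \<and> edges H \<subseteq> edges G"

definition isomorphic :: "'a hypergraph \<Rightarrow> 'b hypergraph \<Rightarrow> bool" where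
  "isomorphic G H \<longleftrightarrow>
     (\<exists>f. bij_betw f (verts G) (verts H) \<and> (\<lambda>e. f ` e) ` edges G = edges H)"

definition connected_graph :: "'a hypergraph \<Rightarrow> bool" where
  "connected_graph G \<longleftrightarrow> verts G \<noteq> {} \<and>
     (\<forall>u\<in>verts G. \<forall>v\<in>verts G. (u, v) \<in> {(x, y). {x, y} \<in> edges G}\<^sup>*)"

definition cycle_graph :: "nat \<Rightarrow> nat hypergraph" where
  "cycle_graph n = Hypergraph {..<n} {{i, (i + 1) mod n} | i. i < n}"

text \<open>The cycles of a graph are regarded as subgraphs, so that a cycle is counted once and not
  once for every choice of a starting vertex and an orientation.\<close>

definition is_cycle :: "'a hypergraph \<Rightarrow> bool" where
  "is_cycle C \<longleftrightarrow> (\<exists>n\<ge>3. isomorphic C (cycle_graph n))"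

definition unicyclic :: "'a hypergraph \<Rightarrow> bool" where
  "unicyclic G \<longleftrightarrow>
     simple_graph G \<and> connected_graph G \<and> (\<exists>!C. subgraph C G \<and> is_cycle C)"

definition tree :: "'a hypergraph \<Rightarrow> bool" where
  "tree T \<longleftrightarrow> simple_graph T \<and> connected_graph T \<and> \<not> (\<exists>C. subgraph C T \<and> is_cycle C)"

text \<open>In the power \<open>G\<^sup>m\<close>, \<open>Inl v\<close> is the original vertex \<open>v\<close> and \<open>Inr (e, j)\<close> is the new
  vertex \<open>i\<^bsub>e,j\<^esub>\<close>.\<close>

definition power_hypergraph ::
    "'a hypergraph \<Rightarrow> nat \<Rightarrow> ('a + 'a set \<times> nat) hypergraph" where
  "power_hypergraph G m = Hypergraph
     (Inl ` verts G \<union> Inr ` (edges G \<times> {1..m-2}))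
     ((\<lambda>e. Inl ` e \<union> (\<lambda>j. Inr (e, j)) ` {1..m-2}) ` edges G)"


section \<open>Tensors and their traces\<close>

text \<open>A tensor of order \<open>m\<close> whose dimensions are indexed by a finite set \<open>V\<close> is a function on
  index lists; only its values at lists of length \<open>m\<close> over \<open>V\<close> are relevant.\<close>

type_synonym 'v tensor = "'v list \<Rightarrow> real"

definition adjacency_tensor :: "nat \<Rightarrow> 'v hypergraph \<Rightarrow> 'v tensor" where
  "adjacency_tensor m H is = (if set is \<in> edges H then 1 / fact (m - 1) else 0)"

text \<open>Real polynomials in the entries \<open>a\<^bsub>ij\<^esub>\<close> of an auxiliary matrix of indeterminates.\<close>

type_synonym 'v entry_poly = "('v \<times> 'v \<Rightarrow>\<^sub>0 nat) \<Rightarrow>\<^sub>0 real"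

definition entry :: "'v \<Rightarrow> 'v \<Rightarrow> 'v entry_poly" where
  "entry i j = Poly_Mapping.single (Poly_Mapping.single (i, j) 1) 1"

definition entry_deriv :: "'v \<times> 'v \<Rightarrow> 'v entry_poly \<Rightarrow> 'v entry_poly" where
  "entry_deriv x p = (\<Sum>\<mu>\<in>Poly_Mapping.keys p.
     Poly_Mapping.single (\<mu> - Poly_Mapping.single x 1)
       (real (Poly_Mapping.lookup \<mu> x) * Poly_Mapping.lookup p \<mu>))"

fun matrix_power :: "'v set \<Rightarrow> ('v \<Rightarrow> 'v \<Rightarrow> 'r::comm_ring_1) \<Rightarrow> nat \<Rightarrow> 'v \<Rightarrow> 'v \<Rightarrow> 'r" where
  "matrix_power V A 0 i j = (if i = j then 1 else 0)"
| "matrix_power V A (Suc k) i j = (\<Sum>l\<in>V. matrix_power V A k i l * A l j)"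

definition matrix_trace :: "'v set \<Rightarrow> ('v \<Rightarrow> 'v \<Rightarrow> 'r::comm_ring_1) \<Rightarrow> 'r" where
  "matrix_trace V A = (\<Sum>i\<in>V. A i i)"

text \<open>The operator
  \<open>g\<^sub>i = \<Sum>j\<^sub>2,\<dots>,j\<^sub>m\<in>V. t\<^bsub>i j\<^sub>2 \<dots> j\<^sub>m\<^esub> \<partial>/\<partial>a\<^bsub>i j\<^sub>2\<^esub> \<cdots> \<partial>/\<partial>a\<^bsub>i j\<^sub>m\<^esub>\<close>
  attached to row \<open>i\<close> of an order \<open>m\<close> tensor \<open>t\<close>.\<close>

definition row_operator ::
    "nat \<Rightarrow> 'v set \<Rightarrow> 'v tensor \<Rightarrow> 'v \<Rightarrow> 'v entry_poly \<Rightarrow> 'v entry_poly" where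
  "row_operator m V t i p = (\<Sum>js\<in>{js. length js = m - 1 \<and> set js \<subseteq> V}.
     Poly_Mapping.single 0 (t (i # js)) * fold (\<lambda>j. entry_deriv (i, j)) js p)"

text \<open>The \<open>d\<close>-th Morozov--Shakirov trace of an order \<open>m\<close> tensor \<open>t\<close> of dimension \<open>N = |V|\<close>,
  \[(m-1)^{N-1} \sum_{d_1+\cdots+d_N=d} \Bigl(\prod_i \frac{g_i^{d_i}}{(d_i(m-1))!}\Bigr)
     \mathrm{tr}(A^{d(m-1)}),\]
  where \<open>A = (a\<^bsub>ij\<^esub>)\<close> is a matrix of indeterminates.  The operators \<open>g\<^sub>i\<close> commute, so
  \<open>Finite_Set.fold\<close> is their composition in any order.  Each summand applies a differential
  operator of order \<open>d(m-1)\<close> to a form of degree \<open>d(m-1)\<close> and is therefore a constant, which is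
  read off as the coefficient of the monomial \<open>0\<close>.\<close>

definition tensor_trace :: "nat \<Rightarrow> 'v set \<Rightarrow> 'v tensor \<Rightarrow> nat \<Rightarrow> real" where
  "tensor_trace m V t d = real (m - 1) ^ (card V - 1) *
     (\<Sum>\<delta>\<in>{\<delta> \<in> V \<rightarrow>\<^sub>E UNIV. sum \<delta> V = d}.
        (\<Prod>i\<in>V. 1 / fact (\<delta> i * (m - 1))) *
        Poly_Mapping.lookup
          (Finite_Set.fold (\<lambda>i. row_operator m V t i ^^ \<delta> i)
             (matrix_trace V (matrix_power V entry (d * (m - 1)))) V) 0)"

definition hypergraph_trace :: "nat \<Rightarrow> 'v hypergraph \<Rightarrow> nat \<Rightarrow> real" where
  "hypergraph_trace m H d = tensor_trace m (verts H) (adjacency_tensor m H) d"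


section \<open>Trees and the coefficients\<close>

text \<open>Isomorphism classes of trees with \<open>k\<close> edges; as trees are finite, it is enough to consider
  those whose vertices are natural numbers.\<close>

definition tree_classes :: "nat \<Rightarrow> nat hypergraph set set" where
  "tree_classes k =
     (let S = {T. tree T \<and> card (edges T) = k}
      in S // {(T, T'). T \<in> S \<and> T' \<in> S \<and> isomorphic T T'})"

definition representative :: "'b set \<Rightarrow> 'b" where
  "representative \<tau> = (SOME T. T \<in> \<tau>)"

definition subgraph_count :: "'a hypergraph \<Rightarrow> 'b hypergraph \<Rightarrow> nat" where
  "subgraph_count G T = card {H. subgraph H G \<and> isomorphic H T}"

definition wdegree :: "'a hypergraph \<Rightarrow> ('a set \<Rightarrow> nat) \<Rightarrow> 'a \<Rightarrow> nat" where
  "wdegree T \<omega> v = (\<Sum>e\<in>{e \<in> edges T. v \<in> e}. \<omega> e)"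

definition wfact :: "'a hypergraph \<Rightarrow> ('a set \<Rightarrow> nat) \<Rightarrow> 'a \<Rightarrow> nat" where
  "wfact T \<omega> v = (\<Prod>e\<in>{e \<in> edges T. v \<in> e}. fact (\<omega> e))"

definition tree_coeff :: "nat \<Rightarrow> 'a hypergraph \<Rightarrow> real" where
  "tree_coeff l T = (\<Sum>\<omega>\<in>{\<omega> \<in> edges T \<rightarrow>\<^sub>E {1..}. sum \<omega> (edges T) = l}.
     (\<Prod>e\<in>edges T. real (\<omega> e)) *
     (\<Prod>v\<in>verts T. fact (wdegree T \<omega> v - 1) / real (wfact T \<omega> v)))"

text \<open>\<open>\<Sum>T\<in>T\<^sub>k. c\<^sub>l(T) N\<^sub>G(T)\<close>; both factors are isomorphism invariants of \<open>T\<close>, so the choice of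
  the representatives does not matter.\<close>

definition tree_sum :: "nat \<Rightarrow> nat \<Rightarrow> 'a hypergraph \<Rightarrow> real" where
  "tree_sum k l G = (\<Sum>\<tau>\<in>tree_classes k.
     tree_coeff l (representative \<tau>) * real (subgraph_count G (representative \<tau>)))"

end

theory Submission
  imports Defs "HOL-Combinatorics.Multiset_Permutations"
begin

text \<open>Up to a factorial, the coefficients of a polynomial are its iterated derivatives at the
  origin, so the operators in the definition of the trace act on them as shifts.  Expanding the
  trace turns it into a sum over all assignments \<open>K\<close>, which record how often each vertex selects
  each of its hyperedges, and the summand of \<open>K\<close> counts the closed walks that use the arcs of the
  multigraph of \<open>K\<close> exactly once.  By the BEST theorem this is a Laplacian minor times factorials.

  Such walks exist only if the multigraph is balanced.  The new vertices of a hyperedge \<open>e\<close> then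
  all have the same multiplicity \<open>\<omega> e\<close>, and the deviation of \<open>K\<close> from \<open>\<omega>\<close> at the old vertices
  is a circulation on \<open>U\<close>, whose support contains the cycle unless it is empty.  Since \<open>\<omega>\<close> has
  total \<open>d / m \<le> n\<close>, either the circulation vanishes or it is one of the two orientations of the
  cycle with \<open>\<omega> = 1\<close> there.  Eliminating the new vertices by Schur complements reduces the minor
  to a Laplacian minor of the support of \<open>\<omega>\<close>: it is the product of \<open>\<omega>\<close> for a tree, \<open>n\<close> for the
  cycle, a power of two for an oriented cycle, and zero for a disconnected support.\<close>

section \<open>Determinants over finite index sets\<close>

text \<open>The constants come from three cancellations. The normalisation
  \<open>1 / fact (\<delta> i * (m - 1))\<close> of the trace meets the factorials
  \<open>fact (outdeg - 1)\<close> of the BEST theorem and leaves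
  \<open>1 / ((m - 1) * wdeg)\<close> at every active vertex; with the multinomial coefficient of an
  old vertex this gives \<open>fact (wdegree - 1) / wfact\<close>, the vertex factor of
  \<open>tree_coeff\<close>. Eliminating the \<open>m - 2\<close> new vertices of an edge yields
  \<open>2 / m\<close> besides powers of \<open>m\<close>, and the matrix that remains is
  \<open>m / 2\<close> times a Laplacian, one factor for each old vertex but the root. A tree has
  one vertex more than edges, so these cancel; on the cycle one factor \<open>2 / m\<close> survives
  and turns \<open>d = m * n\<close> into \<open>2 * n\<close>. There the assignment without
  circulation contributes \<open>2 * n * n\<close> and each orientation
  \<open>2 * n * 2 ^ (n - 1) / 2 ^ n = n\<close>, up to a common factor, whence
  \<open>2 * n * (n + 1)\<close>. Determinants are taken over arbitrary finite index sets because
  the matrices live on the active vertices, which vary with \<open>K\<close>.\<close>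

definition det_on :: "'v set \<Rightarrow> ('v \<Rightarrow> 'v \<Rightarrow> real) \<Rightarrow> real" where
  "det_on S M = (\<Sum>p | p permutes S. of_int (sign p) * (\<Prod>i\<in>S. M i (p i)))"

lemma det_on_cong:
  assumes "S = S'" "\<And>i j. i \<in> S \<Longrightarrow> j \<in> S \<Longrightarrow> M i j = M' i j"
  shows "det_on S M = det_on S' M'"
  unfolding det_on_def using assms
  by (auto intro!: sum.cong prod.cong arg_cong2[where f="(*)"] simp: permutes_in_image)

lemma det_on_empty [simp]: "det_on {} M = 1"
proof -
  have "{p :: 'a \<Rightarrow> 'a. p permutes {}} = {id}"
    by (auto simp: permutes_empty)
  then show ?thesis by (simp add: det_on_def)
qed

lemma det_on_transpose:
  assumes "finite S"
  shows "det_on S (\<lambda>i j. M j i) = det_on S M"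
proof -
  have "det_on S M = (\<Sum>p | p permutes S. of_int (sign (inv p)) * (\<Prod>i\<in>S. M i (inv p i)))"
    unfolding det_on_def by (subst sum_permutations_inverse) simp
  also have "\<dots> = (\<Sum>p | p permutes S. of_int (sign p) * (\<Prod>i\<in>S. M (p i) i))"
  proof (intro sum.cong refl arg_cong2[where f="(*)"])
    fix p assume "p \<in> {p. p permutes S}"
    then have p: "p permutes S" by simp
    show "real_of_int (sign (inv p)) = real_of_int (sign p)"
      using p assms by (simp add: sign_inverse permutes_imp_permutation)
    have "(\<Prod>i\<in>S. M i (inv p i)) = (\<Prod>i\<in>S. M (p i) (inv p (p i)))"
      using prod.permute[OF p, of "\<lambda>i. M i (inv p i)"] by (simp add: o_def)
    also have "\<dots> = (\<Prod>i\<in>S. M (p i) i)"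
      using permutes_inverses[OF p] by simp
    finally show "(\<Prod>i\<in>S. M i (inv p i)) = (\<Prod>i\<in>S. M (p i) i)" .
  qed
  finally show ?thesis by (simp add: det_on_def)
qed

lemma det_on_row_sum:
  assumes "finite S" "a \<in> S"
  shows "det_on S (M(a := \<lambda>j. \<Sum>x\<in>X. c x * R x j)) = (\<Sum>x\<in>X. c x * det_on S (M(a := R x)))"
proof -
  have split: "(\<Prod>i\<in>S. (M(a := r)) i (p i)) = r (p a) * (\<Prod>i\<in>S-{a}. M i (p i))" for r p
    using assms by (subst prod.remove[of S a]) (auto intro!: prod.cong)
  show ?thesis
    unfolding det_on_def split sum_distrib_left sum_distrib_right
    by (subst sum.swap) (simp add: algebra_simps)
qed

lemma det_on_row_add:
  assumes "finite S" "a \<in> S"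
  shows "det_on S (M(a := \<lambda>j. r j + t * s j)) = det_on S (M(a := r)) + t * det_on S (M(a := s))"
  using det_on_row_sum[OF assms, of M "\<lambda>b. if b then 1 else t" "\<lambda>b. if b then r else s" "UNIV :: bool set"]
  by (simp add: UNIV_bool add.commute)

text \<open>Composing each permutation with the transposition of \<open>a\<close> and
  \<open>b\<close> keeps the product and flips the sign, so the determinant equals its own
  negative.\<close>

lemma det_on_identical_rows:
  assumes "finite S" "a \<in> S" "b \<in> S" "a \<noteq> b" "\<And>j. j \<in> S \<Longrightarrow> M a j = M b j"
  shows "det_on S M = 0"
proof -
  let ?t = "transpose a b"
  have t: "?t permutes S" using assms by (simp add: permutes_swap_id)
  have "det_on S M = (\<Sum>p | p permutes S. of_int (sign (p \<circ> ?t)) * (\<Prod>i\<in>S. M i ((p \<circ> ?t) i)))"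
    unfolding det_on_def by (subst sum_permutations_compose_right[OF t]) simp
  also have "\<dots> = (\<Sum>p | p permutes S. - (of_int (sign p) * (\<Prod>i\<in>S. M i (p i))))"
  proof (intro sum.cong refl)
    fix p assume "p \<in> {p. p permutes S}"
    then have p: "p permutes S" by simp
    have sg: "sign (p \<circ> ?t) = - sign p"
      using p assms by (simp add: sign_compose permutes_imp_permutation permutation_swap_id sign_swap_id)
    have "(\<Prod>i\<in>S. M i ((p \<circ> ?t) i)) = (\<Prod>i\<in>S. M (?t i) ((p \<circ> ?t) (?t i)))"
      using prod.permute[OF t, of "\<lambda>i. M i ((p \<circ> ?t) i)"] by (simp add: o_def)
    also have "\<dots> = (\<Prod>i\<in>S. M i (p i))"
      using assms p by (intro prod.cong) (auto simp: Transposition.transpose_def permutes_in_image)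
    finally show "of_int (sign (p \<circ> ?t)) * (\<Prod>i\<in>S. M i ((p \<circ> ?t) i)) =
      - (real_of_int (sign p) * (\<Prod>i\<in>S. M i (p i)))" by (simp add: sg)
  qed
  also have "\<dots> = - det_on S M" by (simp add: det_on_def sum_negf)
  finally show ?thesis by simp
qed

lemma det_on_add_row:
  assumes "finite S" "a \<in> S" "b \<in> S" "a \<noteq> b"
  shows "det_on S (M(a := \<lambda>j. M a j + t * M b j)) = det_on S M"
proof -
  have "det_on S (M(a := M b)) = 0"
    by (rule det_on_identical_rows[OF assms]) (use assms in auto)
  then show ?thesis using det_on_row_add[OF assms(1,2), of M "M a" t "M b"] by simp
qed

lemma det_on_add_rows:
  assumes "finite S" "v \<in> S" "A \<subseteq> S - {v}"
  shows "det_on S (\<lambda>i. if i \<in> A then \<lambda>j. M i j + t i * M v j else M i) = det_on S M"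
proof -
  have "finite A" using assms finite_subset by blast
  then show ?thesis using assms(3)
  proof (induction A)
    case empty
    then show ?case by simp
  next
    case (insert a A)
    let ?M = "\<lambda>i. if i \<in> A then \<lambda>j. M i j + t i * M v j else M i"
    have "(\<lambda>i. if i \<in> insert a A then \<lambda>j. M i j + t i * M v j else M i) =
       ?M(a := \<lambda>j. ?M a j + t a * ?M v j)"
      using insert by (auto simp: fun_eq_iff)
    then show ?case using insert det_on_add_row[OF assms(1), of a v ?M "t a"] assms by auto
  qed
qed

text \<open>A permutation that moves \<open>v\<close> has some \<open>i \<noteq> v\<close> with
  image \<open>v\<close>, hence a zero factor; those that fix \<open>v\<close> are the permutations
  of \<open>S - {v}\<close>.\<close>

lemma det_on_remove:
  assumes "finite S" "v \<in> S" "\<And>i. i \<in> S - {v} \<Longrightarrow> M i v = 0"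
  shows "det_on S M = M v v * det_on (S - {v}) M"
proof -
  have z: "(\<Prod>i\<in>S. M i (p i)) = 0" if p: "p permutes S" "p v \<noteq> v" for p
  proof -
    obtain i where i: "p i = v" using permutes_inverses(1)[OF p(1)] by blast
    then have "i \<in> S" using permutes_in_image[OF p(1), of i] assms(2) by simp
    moreover have "i \<noteq> v" using i p by auto
    ultimately have "M i (p i) = 0" using assms(3) i by simp
    with \<open>i \<in> S\<close> assms(1) show ?thesis by (blast intro: prod_zero)
  qed
  have eq: "{p. p permutes (S - {v})} = {p. p permutes S \<and> p v = v}"
  proof safe
    fix p assume p: "p permutes (S - {v})"
    show "p permutes S" using p by (rule permutes_subset) auto
    show "p v = v" using p by (simp add: permutes_not_in)
  next
    fix p assume p: "p permutes S" "p v = v"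
    show "p permutes (S - {v})"
      by (rule permutes_superset[OF p(1)]) (use p in auto)
  qed
  have "det_on S M = (\<Sum>p | p permutes S \<and> p v = v. of_int (sign p) * (\<Prod>i\<in>S. M i (p i)))"
    unfolding det_on_def
    by (rule sum.mono_neutral_right) (use assms(1) in \<open>auto simp: finite_permutations z simp del: prod_zero_iff\<close>)
  also have "\<dots> = (\<Sum>p | p permutes (S - {v}). M v v * (of_int (sign p) * (\<Prod>i\<in>S - {v}. M i (p i))))"
    unfolding eq by (rule sum.cong) (auto simp: prod.remove[OF assms(1,2)])
  finally show ?thesis by (simp add: det_on_def sum_distrib_left)
qed

text \<open>One pivot step: column \<open>v\<close> is cleared by row operations and then removed.
  The later evaluations for new vertices, trees and cycles iterate it.\<close>

lemma det_on_schur: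
  assumes "finite S" "v \<in> S" "M v v \<noteq> 0"
  shows "det_on S M = M v v * det_on (S - {v}) (\<lambda>i j. M i j - M i v * M v j / M v v)"
proof -
  define N where "N = (\<lambda>i. if i \<in> S - {v} then \<lambda>j. M i j + (- M i v / M v v) * M v j else M i)"
  have "det_on S N = det_on S M"
    unfolding N_def by (rule det_on_add_rows[OF assms(1,2) subset_refl])
  moreover have "det_on S N = N v v * det_on (S - {v}) N"
    by (rule det_on_remove[OF assms(1,2)]) (use assms(3) in \<open>simp add: N_def\<close>)
  moreover have "det_on (S - {v}) N = det_on (S - {v}) (\<lambda>i j. M i j - M i v * M v j / M v v)"
    by (rule det_on_cong[OF refl]) (simp add: N_def)
  moreover have "N v v = M v v" by (simp add: N_def)
  ultimately show ?thesis by simp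
qed

text \<open>Replacing one row of \<open>Z\<close> by the sum of all rows of \<open>Z\<close> does
  not change the determinant, and that sum is the zero row.\<close>

lemma det_on_dependent_rows:
  assumes "finite S" "Z \<subseteq> S" "Z \<noteq> {}" "\<And>j. j \<in> S \<Longrightarrow> (\<Sum>z\<in>Z. M z j) = 0"
  shows "det_on S M = 0"
proof -
  obtain c where c: "c \<in> Z" using assms(3) by blast
  have fZ: "finite Z" by (rule finite_subset[OF assms(2,1)])
  have "det_on S (M(c := \<lambda>j. \<Sum>z\<in>Z. 1 * M z j)) = (\<Sum>z\<in>Z. 1 * det_on S (M(c := M z)))"
    using c assms(2) by (intro det_on_row_sum[OF assms(1), of c M "\<lambda>_. 1" M Z]) auto
  also have "\<dots> = (\<Sum>z\<in>Z. if z = c then det_on S M else 0)"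
  proof (intro sum.cong refl)
    fix z assume z: "z \<in> Z"
    have "det_on S (M(c := M z)) = 0" if "z \<noteq> c"
      by (rule det_on_identical_rows[OF assms(1), of c z]) (use that c z assms(2) in auto)
    then show "1 * det_on S (M(c := M z)) = (if z = c then det_on S M else 0)"
      by simp
  qed
  also have "\<dots> = det_on S M" using fZ c by simp
  also have "det_on S (M(c := \<lambda>j. \<Sum>z\<in>Z. 1 * M z j)) = det_on S (M(c := \<lambda>j. \<Sum>z\<in>({} :: 'a set). 1 * M z j))"
    by (rule det_on_cong[OF refl]) (simp add: assms(4))
  also have "\<dots> = 0"
    using c assms(2) det_on_row_sum[OF assms(1), of c M "\<lambda>_. 1" M "{}"] by auto
  finally show ?thesis by simp
qed

lemma det_on_dependent_cols:
  assumes "finite S" "Z \<subseteq> S" "Z \<noteq> {}" "\<And>i. i \<in> S \<Longrightarrow> (\<Sum>z\<in>Z. M i z) = 0"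
  shows "det_on S M = 0"
  using det_on_dependent_rows[OF assms(1-3), of "\<lambda>i j. M j i"] assms(4) det_on_transpose[OF assms(1), of M]
  by simp

lemma det_on_scale:
  assumes "finite S"
  shows "det_on S (\<lambda>i j. c * M i j) = c ^ card S * det_on S M"
  unfolding det_on_def by (simp add: prod.distrib sum_distrib_left algebra_simps)

text \<open>Closed walks may start anywhere, so the minors at different roots have to be compared.
  The minor at \<open>x\<close> is the determinant with row \<open>x\<close> replaced by the unit
  vector \<open>u x\<close>; zero row sums allow one unit vector to be exchanged for another, zero
  column sums allow the replaced row to be moved.\<close>

lemma det_on_minor_root:
  assumes "finite S" "r \<in> S" "s \<in> S"
    and rows: "\<And>i. i \<in> S \<Longrightarrow> (\<Sum>j\<in>S. M i j) = 0"
    and cols: "\<And>j. j \<in> S \<Longrightarrow> (\<Sum>i\<in>S. M i j) = 0"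
  shows "det_on (S - {r}) M = det_on (S - {s}) M"
proof (cases "r = s")
  case False
  define u :: "'a \<Rightarrow> 'a \<Rightarrow> real" where "u = (\<lambda>x j. if j = x then 1 else 0)"
  have minor: "det_on S (M(x := u x)) = det_on (S - {x}) M" if "x \<in> S" for x
  proof -
    have "det_on S (M(x := u x)) = det_on S (\<lambda>i j. (M(x := u x)) j i)"
      using det_on_transpose[OF assms(1)] by metis
    also have "\<dots> = det_on (S - {x}) (\<lambda>i j. (M(x := u x)) j i)"
      using det_on_remove[OF assms(1) that, of "\<lambda>i j. (M(x := u x)) j i"] by (simp add: u_def)
    also have "\<dots> = det_on (S - {x}) (M(x := u x))"
      using det_on_transpose[of "S - {x}" "M(x := u x)"] assms(1) by simp
    also have "\<dots> = det_on (S - {x}) M" by (rule det_on_cong) auto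
    finally show ?thesis .
  qed
  \<comment> \<open>The difference row \<open>u r - u s\<close> has entry sum zero like all other
    rows, so the columns are dependent.\<close>
  have cofactor: "det_on S (M(s := u r)) = det_on S (M(s := u s))"
  proof -
    have "det_on S (M(s := \<lambda>j. u r j + (-1) * u s j)) = 0"
    proof (rule det_on_dependent_cols[OF assms(1) subset_refl])
      fix i assume "i \<in> S"
      then show "(\<Sum>z\<in>S. (M(s := \<lambda>j. u r j + (-1) * u s j)) i z) = 0"
        using rows assms by (cases "i = s") (auto simp: u_def sum_subtractf)
    qed (use assms in auto)
    then show ?thesis using det_on_row_add[OF assms(1,3), of M "u r" "-1" "u s"] by simp
  qed
  let ?N = "M(r := u r)"
  \<comment> \<open>In \<open>?N\<close> row \<open>s\<close> may be replaced by the sum of all rows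
    of \<open>M\<close> outside \<open>r\<close>, which by the zero column sums is the negative of
    row \<open>r\<close>.\<close>
  have "det_on S ?N = det_on S (?N(s := \<lambda>j. \<Sum>x\<in>S-{r}. 1 * M x j))"
  proof -
    have "det_on S (?N(s := \<lambda>j. \<Sum>x\<in>S-{r}. 1 * M x j)) = (\<Sum>x\<in>S-{r}. 1 * det_on S (?N(s := M x)))"
      by (rule det_on_row_sum[OF assms(1,3), of ?N "\<lambda>_. 1" M])
    also have "\<dots> = (\<Sum>x\<in>S-{r}. if x = s then det_on S ?N else 0)"
    proof (intro sum.cong refl)
      fix x assume x: "x \<in> S - {r}"
      have "det_on S (?N(s := M x)) = 0" if "x \<noteq> s"
        by (rule det_on_identical_rows[OF assms(1), of s x]) (use that x assms(3) in auto)
      moreover have "?N(s := M s) = ?N" using False by auto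
      ultimately show "1 * det_on S (?N(s := M x)) = (if x = s then det_on S ?N else 0)"
        by auto
    qed
    also have "\<dots> = det_on S ?N" using assms False by simp
    finally show ?thesis by simp
  qed
  also have "\<dots> = det_on S (?N(s := \<lambda>j. \<Sum>x\<in>{r}. - 1 * M x j))"
  proof (rule det_on_cong[OF refl])
    fix i j assume "i \<in> S" "j \<in> S"
    have "(\<Sum>x\<in>S - {r}. M x j) = - M r j"
      using cols[OF \<open>j \<in> S\<close>] assms by (simp add: sum.remove[of S r])
    then show "(?N(s := \<lambda>j. \<Sum>x\<in>S-{r}. 1 * M x j)) i j = (?N(s := \<lambda>j. \<Sum>x\<in>{r}. - 1 * M x j)) i j"
      by simp
  qed
  also have "\<dots> = - det_on S (?N(s := M r))"
    using det_on_row_sum[OF assms(1,3), of ?N "\<lambda>_. -1" M "{r}"] by simp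
  also have "\<dots> = det_on S (M(s := u r))"
  proof -
    let ?r = "u r"
    \<comment> \<open>The sign change under exchange of two rows follows from bilinearity and
      \<open>B x x = 0\<close> by expanding \<open>B (x + y) (x + y)\<close>.\<close>
    define B where "B x y = det_on S (M(r := x, s := y))" for x y
    have B: "B x x = 0" for x
      unfolding B_def by (rule det_on_identical_rows[OF assms(1-3) False]) (use False in auto)
    have swap: "M(r := a, s := b) = M(s := b, r := a)" for a b using False by (simp add: fun_upd_twist)
    have Badd1: "B (\<lambda>j. a j + 1 * b j) c = B a c + B b c" for a b c
      unfolding B_def swap using det_on_row_add[OF assms(1,2), of "M(s := c)" a 1 b] by simp
    have Badd2: "B c (\<lambda>j. a j + 1 * b j) = B c a + B c b" for a b c
      unfolding B_def using det_on_row_add[OF assms(1,3), of "M(r := c)" a 1 b] by simp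
    have "B (\<lambda>j. ?r j + 1 * M r j) (\<lambda>j. ?r j + 1 * M r j) = 0" by (rule B)
    then have "B ?r (M r) + B (M r) ?r = 0" unfolding Badd1 Badd2 by (simp add: B)
    moreover have "B ?r (M r) = det_on S (?N(s := M r))" by (simp add: B_def)
    moreover have "B (M r) ?r = det_on S (M(s := u r))" by (simp add: B_def)
    ultimately show ?thesis by simp
  qed
  finally show ?thesis
    using cofactor minor[OF assms(2)] minor[OF assms(3)] by linarith
qed simp

section \<open>Differential operators as shifts of coefficients\<close>

definition mono_fact :: "('x \<Rightarrow>\<^sub>0 nat) \<Rightarrow> real" where
  "mono_fact \<mu> = (\<Prod>x\<in>Poly_Mapping.keys \<mu>. fact (Poly_Mapping.lookup \<mu> x))"

text \<open>The value at the origin of the partial derivative of \<open>p\<close> of multi-index \<open>\<mu>\<close>.\<close>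

definition taylor :: "(('x \<Rightarrow>\<^sub>0 nat) \<Rightarrow>\<^sub>0 real) \<Rightarrow> ('x \<Rightarrow>\<^sub>0 nat) \<Rightarrow> real" where
  "taylor p \<mu> = mono_fact \<mu> * Poly_Mapping.lookup p \<mu>"

lemma mono_fact_superset:
  assumes "finite A" "Poly_Mapping.keys \<mu> \<subseteq> A"
  shows "mono_fact \<mu> = (\<Prod>x\<in>A. fact (Poly_Mapping.lookup \<mu> x))"
  unfolding mono_fact_def
  by (rule prod.mono_neutral_left[OF assms]) (simp add: in_keys_iff)

lemma mono_fact_nonzero [simp]: "mono_fact \<mu> \<noteq> 0"
  by (simp add: mono_fact_def)

lemma mono_fact_zero [simp]: "mono_fact 0 = 1"
  by (simp add: mono_fact_def)

text \<open>This factor is the one that differentiation puts in front of a coefficient, so in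
  \<open>taylor\<close> a derivative becomes a shift without any factor.\<close>

lemma mono_fact_add_single:
  "mono_fact (\<mu> + Poly_Mapping.single x 1) = real (Poly_Mapping.lookup \<mu> x + 1) * mono_fact \<mu>"
proof -
  let ?A = "insert x (Poly_Mapping.keys \<mu>)"
  have sub: "Poly_Mapping.keys (\<mu> + Poly_Mapping.single x 1) \<subseteq> ?A"
    using keys_add[of \<mu> "Poly_Mapping.single x 1"] by (auto split: if_splits)
  have "mono_fact (\<mu> + Poly_Mapping.single x 1) =
      (\<Prod>y\<in>?A. fact (Poly_Mapping.lookup (\<mu> + Poly_Mapping.single x 1) y))"
    by (rule mono_fact_superset) (use sub in auto)
  also have "\<dots> = fact (Poly_Mapping.lookup \<mu> x + 1) *
      (\<Prod>y\<in>?A - {x}. fact (Poly_Mapping.lookup (\<mu> + Poly_Mapping.single x 1) y))"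
    by (subst prod.remove[of ?A x]) (auto simp: lookup_add)
  also have "(\<Prod>y\<in>?A - {x}. fact (Poly_Mapping.lookup (\<mu> + Poly_Mapping.single x 1) y)) =
      (\<Prod>y\<in>?A - {x}. fact (Poly_Mapping.lookup \<mu> y) :: real)"
    by (rule prod.cong) (auto simp: lookup_add lookup_single when_def)
  also have "fact (Poly_Mapping.lookup \<mu> x + 1) * \<dots> =
      real (Poly_Mapping.lookup \<mu> x + 1) * (\<Prod>y\<in>?A. fact (Poly_Mapping.lookup \<mu> y))"
    by (subst prod.remove[of ?A x]) auto
  also have "(\<Prod>y\<in>?A. fact (Poly_Mapping.lookup \<mu> y)) = mono_fact \<mu>"
    by (rule mono_fact_superset[symmetric]) auto
  finally show ?thesis .
qed

lemma taylor_zero: "taylor p 0 = Poly_Mapping.lookup p 0"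
  by (simp add: taylor_def)

lemma taylor_sum: "taylor (\<Sum>x\<in>A. p x) \<mu> = (\<Sum>x\<in>A. taylor (p x) \<mu>)"
  by (simp add: taylor_def lookup_sum sum_distrib_left)

text \<open>Polynomials, and hence operators on them, may be compared through \<open>taylor\<close>;
  this is how the row operators are shown to commute.\<close>

lemma taylor_inject: "taylor p = taylor q \<Longrightarrow> p = q"
  by (rule poly_mapping_eqI) (metis taylor_def mono_fact_nonzero mult_cancel_left)

lemma lookup_const_mult:
  fixes p :: "('x \<Rightarrow>\<^sub>0 nat) \<Rightarrow>\<^sub>0 real"
  shows "Poly_Mapping.lookup (Poly_Mapping.single 0 c * p) \<mu> = c * Poly_Mapping.lookup p \<mu>"
  unfolding mult_map_scale_conv_mult[symmetric]
  by (simp add: Poly_Mapping.map.rep_eq when_def)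

lemma taylor_const_mult: "taylor (Poly_Mapping.single 0 c * p) \<mu> = c * taylor p \<mu>"
  by (simp add: taylor_def lookup_const_mult)

lemma lookup_entry_deriv:
  "Poly_Mapping.lookup (entry_deriv x p) \<mu> =
     real (Poly_Mapping.lookup \<mu> x + 1) * Poly_Mapping.lookup p (\<mu> + Poly_Mapping.single x 1)"
proof -
  let ?s = "Poly_Mapping.single x (1::nat)"
  have termwise: "Poly_Mapping.lookup (Poly_Mapping.single (\<nu> - ?s)
       (real (Poly_Mapping.lookup \<nu> x) * Poly_Mapping.lookup p \<nu>)) \<mu> =
     (if \<nu> = \<mu> + ?s then real (Poly_Mapping.lookup \<mu> x + 1) * Poly_Mapping.lookup p (\<mu> + ?s) else 0)" for \<nu>
  proof (cases "\<nu> = \<mu> + ?s")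
    case True
    then show ?thesis by (simp add: lookup_add)
  next
    case False
    \<comment> \<open>Truncated subtraction also sends a monomial without \<open>x\<close> to
      itself. Such a monomial may hit \<open>\<mu>\<close>, but its coefficient in the derivative is
      zero.\<close>
    have "Poly_Mapping.lookup \<nu> x = 0" if eq: "\<nu> - ?s = \<mu>"
    proof (rule ccontr)
      assume nz: "Poly_Mapping.lookup \<nu> x \<noteq> 0"
      have "\<nu> = \<mu> + ?s"
      proof (rule poly_mapping_eqI)
        fix y
        show "Poly_Mapping.lookup \<nu> y = Poly_Mapping.lookup (\<mu> + ?s) y"
          using nz unfolding eq[symmetric]
          by (auto simp: lookup_add lookup_minus lookup_single when_def)
      qed
      with False show False by simp
    qed
    then show ?thesis using False by (auto simp: lookup_single when_def)
  qed
  show ?thesis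
    unfolding entry_deriv_def lookup_sum termwise
    by (simp add: in_keys_iff)
qed

lemma taylor_entry_deriv: "taylor (entry_deriv x p) \<mu> = taylor p (\<mu> + Poly_Mapping.single x 1)"
  by (simp add: taylor_def lookup_entry_deriv mono_fact_add_single[simplified])

lemma taylor_entry_derivs:
  "taylor (fold (\<lambda>j. entry_deriv (i, j)) js p) \<mu> =
     taylor p (\<mu> + (\<Sum>j\<leftarrow>js. Poly_Mapping.single (i, j) 1))"
  by (induction js arbitrary: p) (simp_all add: taylor_entry_deriv ac_simps)

lemma taylor_row_operator:
  "taylor (row_operator m V t i p) \<mu> = (\<Sum>js\<in>{js. length js = m - 1 \<and> set js \<subseteq> V}.
     t (i # js) * taylor p (\<mu> + (\<Sum>j\<leftarrow>js. Poly_Mapping.single (i, j) 1)))"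
  by (simp add: row_operator_def taylor_sum taylor_const_mult taylor_entry_derivs)

lemma comp_fun_commute_row_operator: "comp_fun_commute (row_operator m V t)"
proof
  fix i j
  have "row_operator m V t j (row_operator m V t i p) = row_operator m V t i (row_operator m V t j p)" for p
  proof (rule taylor_inject, rule ext)
    fix \<mu>
    show "taylor (row_operator m V t j (row_operator m V t i p)) \<mu> =
          taylor (row_operator m V t i (row_operator m V t j p)) \<mu>"
      unfolding taylor_row_operator sum_distrib_left
      by (subst sum.swap) (simp add: ac_simps)
  qed
  then show "row_operator m V t j \<circ> row_operator m V t i = row_operator m V t i \<circ> row_operator m V t j"
    by auto
qed

text \<open>Each edge through \<open>i\<close> occurs once for every ordering of its other vertices,
  and the \<open>fact (m - 1)\<close> orderings cancel the entry \<open>1 / fact (m - 1)\<close> of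
  the tensor.\<close>

lemma taylor_row_operator_adjacency:
  assumes H: "uniform_hypergraph m H" and "m \<ge> 1"
  shows "taylor (row_operator m (verts H) (adjacency_tensor m H) i p) \<mu> =
    (\<Sum>e\<in>{e \<in> edges H. i \<in> e}. taylor p (\<mu> + (\<Sum>j\<in>e - {i}. Poly_Mapping.single (i, j) 1)))"
proof -
  let ?J = "{js. length js = m - 1 \<and> set js \<subseteq> verts H}"
  let ?E = "{e \<in> edges H. i \<in> e}"
  let ?f = "\<lambda>js. adjacency_tensor m H (i # js) *
    taylor p (\<mu> + (\<Sum>j\<leftarrow>js. Poly_Mapping.single (i, j) 1))"
  have fin: "finite (verts H)" and sub: "\<And>e. e \<in> edges H \<Longrightarrow> e \<subseteq> verts H"
    and card: "\<And>e. e \<in> edges H \<Longrightarrow> card e = m"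
    using H by (auto simp: uniform_hypergraph_def)
  have fe: "finite e" if "e \<in> edges H" for e using finite_subset[OF sub fin] that by blast
  have finE: "finite ?E"
    by (rule finite_subset[of _ "Pow (verts H)"]) (use sub fin in auto)
  have finJ: "finite ?J"
    by (rule finite_subset[OF _ finite_lists_length_eq[OF fin, of "m - 1"]]) auto
  \<comment> \<open>An edge has \<open>m\<close> vertices, so a list of length \<open>m - 1\<close>
    that completes \<open>i\<close> to an edge can neither repeat a vertex nor contain
    \<open>i\<close>.\<close>
  have perm: "js \<in> permutations_of_set (insert i (set js) - {i})"
    if js: "js \<in> ?J" "insert i (set js) \<in> edges H" for js
  proof -
    have c: "card (insert i (set js)) = m" using js card by simp
    have l: "length js = m - 1" using js by simp
    have "card (set js) \<le> m - 1" using card_length[of js] l by simp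
    then have i: "i \<notin> set js" using c \<open>m \<ge> 1\<close> by (auto simp: insert_absorb)
    then have "card (set js) = length js" using c l by simp
    then have "distinct js" by (rule card_distinct)
    then show ?thesis using i by (simp add: permutations_of_set_def)
  qed
  have "sum ?f ?J = sum ?f (\<Union>e\<in>?E. permutations_of_set (e - {i}))"
  proof (rule sum.mono_neutral_right[OF finJ])
    show "(\<Union>e\<in>?E. permutations_of_set (e - {i})) \<subseteq> ?J"
    proof safe
      fix e js x assume e: "e \<in> edges H" "i \<in> e" and js: "js \<in> permutations_of_set (e - {i})"
      have d: "distinct js" "set js = e - {i}" using js by (auto simp: permutations_of_set_def)
      then show "length js = m - 1"
        using e card fe[OF e(1)] by (metis card_Diff_singleton distinct_card)
      show "x \<in> verts H" if "x \<in> set js" using d that sub[OF e(1)] by auto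
    qed
    show "\<forall>js\<in>?J - (\<Union>e\<in>?E. permutations_of_set (e - {i})). ?f js = 0"
      using perm by (auto simp: adjacency_tensor_def)
  qed
  also have "\<dots> = (\<Sum>e\<in>?E. sum ?f (permutations_of_set (e - {i})))"
  proof (rule sum.UNION_disjoint[OF finE])
    show "\<forall>e\<in>?E. \<forall>e'\<in>?E. e \<noteq> e' \<longrightarrow>
        permutations_of_set (e - {i}) \<inter> permutations_of_set (e' - {i}) = {}"
      by (auto simp: permutations_of_set_def)
  qed auto
  also have "\<dots> = (\<Sum>e\<in>?E. taylor p (\<mu> + (\<Sum>j\<in>e - {i}. Poly_Mapping.single (i, j) 1)))"
  proof (rule sum.cong[OF refl])
    fix e assume e: "e \<in> ?E"
    have "sum ?f (permutations_of_set (e - {i})) = (\<Sum>js\<in>permutations_of_set (e - {i}).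
        1 / fact (m - 1) * taylor p (\<mu> + (\<Sum>j\<in>e - {i}. Poly_Mapping.single (i, j) 1)))"
    proof (rule sum.cong[OF refl])
      fix js assume "js \<in> permutations_of_set (e - {i})"
      then have d: "distinct js" "set js = e - {i}" by (auto simp: permutations_of_set_def)
      have "set (i # js) = e" using d e by auto
      then show "?f js = 1 / fact (m - 1) *
          taylor p (\<mu> + (\<Sum>j\<in>e - {i}. Poly_Mapping.single (i, j) 1))"
        using e d sum_list_distinct_conv_sum_set[OF d(1), of "\<lambda>j. Poly_Mapping.single (i, j) (1::nat)"]
        by (simp add: adjacency_tensor_def)
    qed
    also have "\<dots> = taylor p (\<mu> + (\<Sum>j\<in>e - {i}. Poly_Mapping.single (i, j) 1))"
      using e card fe by simp
    finally show "sum ?f (permutations_of_set (e - {i})) =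
      taylor p (\<mu> + (\<Sum>j\<in>e - {i}. Poly_Mapping.single (i, j) 1))" .
  qed
  finally show ?thesis by (simp add: taylor_row_operator)
qed

section \<open>Multinomial expansion of powers and products of operators\<close>

definition multinom :: "'e set \<Rightarrow> ('e \<Rightarrow> nat) \<Rightarrow> real" where
  "multinom I k = fact (sum k I) / (\<Prod>e\<in>I. fact (k e))"

definition compositions :: "'e set \<Rightarrow> nat \<Rightarrow> ('e \<Rightarrow> nat) set" where
  "compositions I n = {k \<in> I \<rightarrow>\<^sub>E UNIV. sum k I = n}"

lemma finite_compositions [simp]:
  assumes "finite I"
  shows "finite (compositions I n)"
proof (rule finite_subset)
  show "compositions I n \<subseteq> I \<rightarrow>\<^sub>E {..n}"
  proof
    fix k assume k: "k \<in> compositions I n"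
    have "k e \<le> sum k I" if "e \<in> I" for e
      by (rule member_le_sum) (use that assms in auto)
    then show "k \<in> I \<rightarrow>\<^sub>E {..n}"
      using k by (auto simp: compositions_def PiE_iff)
  qed
qed (use assms in \<open>auto intro: finite_PiE\<close>)

text \<open>Pascal's rule: split according to the element \<open>e\<close> that is chosen in one
  distinguished draw.\<close>

lemma multinom_Suc:
  assumes "finite I" "k \<in> compositions I (Suc n)"
  shows "multinom I k = (\<Sum>e\<in>I. if 0 < k e then multinom I (k(e := k e - 1)) else 0)"
proof -
  have "(if 0 < k e then multinom I (k(e := k e - 1)) else 0) =
     fact n * real (k e) / (\<Prod>e\<in>I. fact (k e))" if e: "e \<in> I" for e
  proof (cases "0 < k e")
    case True
    have "sum (k(e := k e - 1)) I = n"
      using assms e True by (simp add: compositions_def sum.remove[of I e])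
    moreover have "(\<Prod>x\<in>I. fact (k x)) = (\<Prod>x\<in>I. fact ((k(e := k e - 1)) x)) * real (k e)"
      unfolding prod.remove[OF assms(1) e]
      using True by (simp add: fact_reduce[of "k e"])
    ultimately show ?thesis
      using True by (simp add: multinom_def del: fun_upd_apply)
  qed simp
  then have "(\<Sum>e\<in>I. if 0 < k e then multinom I (k(e := k e - 1)) else 0) =
     (\<Sum>e\<in>I. fact n * real (k e) / (\<Prod>e\<in>I. fact (k e)))" by simp
  also have "\<dots> = fact n * real (sum k I) / (\<Prod>e\<in>I. fact (k e))"
    by (simp add: sum_divide_distrib[symmetric] sum_distrib_left[symmetric])
  also have "\<dots> = multinom I k" using assms by (simp add: multinom_def compositions_def)
  finally show ?thesis by simp
qed

text \<open>The multinomial theorem for a sum of commuting shifts. Exponents form just an additive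
  monoid, so the multiple of \<open>s e\<close> is written as a sum of \<open>k e\<close> equal
  terms.\<close>

lemma taylor_funpow:
  assumes "finite I" and g: "\<And>p \<mu>. taylor (g p) \<mu> = (\<Sum>e\<in>I. taylor p (\<mu> + s e))"
  shows "taylor ((g ^^ n) p) \<mu> =
    (\<Sum>k\<in>compositions I n. multinom I k * taylor p (\<mu> + (\<Sum>e\<in>I. \<Sum>_<k e. s e)))"
proof (induction n arbitrary: \<mu>)
  case 0
  have "compositions I 0 = {\<lambda>e\<in>I. 0}"
    using assms(1) by (auto simp: compositions_def PiE_def extensional_def fun_eq_iff restrict_def)
  then show ?case by (simp add: multinom_def)
next
  case (Suc n)
  let ?h = "\<lambda>k. taylor p (\<mu> + (\<Sum>e\<in>I. \<Sum>_<k e. s e))"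
  have step: "(\<Sum>k\<in>compositions I n. multinom I k * taylor p (\<mu> + s e + (\<Sum>e\<in>I. \<Sum>_<k e. s e))) =
     (\<Sum>k\<in>{k \<in> compositions I (Suc n). 0 < k e}. multinom I (k(e := k e - 1)) * ?h k)"
    if e: "e \<in> I" for e
  proof (rule sum.reindex_bij_witness[of _ "\<lambda>k. k(e := k e - 1)" "\<lambda>k. k(e := k e + 1)"])
    fix k assume "k \<in> compositions I n"
    then show "k(e := k e + 1) \<in> {k \<in> compositions I (Suc n). 0 < k e}"
      using e assms(1) by (auto simp: compositions_def PiE_def extensional_def sum.remove[of I e])
    have "(\<Sum>x\<in>I. \<Sum>_<(k(e := k e + 1)) x. s x) = s e + (\<Sum>x\<in>I. \<Sum>_<k x. s x)"
      using e assms(1) by (simp add: sum.remove[of I e] ac_simps)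
    then show "multinom I ((k(e := k e + 1))(e := (k(e := k e + 1)) e - 1)) * ?h (k(e := k e + 1)) =
      multinom I k * taylor p (\<mu> + s e + (\<Sum>e\<in>I. \<Sum>_<k e. s e))"
      by (simp add: ac_simps)
  next
    fix k assume "k \<in> {k \<in> compositions I (Suc n). 0 < k e}"
    then show "k(e := k e - 1) \<in> compositions I n"
      using e assms(1) by (auto simp: compositions_def PiE_def extensional_def sum.remove[of I e])
  qed auto
  have "taylor ((g ^^ Suc n) p) \<mu> = (\<Sum>e\<in>I. \<Sum>k\<in>compositions I n.
      multinom I k * taylor p (\<mu> + s e + (\<Sum>e\<in>I. \<Sum>_<k e. s e)))"
    by (simp add: g Suc.IH)
  also have "\<dots> = (\<Sum>e\<in>I. \<Sum>k\<in>compositions I (Suc n).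
      (if 0 < k e then multinom I (k(e := k e - 1)) else 0) * ?h k)"
  proof (rule sum.cong[OF refl])
    fix e assume "e \<in> I"
    show "(\<Sum>k\<in>compositions I n. multinom I k * taylor p (\<mu> + s e + (\<Sum>e\<in>I. \<Sum>_<k e. s e))) =
      (\<Sum>k\<in>compositions I (Suc n). (if 0 < k e then multinom I (k(e := k e - 1)) else 0) * ?h k)"
      unfolding step[OF \<open>e \<in> I\<close>] using assms(1)
      by (intro sum.mono_neutral_cong_left) auto
  qed
  also have "\<dots> = (\<Sum>k\<in>compositions I (Suc n). multinom I k * ?h k)"
    using multinom_Suc[OF assms(1)] by (subst sum.swap) (simp add: sum_distrib_right)
  finally show ?case .
qed

lemma taylor_fold_funpow:
  assumes "finite V" "comp_fun_commute g" "\<And>i. i \<in> V \<Longrightarrow> finite (I i)"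
    and g: "\<And>i p \<mu>. i \<in> V \<Longrightarrow> taylor (g i p) \<mu> = (\<Sum>e\<in>I i. taylor p (\<mu> + s i e))"
  shows "taylor (Finite_Set.fold (\<lambda>i. g i ^^ \<delta> i) p V) \<mu> =
    (\<Sum>K\<in>(\<Pi>\<^sub>E i\<in>V. compositions (I i) (\<delta> i)). (\<Prod>i\<in>V. multinom (I i) (K i)) *
       taylor p (\<mu> + (\<Sum>i\<in>V. \<Sum>e\<in>I i. \<Sum>_<K i e. s i e)))"
  using assms(1,3,4)
proof (induction V arbitrary: \<mu>)
  case empty
  then show ?case by simp
next
  case (insert x V)
  interpret comp_fun_commute "\<lambda>i. g i ^^ \<delta> i"
    by (rule comp_fun_commute.comp_fun_commute_funpow[OF assms(2)])
  let ?C = "\<lambda>i. compositions (I i) (\<delta> i)"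
  let ?T = "\<lambda>V K. (\<Prod>i\<in>V. multinom (I i) (K i)) *
     taylor p (\<mu> + (\<Sum>i\<in>V. \<Sum>e\<in>I i. \<Sum>_<K i e. s i e))"
  have upd: "?T (insert x V) (K(x := k)) = multinom (I x) k * ((\<Prod>i\<in>V. multinom (I i) (K i)) *
     taylor p (\<mu> + (\<Sum>e\<in>I x. \<Sum>_<k e. s x e) + (\<Sum>i\<in>V. \<Sum>e\<in>I i. \<Sum>_<K i e. s i e)))" for K k
  proof -
    have "(\<Prod>i\<in>V. multinom (I i) ((K(x := k)) i)) = (\<Prod>i\<in>V. multinom (I i) (K i))"
      using insert.hyps by (intro prod.cong) auto
    moreover have "(\<Sum>i\<in>V. \<Sum>e\<in>I i. \<Sum>_<(K(x := k)) i e. s i e) = (\<Sum>i\<in>V. \<Sum>e\<in>I i. \<Sum>_<K i e. s i e)"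
      using insert.hyps by (intro sum.cong) auto
    ultimately show ?thesis
      using insert.hyps by (simp add: ac_simps)
  qed
  have "taylor (Finite_Set.fold (\<lambda>i. g i ^^ \<delta> i) p (insert x V)) \<mu> =
     taylor ((g x ^^ \<delta> x) (Finite_Set.fold (\<lambda>i. g i ^^ \<delta> i) p V)) \<mu>"
    using insert.hyps by simp
  also have "\<dots> = (\<Sum>k\<in>?C x. multinom (I x) k *
      taylor (Finite_Set.fold (\<lambda>i. g i ^^ \<delta> i) p V) (\<mu> + (\<Sum>e\<in>I x. \<Sum>_<k e. s x e)))"
    by (rule taylor_funpow) (use insert.prems in auto)
  also have "\<dots> = (\<Sum>k\<in>?C x. \<Sum>K\<in>PiE V ?C. ?T (insert x V) (K(x := k)))"
    unfolding upd using insert by (simp add: sum_distrib_left)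
  also have "\<dots> = (\<Sum>(k, K)\<in>?C x \<times> PiE V ?C. ?T (insert x V) (K(x := k)))"
    by (rule sum.cartesian_product)
  also have "\<dots> = sum (?T (insert x V)) ((\<lambda>(k, K). K(x := k)) ` (?C x \<times> PiE V ?C))"
    by (subst sum.reindex[OF inj_combinator[OF insert.hyps(2)]]) (simp add: case_prod_unfold)
  also have "(\<lambda>(k, K). K(x := k)) ` (?C x \<times> PiE V ?C) = PiE (insert x V) ?C"
    by (rule PiE_insert_eq[symmetric])
  finally show ?case .
qed

text \<open>The vector \<open>\<delta>\<close> consists of the row sums of \<open>K\<close>. Summing
  over \<open>\<delta>\<close> and then over all \<open>K\<close> with these row sums is therefore a
  single sum over all \<open>K\<close> of total \<open>d\<close>.\<close>

lemma tensor_trace_expansion: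
  fixes I :: "'v \<Rightarrow> 'e set" and V :: "'v set"
  assumes V: "finite V" and I: "\<And>i. i \<in> V \<Longrightarrow> finite (I i)"
    and row: "\<And>i p \<mu>. i \<in> V \<Longrightarrow>
      taylor (row_operator m V t i p) \<mu> = (\<Sum>e\<in>I i. taylor p (\<mu> + s i e))"
  shows "tensor_trace m V t d = real (m - 1) ^ (card V - 1) *
    (\<Sum>K\<in>{K \<in> \<Pi>\<^sub>E i\<in>V. I i \<rightarrow>\<^sub>E UNIV. (\<Sum>i\<in>V. sum (K i) (I i)) = d}.
       (\<Prod>i\<in>V. multinom (I i) (K i) / fact (sum (K i) (I i) * (m - 1))) *
       (\<Sum>r\<in>V. taylor (matrix_power V entry (d * (m - 1)) r r)
          (\<Sum>i\<in>V. \<Sum>e\<in>I i. \<Sum>_<K i e. s i e)))"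
proof -
  let ?P = "matrix_trace V (matrix_power V entry (d * (m - 1)))"
  let ?\<mu> = "\<lambda>K. \<Sum>i\<in>V. \<Sum>e\<in>I i. \<Sum>_<K i e. s i e"
  let ?D = "{\<delta> \<in> V \<rightarrow>\<^sub>E UNIV. sum \<delta> V = d}"
  let ?\<K> = "\<lambda>\<delta>. \<Pi>\<^sub>E i\<in>V. compositions (I i) (\<delta> i)"
  let ?T = "\<lambda>K. (\<Prod>i\<in>V. multinom (I i) (K i) / fact (sum (K i) (I i) * (m - 1))) * taylor ?P (?\<mu> K)"
  have termwise: "(\<Prod>i\<in>V. 1 / fact (\<delta> i * (m - 1))) *
     Poly_Mapping.lookup (Finite_Set.fold (\<lambda>i. row_operator m V t i ^^ \<delta> i) ?P V) 0 =
     (\<Sum>K\<in>?\<K> \<delta>. ?T K)" for \<delta>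
  proof -
    have "Poly_Mapping.lookup (Finite_Set.fold (\<lambda>i. row_operator m V t i ^^ \<delta> i) ?P V) 0 =
      (\<Sum>K\<in>?\<K> \<delta>. (\<Prod>i\<in>V. multinom (I i) (K i)) * taylor ?P (?\<mu> K))"
      using taylor_fold_funpow[OF V comp_fun_commute_row_operator I row, of \<delta> ?P 0]
      by (simp add: taylor_zero)
    moreover have "(\<Prod>i\<in>V. 1 / fact (\<delta> i * (m - 1))) * ((\<Prod>i\<in>V. multinom (I i) (K i)) * taylor ?P (?\<mu> K)) = ?T K"
      if K: "K \<in> ?\<K> \<delta>" for K
    proof -
      have "(\<Prod>i\<in>V. multinom (I i) (K i) / fact (sum (K i) (I i) * (m - 1))) =
         (\<Prod>i\<in>V. 1 / fact (\<delta> i * (m - 1)) * multinom (I i) (K i))"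
        using K by (intro prod.cong) (auto simp: compositions_def PiE_iff)
      then show ?thesis by (simp only: prod.distrib mult.assoc)
    qed
    ultimately show ?thesis
      by (simp only: sum_distrib_left cong: sum.cong)
  qed
  have finD: "finite ?D"
    using finite_compositions[OF V, of d] by (simp add: compositions_def)
  have "(\<Sum>\<delta>\<in>?D. \<Sum>K\<in>?\<K> \<delta>. ?T K) = sum ?T (\<Union>\<delta>\<in>?D. ?\<K> \<delta>)"
  proof (rule sum.UNION_disjoint[symmetric, OF finD])
    show "\<forall>\<delta>\<in>?D. finite (?\<K> \<delta>)" using V I by (auto intro!: finite_PiE)
    show "\<forall>\<delta>\<in>?D. \<forall>\<delta>'\<in>?D. \<delta> \<noteq> \<delta>' \<longrightarrow> ?\<K> \<delta> \<inter> ?\<K> \<delta>' = {}"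
    proof (intro ballI impI, rule ccontr)
      fix \<delta> \<delta>' assume \<delta>: "\<delta> \<in> ?D" "\<delta>' \<in> ?D" "\<delta> \<noteq> \<delta>'" and "?\<K> \<delta> \<inter> ?\<K> \<delta>' \<noteq> {}"
      then obtain K where "K \<in> ?\<K> \<delta>" "K \<in> ?\<K> \<delta>'" by auto
      then have "\<delta> i = \<delta>' i" if "i \<in> V" for i
        using that by (auto simp: compositions_def PiE_iff)
      then have "\<delta> = \<delta>'" using \<delta> by (intro PiE_ext[of _ V "\<lambda>_. UNIV"]) auto
      with \<delta> show False by simp
    qed
  qed
  also have "(\<Union>\<delta>\<in>?D. ?\<K> \<delta>) = {K \<in> \<Pi>\<^sub>E i\<in>V. I i \<rightarrow>\<^sub>E UNIV. (\<Sum>i\<in>V. sum (K i) (I i)) = d}"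
  proof (intro equalityI subsetI)
    fix K assume "K \<in> (\<Union>\<delta>\<in>?D. ?\<K> \<delta>)"
    then obtain \<delta> where \<delta>: "sum \<delta> V = d" "K \<in> ?\<K> \<delta>" by auto
    then have "(\<Sum>i\<in>V. sum (K i) (I i)) = sum \<delta> V"
      by (intro sum.cong) (auto simp: compositions_def PiE_iff)
    then show "K \<in> {K \<in> \<Pi>\<^sub>E i\<in>V. I i \<rightarrow>\<^sub>E UNIV. (\<Sum>i\<in>V. sum (K i) (I i)) = d}"
      using \<delta> by (auto simp: compositions_def PiE_iff)
  next
    fix K assume "K \<in> {K \<in> \<Pi>\<^sub>E i\<in>V. I i \<rightarrow>\<^sub>E UNIV. (\<Sum>i\<in>V. sum (K i) (I i)) = d}"
    then have K: "K \<in> (\<Pi>\<^sub>E i\<in>V. I i \<rightarrow>\<^sub>E UNIV)" and "(\<Sum>i\<in>V. sum (K i) (I i)) = d"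
      by auto
    then show "K \<in> (\<Union>\<delta>\<in>?D. ?\<K> \<delta>)"
      by (intro UN_I[of "\<lambda>i\<in>V. sum (K i) (I i)"]) (auto simp: compositions_def PiE_iff)
  qed
  finally show ?thesis
    unfolding tensor_trace_def termwise by (simp add: matrix_trace_def taylor_sum)
qed

section \<open>Counting closed walks with prescribed arc multiplicities\<close>

definition outdeg :: "'v set \<Rightarrow> ('v \<times> 'v \<Rightarrow>\<^sub>0 nat) \<Rightarrow> 'v \<Rightarrow> nat" where
  "outdeg V \<mu> v = (\<Sum>b\<in>V. Poly_Mapping.lookup \<mu> (v, b))"

definition indeg :: "'v set \<Rightarrow> ('v \<times> 'v \<Rightarrow>\<^sub>0 nat) \<Rightarrow> 'v \<Rightarrow> nat" where
  "indeg V \<mu> v = (\<Sum>a\<in>V. Poly_Mapping.lookup \<mu> (a, v))"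

text \<open>A vertex without outgoing arcs has a zero row in the Laplacian and would make the minors
  containing it vanish.\<close>

definition active :: "'v set \<Rightarrow> ('v \<times> 'v \<Rightarrow>\<^sub>0 nat) \<Rightarrow> 'v set" where
  "active V \<mu> = {v \<in> V. 0 < outdeg V \<mu> v}"

text \<open>Out-degree Laplacian of a directed multigraph; its minor at \<open>r\<close> is the
  number of spanning trees directed towards \<open>r\<close>, as it occurs in the BEST
  formula.\<close>

definition laplacian :: "'v set \<Rightarrow> ('v \<times> 'v \<Rightarrow>\<^sub>0 nat) \<Rightarrow> 'v \<Rightarrow> 'v \<Rightarrow> real" where
  "laplacian V \<mu> a b = (if a = b then real (outdeg V \<mu> a) else 0) - real (Poly_Mapping.lookup \<mu> (a, b))"

text \<open>The number of walks from \<open>i\<close> to \<open>j\<close> that use every arc of a multigraph with arc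
  multiplicities \<open>\<mu>\<close> exactly once; the factorials in \<open>taylor\<close> distinguish parallel arcs.\<close>

definition trails :: "'v set \<Rightarrow> nat \<Rightarrow> 'v \<Rightarrow> 'v \<Rightarrow> ('v \<times> 'v \<Rightarrow>\<^sub>0 nat) \<Rightarrow> real" where
  "trails V L i j \<mu> = taylor (matrix_power V entry L i j) \<mu>"

text \<open>Matrix powers are defined by multiplication from the right, whereas the induction on
  walks splits off the first arc.\<close>

lemma matrix_power_Suc_left:
  assumes "finite V" "i \<in> V" "j \<in> V"
  shows "matrix_power V A (Suc k) i j = (\<Sum>l\<in>V. A i l * matrix_power V A k l j)"
  using assms(3)
proof (induction k arbitrary: j)
  case 0
  have "(\<Sum>l\<in>V. matrix_power V A 0 i l * A l j) = (\<Sum>l\<in>V. if l = i then A i j else 0)"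
    by (intro sum.cong) auto
  also have "\<dots> = (\<Sum>l\<in>V. A i l * matrix_power V A 0 l j)"
  proof -
    have "(\<Sum>l\<in>V. A i l * matrix_power V A 0 l j) = (\<Sum>l\<in>V. if l = j then A i j else 0)"
      by (intro sum.cong) auto
    then show ?thesis using assms 0 by simp
  qed
  finally show ?case by simp
next
  case (Suc k)
  have "matrix_power V A (Suc (Suc k)) i j = (\<Sum>l\<in>V. matrix_power V A (Suc k) i l * A l j)"
    by (rule matrix_power.simps)
  also have "\<dots> = (\<Sum>l\<in>V. (\<Sum>h\<in>V. A i h * matrix_power V A k h l) * A l j)"
    using Suc.IH by (intro sum.cong) auto
  also have "\<dots> = (\<Sum>h\<in>V. \<Sum>l\<in>V. A i h * (matrix_power V A k h l * A l j))"
    unfolding sum_distrib_right mult.assoc by (rule sum.swap)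
  also have "\<dots> = (\<Sum>h\<in>V. A i h * matrix_power V A (Suc k) h j)"
    by (simp add: sum_distrib_left)
  finally show ?case .
qed

lemma lookup_entry_mult:
  "Poly_Mapping.lookup (entry i l * q) \<mu> = (if 0 < Poly_Mapping.lookup \<mu> (i, l)
     then Poly_Mapping.lookup q (\<mu> - Poly_Mapping.single (i, l) 1) else 0)"
proof -
  let ?s = "Poly_Mapping.single (i, l) (1::nat)"
  have "Poly_Mapping.lookup (entry i l * q) \<mu> =
      (\<Sum>k. Poly_Mapping.lookup (entry i l) k * (\<Sum>h. Poly_Mapping.lookup q h when \<mu> = k + h))"
    by (simp add: lookup_mult)
  also have "\<dots> = (\<Sum>k. (\<Sum>h. Poly_Mapping.lookup q h when \<mu> = ?s + h) when k = ?s)"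
    by (intro Sum_any.cong) (auto simp: entry_def lookup_single when_def)
  also have "\<dots> = (\<Sum>h. Poly_Mapping.lookup q h when \<mu> = ?s + h)" by simp
  also have "\<dots> = (if 0 < Poly_Mapping.lookup \<mu> (i, l) then Poly_Mapping.lookup q (\<mu> - ?s) else 0)"
  proof (cases "0 < Poly_Mapping.lookup \<mu> (i, l)")
    case True
    then have "\<mu> = ?s + h \<longleftrightarrow> h = \<mu> - ?s" for h
      by (auto simp: poly_mapping_eq_iff fun_eq_iff lookup_add lookup_minus lookup_single when_def)
    then show ?thesis using True by simp
  next
    case False
    then have "\<mu> \<noteq> ?s + h" for h by (auto simp: lookup_add)
    then show ?thesis using False by simp
  qed
  finally show ?thesis .
qed

lemma trails_0: "trails V 0 i j \<mu> = (if i = j \<and> \<mu> = 0 then 1 else 0)"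
  by (simp add: trails_def taylor_def lookup_one when_def)

text \<open>The first arc is one of the parallel arcs from \<open>i\<close> to \<open>l\<close>;
  algebraically their number is the quotient of \<open>mono_fact\<close> before and after the
  removal of one of them.\<close>

lemma trails_Suc:
  assumes "finite V" "i \<in> V" "j \<in> V"
  shows "trails V (Suc L) i j \<mu> = (\<Sum>l\<in>V. real (Poly_Mapping.lookup \<mu> (i, l)) *
           trails V L l j (\<mu> - Poly_Mapping.single (i, l) (Suc 0)))"
proof -
  have "taylor (entry i l * q) \<mu> = real (Poly_Mapping.lookup \<mu> (i, l)) *
      taylor q (\<mu> - Poly_Mapping.single (i, l) 1)" for l q
  proof (cases "0 < Poly_Mapping.lookup \<mu> (i, l)")
    case True
    let ?s = "Poly_Mapping.single (i, l) (1::nat)"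
    have "\<mu> = (\<mu> - ?s) + ?s"
      using True by (intro poly_mapping_eqI) (auto simp: lookup_add lookup_minus lookup_single when_def)
    then have "mono_fact \<mu> = real (Poly_Mapping.lookup \<mu> (i, l)) * mono_fact (\<mu> - ?s)"
      using mono_fact_add_single[of "\<mu> - ?s" "(i, l)"] True by (simp add: lookup_minus)
    then show ?thesis using True by (simp add: taylor_def lookup_entry_mult)
  qed (simp add: taylor_def lookup_entry_mult)
  then show ?thesis
    unfolding trails_def matrix_power_Suc_left[OF assms] taylor_sum by simp
qed

lemma outdeg_minus:
  assumes "finite V" "l \<in> V" "0 < Poly_Mapping.lookup \<mu> (i, l)"
  shows "outdeg V (\<mu> - Poly_Mapping.single (i, l) (Suc 0)) v = outdeg V \<mu> v - (if v = i then 1 else 0)"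
proof (cases "v = i")
  case True
  have "(\<Sum>b\<in>V - {l}. Poly_Mapping.lookup (\<mu> - Poly_Mapping.single (i, l) (Suc 0)) (i, b)) =
      (\<Sum>b\<in>V - {l}. Poly_Mapping.lookup \<mu> (i, b))"
    by (rule sum.cong) (auto simp: lookup_minus lookup_single when_def)
  then show ?thesis
    unfolding outdeg_def True sum.remove[OF assms(1,2)]
    using assms(3) by (simp add: lookup_minus)
qed (auto simp: outdeg_def lookup_minus lookup_single when_def intro!: sum.cong)

lemma indeg_minus:
  assumes "finite V" "i \<in> V" "0 < Poly_Mapping.lookup \<mu> (i, l)"
  shows "indeg V (\<mu> - Poly_Mapping.single (i, l) (Suc 0)) v = indeg V \<mu> v - (if v = l then 1 else 0)"
proof (cases "v = l")
  case True
  have "(\<Sum>a\<in>V - {i}. Poly_Mapping.lookup (\<mu> - Poly_Mapping.single (i, l) (Suc 0)) (a, l)) =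
      (\<Sum>a\<in>V - {i}. Poly_Mapping.lookup \<mu> (a, l))"
    by (rule sum.cong) (auto simp: lookup_minus lookup_single when_def)
  then show ?thesis
    unfolding indeg_def True sum.remove[OF assms(1,2)]
    using assms(3) by (simp add: lookup_minus)
qed (auto simp: indeg_def lookup_minus lookup_single when_def intro!: sum.cong)

lemma outdeg_ge:
  assumes "finite V" "l \<in> V"
  shows "Poly_Mapping.lookup \<mu> (i, l) \<le> outdeg V \<mu> i"
  unfolding outdeg_def by (rule member_le_sum) (use assms in auto)

lemma indeg_ge:
  assumes "finite V" "i \<in> V"
  shows "Poly_Mapping.lookup \<mu> (i, l) \<le> indeg V \<mu> l"
  unfolding indeg_def by (rule member_le_sum) (use assms in auto)

text \<open>Splitting off the first arc \<open>(i, l)\<close> lowers the out-degree of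
  \<open>i\<close> and the in-degree of \<open>l\<close> and moves the start from \<open>i\<close>
  to \<open>l\<close>. The indicators stand on both sides because degrees are natural
  numbers.\<close>

lemma trails_balanced:
  assumes "finite V" "i \<in> V" "r \<in> V" "trails V L i r \<mu> \<noteq> 0" "v \<in> V"
  shows "outdeg V \<mu> v + (if v = r then 1 else 0) = indeg V \<mu> v + (if v = i then 1 else 0)"
  using assms(2,4)
proof (induction L arbitrary: i \<mu>)
  case 0
  then show ?case by (auto simp: trails_0 outdeg_def indeg_def split: if_splits)
next
  case (Suc L)
  obtain l where l: "l \<in> V" "0 < Poly_Mapping.lookup \<mu> (i, l)"
    "trails V L l r (\<mu> - Poly_Mapping.single (i, l) (Suc 0)) \<noteq> 0"
    using Suc.prems(2) unfolding trails_Suc[OF assms(1) Suc.prems(1) assms(3)]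
    by (metis (no_types, lifting) gr0I mult_eq_0_iff of_nat_0 sum.neutral)
  have "0 < outdeg V \<mu> i" "0 < indeg V \<mu> l"
    using outdeg_ge[OF assms(1) l(1), of \<mu> i] indeg_ge[OF assms(1) Suc.prems(1), of \<mu> l] l(2) by auto
  then show ?case
    using Suc.IH[OF l(1,3)] outdeg_minus[OF assms(1) l(1,2), of v]
      indeg_minus[OF assms(1) Suc.prems(1) l(2), of v]
    by (auto split: if_splits)
qed

text \<open>The BEST theorem.  Writing \<open>\<tau>\<close> for the Laplacian minor at \<open>r\<close> and \<open>o\<close> for the out-degree of
  the first vertex \<open>i\<close>, removing the first arc \<open>(i, l)\<close> reduces the induction step to
  \<open>(o - 1) \<tau>(\<mu>) = \<Sum>l. \<mu>(i, l) \<tau>(\<mu> - (i, l))\<close>, which is linearity of the determinant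
  in the row \<open>i\<close>.\<close>

theorem trails_eq_det:
  assumes V: "finite V" and i: "i \<in> V" and r: "r \<in> V"
    and keys: "Poly_Mapping.keys \<mu> \<subseteq> V \<times> V"
    and bal: "\<And>v. v \<in> V \<Longrightarrow>
      outdeg V \<mu> v + (if v = r then 1 else 0) = indeg V \<mu> v + (if v = i then 1 else 0)"
    and L: "sum (outdeg V \<mu>) V = L"
  shows "trails V L i r \<mu> = det_on (active V \<mu> - {r}) (laplacian V \<mu>) * fact (outdeg V \<mu> r) *
           (\<Prod>v\<in>active V \<mu> - {r}. fact (outdeg V \<mu> v - 1))"
  using i keys bal L
proof (induction L arbitrary: i \<mu>)
  case 0
  have "Poly_Mapping.lookup \<mu> x = 0" for x
  proof (cases "x \<in> Poly_Mapping.keys \<mu>")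
    case True
    then obtain a b where x: "x = (a, b)" "a \<in> V" "b \<in> V" using "0.prems" by auto
    then show ?thesis using "0.prems"(4) outdeg_ge[OF V x(3), of \<mu> a] V by simp
  qed (simp add: in_keys_iff)
  then have "\<mu> = 0" by (simp add: poly_mapping_eqI)
  moreover have "i = r" using "0.prems"(3)[OF r] \<open>\<mu> = 0\<close> by (simp add: outdeg_def indeg_def split: if_splits)
  ultimately show ?case by (simp add: trails_0 active_def outdeg_def)
next
  case (Suc L)
  note i = Suc.prems(1) and keys = Suc.prems(2) and bal = Suc.prems(3)
  define S where "S = active V \<mu>"
  have finS: "finite S" using V by (simp add: S_def active_def)
  let ?\<mu> = "\<lambda>l. \<mu> - Poly_Mapping.single (i, l) (Suc 0)"
  let ?n = "\<lambda>l. Poly_Mapping.lookup \<mu> (i, l)"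
  \<comment> \<open>Removing an arc out of \<open>i\<close> alters the Laplacian in row
    \<open>i\<close> only.\<close>
  have lap_row: "laplacian V (?\<mu> l) a b = laplacian V \<mu> a b"
    if "a \<noteq> i" "l \<in> V" "0 < ?n l" for a b l
    using that V by (simp add: laplacian_def outdeg_minus[OF V] lookup_minus lookup_single when_def)
  have IH: "trails V L l r (?\<mu> l) = det_on (active V (?\<mu> l) - {r}) (laplacian V (?\<mu> l)) *
      fact (outdeg V (?\<mu> l) r) * (\<Prod>v\<in>active V (?\<mu> l) - {r}. fact (outdeg V (?\<mu> l) v - 1))"
    if l: "l \<in> V" "0 < ?n l" for l
  proof (rule Suc.IH[OF l(1)])
    show "Poly_Mapping.keys (?\<mu> l) \<subseteq> V \<times> V"
      using keys by (auto simp: in_keys_iff lookup_minus subset_eq)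
    have pos: "0 < outdeg V \<mu> i" "0 < indeg V \<mu> l"
      using outdeg_ge[OF V l(1), of \<mu> i] indeg_ge[OF V i, of \<mu> l] l(2) by auto
    show "outdeg V (?\<mu> l) v + (if v = r then 1 else 0) = indeg V (?\<mu> l) v + (if v = l then 1 else 0)"
      if "v \<in> V" for v
      using bal[OF that] pos by (auto simp: outdeg_minus[OF V l] indeg_minus[OF V i l(2)] split: if_splits)
    have "sum (outdeg V (?\<mu> l)) V + 1 = sum (outdeg V \<mu>) V"
      using pos(1) unfolding sum.remove[OF V i] by (simp add: outdeg_minus[OF V l])
    then show "sum (outdeg V (?\<mu> l)) V = L" using Suc.prems(4) by simp
  qed
  show ?case
  proof (cases "outdeg V \<mu> i = 0")
    case True
    then have "i = r" using bal[OF i] by (auto split: if_splits)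
    have "?n l = 0" if "l \<in> V" for l using outdeg_ge[OF V that, of \<mu> i] True by simp
    then have "trails V (Suc L) i r \<mu> = 0" by (simp add: trails_Suc[OF V i r])
    \<comment> \<open>The start has no outgoing arc although arcs remain, so there is no walk. The
      minor vanishes as well: \<open>r\<close> is inactive, so it ranges over all of the nonempty
      \<open>S\<close>, and no arc leaves \<open>S\<close>, so its row sums are zero.\<close>
    moreover have "det_on (S - {r}) (laplacian V \<mu>) = 0"
    proof (rule det_on_dependent_cols)
      have "S - {r} = S" using True \<open>i = r\<close> by (auto simp: S_def active_def)
      have "\<exists>v\<in>V. outdeg V \<mu> v \<noteq> 0"
      proof (rule ccontr)
        assume "\<not> (\<exists>v\<in>V. outdeg V \<mu> v \<noteq> 0)"
        then have "sum (outdeg V \<mu>) V = 0" by simp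
        then show False using Suc.prems(4) by simp
      qed
      then have "S \<noteq> {}" by (auto simp: S_def active_def)
      then show "S - {r} \<noteq> {}" using \<open>S - {r} = S\<close> by simp
      fix a assume a: "a \<in> S - {r}"
      have "outdeg V \<mu> a = (\<Sum>b\<in>S. Poly_Mapping.lookup \<mu> (a, b))"
        unfolding outdeg_def
      proof (rule sum.mono_neutral_right[OF V])
        show "\<forall>b\<in>V - S. Poly_Mapping.lookup \<mu> (a, b) = 0"
        proof
          fix b assume b: "b \<in> V - S"
          then have "outdeg V \<mu> b = 0" by (simp add: S_def active_def)
          then have "indeg V \<mu> b = 0" using bal[of b] b \<open>i = r\<close> by (auto split: if_splits)
          then show "Poly_Mapping.lookup \<mu> (a, b) = 0"
            using indeg_ge[OF V, of a \<mu> b] a by (auto simp: S_def active_def)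
        qed
      qed (auto simp: S_def active_def)
      then show "(\<Sum>b\<in>S - {r}. laplacian V \<mu> a b) = 0"
        using a finS \<open>S - {r} = S\<close> by (simp add: laplacian_def sum_subtractf)
    qed (use finS in auto)
    ultimately show ?thesis by (simp add: S_def)
  next
    case out: False
    have sum_n: "(\<Sum>l\<in>V. real (?n l)) = real (outdeg V \<mu> i)" by (simp add: outdeg_def)
    show ?thesis
    proof (cases "i = r")
      case True
      \<comment> \<open>Row \<open>r\<close> is not part of the minor, so every first arc leaves the
        same minor, and of the factorials only that of \<open>r\<close> changes.\<close>
      have trail: "real (?n l) * trails V L l r (?\<mu> l) = real (?n l) *
          (det_on (S - {r}) (laplacian V \<mu>) * fact (outdeg V \<mu> r - 1) *
           (\<Prod>v\<in>S - {r}. fact (outdeg V \<mu> v - 1)))" if "l \<in> V" for l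
      proof (cases "0 < ?n l")
        case pos: True
        have om: "outdeg V (\<mu> - Poly_Mapping.single (r, l) (Suc 0)) v =
            outdeg V \<mu> v - (if v = r then 1 else 0)" for v
          using outdeg_minus[OF V that pos, of v] True by simp
        have S: "active V (?\<mu> l) - {r} = S - {r}"
          using True by (auto simp: S_def active_def om)
        have "det_on (S - {r}) (laplacian V (?\<mu> l)) = det_on (S - {r}) (laplacian V \<mu>)"
          using lap_row[OF _ that pos] True by (intro det_on_cong) auto
        moreover have "(\<Prod>v\<in>S - {r}. fact (outdeg V (?\<mu> l) v - 1)) =
            (\<Prod>v\<in>S - {r}. fact (outdeg V \<mu> v - 1) :: real)"
          using True by (intro prod.cong) (auto simp: om)
        ultimately show ?thesis
          unfolding IH[OF that pos] S using True by (simp add: om)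
      qed simp
      have "trails V (Suc L) i r \<mu> = real (outdeg V \<mu> r) * (det_on (S - {r}) (laplacian V \<mu>) *
          fact (outdeg V \<mu> r - 1) * (\<Prod>v\<in>S - {r}. fact (outdeg V \<mu> v - 1)))"
      proof -
        have "trails V (Suc L) i r \<mu> = (\<Sum>l\<in>V. real (?n l) * (det_on (S - {r}) (laplacian V \<mu>) *
            fact (outdeg V \<mu> r - 1) * (\<Prod>v\<in>S - {r}. fact (outdeg V \<mu> v - 1))))"
          unfolding trails_Suc[OF V i r] by (rule sum.cong[OF refl trail])
        then show ?thesis unfolding sum_distrib_right[symmetric] sum_n using True by simp
      qed
      moreover have "real (outdeg V \<mu> r) * fact (outdeg V \<mu> r - 1) = fact (outdeg V \<mu> r)"
        using out True by (simp add: fact_reduce[of "outdeg V \<mu> r"])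
      ultimately show ?thesis by (simp add: S_def mult.assoc mult.left_commute)
    next
      case ir: False
      have iS: "i \<in> S - {r}" using i out ir by (simp add: S_def active_def)
      have o_in: "outdeg V \<mu> i = indeg V \<mu> i + 1" using bal[OF i] ir by simp
      define F where "F = fact (outdeg V \<mu> r) * (\<Prod>v\<in>S - {r} - {i}. fact (outdeg V \<mu> v - 1) :: real)"
      show ?thesis
      proof (cases "outdeg V \<mu> i = 1")
        case one: True
        \<comment> \<open>The only arc out of \<open>i\<close> is used up, so \<open>i\<close>
          becomes inactive. Balance shows that no arc enters \<open>i\<close>, hence column
          \<open>i\<close> of the old minor is zero off the diagonal and \<open>i\<close> can be
          removed from it, with pivot 1.\<close>
        have S': "active V (?\<mu> l) - {r} = S - {r} - {i}" if "l \<in> V" "0 < ?n l" for l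
          using one by (auto simp: S_def active_def outdeg_minus[OF V that])
        have "?n i \<le> indeg V \<mu> i" by (rule indeg_ge[OF V i])
        then have nii: "?n i = 0" using o_in one by simp
        have trail: "real (?n l) * trails V L l r (?\<mu> l) = real (?n l) *
            (det_on (S - {r} - {i}) (laplacian V \<mu>) * F)" if "l \<in> V" for l
        proof (cases "0 < ?n l")
          case pos: True
          have "det_on (S - {r} - {i}) (laplacian V (?\<mu> l)) = det_on (S - {r} - {i}) (laplacian V \<mu>)"
            using lap_row[OF _ that pos] by (intro det_on_cong) auto
          moreover have "(\<Prod>v\<in>S - {r} - {i}. fact (outdeg V (?\<mu> l) v - 1)) =
              (\<Prod>v\<in>S - {r} - {i}. fact (outdeg V \<mu> v - 1) :: real)"
            by (intro prod.cong) (auto simp: outdeg_minus[OF V that pos])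
          ultimately show ?thesis
            unfolding IH[OF that pos] S'[OF that pos] using ir
            by (simp add: outdeg_minus[OF V that pos] F_def)
        qed simp
        have "det_on (S - {r}) (laplacian V \<mu>) = laplacian V \<mu> i i * det_on (S - {r} - {i}) (laplacian V \<mu>)"
        proof (rule det_on_remove[OF _ iS])
          fix a assume a: "a \<in> S - {r} - {i}"
          then have "Poly_Mapping.lookup \<mu> (a, i) \<le> indeg V \<mu> i"
            by (intro indeg_ge[OF V]) (auto simp: S_def active_def)
          then show "laplacian V \<mu> a i = 0" using a o_in one by (simp add: laplacian_def)
        qed (use finS in simp)
        then have "det_on (S - {r}) (laplacian V \<mu>) = det_on (S - {r} - {i}) (laplacian V \<mu>)"
          using one nii by (simp add: laplacian_def)
        moreover have "trails V (Suc L) i r \<mu> = det_on (S - {r} - {i}) (laplacian V \<mu>) * F"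
        proof -
          have "trails V (Suc L) i r \<mu> =
              (\<Sum>l\<in>V. real (?n l) * (det_on (S - {r} - {i}) (laplacian V \<mu>) * F))"
            unfolding trails_Suc[OF V i r] by (rule sum.cong[OF refl trail])
          then show ?thesis unfolding sum_distrib_right[symmetric] sum_n using one by simp
        qed
        moreover have "(\<Prod>v\<in>S - {r}. fact (outdeg V \<mu> v - 1) :: real) =
            (\<Prod>v\<in>S - {r} - {i}. fact (outdeg V \<mu> v - 1))"
          using finS iS one by (simp add: prod.remove[of "S - {r}" i])
        ultimately show ?thesis by (simp add: F_def S_def mult.assoc)
      next
        case False
        then have two: "2 \<le> outdeg V \<mu> i" using out by simp
        \<comment> \<open>Row \<open>i\<close> after removal of the arc \<open>(i, l)\<close>: the
          diagonal loses one and the entry at \<open>l\<close> gains one. For a loop the two changes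
          cancel.\<close>
        define R where "R l = (\<lambda>b. laplacian V \<mu> i b - (if b = i then 1 else 0) + (if b = l then 1 else 0))" for l
        have trail: "real (?n l) * trails V L l r (?\<mu> l) = real (?n l) *
            det_on (S - {r}) ((laplacian V \<mu>)(i := R l)) * (F * fact (outdeg V \<mu> i - 2))" if "l \<in> V" for l
        proof (cases "0 < ?n l")
          case pos: True
          have S': "active V (?\<mu> l) - {r} = S - {r}"
            using two by (auto simp: S_def active_def outdeg_minus[OF V that pos])
          have "det_on (S - {r}) (laplacian V (?\<mu> l)) = det_on (S - {r}) ((laplacian V \<mu>)(i := R l))"
          proof (rule det_on_cong[OF refl])
            fix a b
            show "laplacian V (?\<mu> l) a b = ((laplacian V \<mu>)(i := R l)) a b"
            proof (cases "a = i")
              case True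
              have "real (outdeg V (?\<mu> l) i) = real (outdeg V \<mu> i) - 1"
                using two outdeg_minus[OF V that pos, of i] by (simp add: of_nat_diff)
              then show ?thesis using True pos
                by (auto simp: R_def laplacian_def lookup_minus lookup_single when_def of_nat_diff)
            qed (simp add: lap_row[OF _ that pos])
          qed
          moreover have "(\<Prod>v\<in>S - {r}. fact (outdeg V (?\<mu> l) v - 1) :: real) =
              fact (outdeg V \<mu> i - 2) * (\<Prod>v\<in>S - {r} - {i}. fact (outdeg V \<mu> v - 1))"
          proof -
            have "(\<Prod>v\<in>S - {r}. fact (outdeg V (?\<mu> l) v - 1) :: real) =
              fact (outdeg V (?\<mu> l) i - 1) * (\<Prod>v\<in>S - {r} - {i}. fact (outdeg V (?\<mu> l) v - 1))"
              by (rule prod.remove) (use finS iS in auto)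
            moreover have "(\<Prod>v\<in>S - {r} - {i}. fact (outdeg V (?\<mu> l) v - 1)) =
              (\<Prod>v\<in>S - {r} - {i}. fact (outdeg V \<mu> v - 1) :: real)"
              by (intro prod.cong) (auto simp: outdeg_minus[OF V that pos])
            ultimately show ?thesis
              by (simp add: outdeg_minus[OF V that pos] numeral_2_eq_2)
          qed
          ultimately show ?thesis
            unfolding IH[OF that pos] S' using ir by (simp add: outdeg_minus[OF V that pos] F_def)
        qed simp
        have "(\<Sum>l\<in>V. real (?n l) * det_on (S - {r}) ((laplacian V \<mu>)(i := R l))) =
            det_on (S - {r}) ((laplacian V \<mu>)(i := \<lambda>b. \<Sum>l\<in>V. real (?n l) * R l b))"
          by (rule det_on_row_sum[symmetric]) (use finS iS in auto)
        \<comment> \<open>The sum over \<open>{()}\<close> has a single term and serves to pull out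
          the scalar with \<open>det_on_row_sum\<close>.\<close>
        also have "\<dots> = det_on (S - {r}) ((laplacian V \<mu>)(i :=
            \<lambda>b. \<Sum>x\<in>{()}. (real (outdeg V \<mu> i) - 1) * laplacian V \<mu> i b))"
        proof (rule det_on_cong[OF refl])
          fix a b assume b: "b \<in> S - {r}"
          have bV: "b \<in> V" using b by (auto simp: S_def active_def)
          have "(\<Sum>l\<in>V. real (?n l) * R l b) =
             (\<Sum>l\<in>V. real (?n l) * (laplacian V \<mu> i b - (if b = i then 1 else 0)) + (if b = l then real (?n b) else 0))"
            by (intro sum.cong) (auto simp: R_def algebra_simps)
          also have "\<dots> = real (outdeg V \<mu> i) * (laplacian V \<mu> i b - (if b = i then 1 else 0)) + real (?n b)"
            using V bV by (simp add: sum.distrib sum_distrib_right[symmetric] sum_n)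
          also have "\<dots> = (real (outdeg V \<mu> i) - 1) * laplacian V \<mu> i b"
            by (auto simp: laplacian_def algebra_simps)
          finally show "((laplacian V \<mu>)(i := \<lambda>b. \<Sum>l\<in>V. real (?n l) * R l b)) a b =
            ((laplacian V \<mu>)(i := \<lambda>b. \<Sum>x\<in>{()}. (real (outdeg V \<mu> i) - 1) * laplacian V \<mu> i b)) a b"
            by simp
        qed
        also have "\<dots> = (\<Sum>x\<in>{()}. (real (outdeg V \<mu> i) - 1) *
            det_on (S - {r}) ((laplacian V \<mu>)(i := laplacian V \<mu> i)))"
          by (rule det_on_row_sum) (use finS iS in auto)
        finally have lin: "(\<Sum>l\<in>V. real (?n l) * det_on (S - {r}) ((laplacian V \<mu>)(i := R l))) =
            (real (outdeg V \<mu> i) - 1) * det_on (S - {r}) (laplacian V \<mu>)" by simp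
        have "trails V (Suc L) i r \<mu> = (\<Sum>l\<in>V. real (?n l) *
            det_on (S - {r}) ((laplacian V \<mu>)(i := R l)) * (F * fact (outdeg V \<mu> i - 2)))"
          unfolding trails_Suc[OF V i r] using trail by (intro sum.cong) auto
        also have "\<dots> = (real (outdeg V \<mu> i) - 1) * det_on (S - {r}) (laplacian V \<mu>) *
            (F * fact (outdeg V \<mu> i - 2))"
          unfolding lin[symmetric] by (rule sum_distrib_right[symmetric])
        finally have tr: "trails V (Suc L) i r \<mu> = (real (outdeg V \<mu> i) - 1) *
            det_on (S - {r}) (laplacian V \<mu>) * (F * fact (outdeg V \<mu> i - 2))" .
        obtain k where k: "outdeg V \<mu> i = 2 + k" using le_Suc_ex[OF two] by blast
        have "trails V (Suc L) i r \<mu> =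
            det_on (S - {r}) (laplacian V \<mu>) * (F * fact (outdeg V \<mu> i - 1))"
          unfolding tr k by simp
        moreover have "(\<Prod>v\<in>S - {r}. fact (outdeg V \<mu> v - 1) :: real) =
            fact (outdeg V \<mu> i - 1) * (\<Prod>v\<in>S - {r} - {i}. fact (outdeg V \<mu> v - 1))"
          by (rule prod.remove) (use finS iS in auto)
        ultimately show ?thesis by (simp add: F_def S_def mult.assoc mult.left_commute mult.commute)
      qed
    qed
  qed
qed

text \<open>All active roots share the same minor by \<open>det_on_minor_root\<close>. The factorial
  at the root exceeds that of the other vertices by the factor \<open>outdeg r\<close>, and the
  out-degrees sum to \<open>L\<close>.\<close>

theorem closed_trails:
  assumes V: "finite V" and keys: "Poly_Mapping.keys \<mu> \<subseteq> V \<times> V"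
    and bal: "\<And>v. v \<in> V \<Longrightarrow> outdeg V \<mu> v = indeg V \<mu> v"
    and L: "sum (outdeg V \<mu>) V = L"
    and s: "s \<in> active V \<mu>"
  shows "(\<Sum>r\<in>V. trails V L r r \<mu>) = real L * det_on (active V \<mu> - {s}) (laplacian V \<mu>) *
           (\<Prod>v\<in>active V \<mu>. fact (outdeg V \<mu> v - 1))"
proof -
  define S where "S = active V \<mu>"
  have finS: "finite S" and subS: "S \<subseteq> V" using V by (auto simp: S_def active_def)
  define P where "P = (\<Prod>v\<in>S. fact (outdeg V \<mu> v - 1) :: real)"
  define \<tau> where "\<tau> = det_on (S - {s}) (laplacian V \<mu>)"
  have zero: "Poly_Mapping.lookup \<mu> (a, b) = 0" if "a \<in> V" "b \<in> V" "a \<notin> S \<or> b \<notin> S" for a b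
    using that outdeg_ge[OF V, of b \<mu> a] indeg_ge[OF V, of a \<mu> b] bal[of b]
    by (auto simp: S_def active_def)
  have rows: "(\<Sum>b\<in>S. laplacian V \<mu> a b) = 0" if "a \<in> S" for a
  proof -
    have "outdeg V \<mu> a = (\<Sum>b\<in>S. Poly_Mapping.lookup \<mu> (a, b))"
      unfolding outdeg_def using that subS zero by (intro sum.mono_neutral_right[OF V]) auto
    then show ?thesis using that finS by (simp add: laplacian_def sum_subtractf)
  qed
  have cols: "(\<Sum>a\<in>S. laplacian V \<mu> a b) = 0" if "b \<in> S" for b
  proof -
    have "indeg V \<mu> b = (\<Sum>a\<in>S. Poly_Mapping.lookup \<mu> (a, b))"
      unfolding indeg_def using that subS zero by (intro sum.mono_neutral_right[OF V]) auto
    moreover have "outdeg V \<mu> b = indeg V \<mu> b" using bal that subS by auto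
    ultimately show ?thesis using that finS by (simp add: laplacian_def sum_subtractf)
  qed
  have "trails V L r r \<mu> = real (outdeg V \<mu> r) * (\<tau> * P)" if r: "r \<in> V" for r
  proof -
    have eq: "trails V L r r \<mu> = det_on (S - {r}) (laplacian V \<mu>) * fact (outdeg V \<mu> r) *
           (\<Prod>v\<in>S - {r}. fact (outdeg V \<mu> v - 1))"
      unfolding S_def by (rule trails_eq_det[OF V r r keys _ L]) (simp add: bal)
    show ?thesis
    proof (cases "r \<in> S")
      case True
      have "det_on (S - {r}) (laplacian V \<mu>) = \<tau>"
        unfolding \<tau>_def using s True by (intro det_on_minor_root finS rows cols) (auto simp: S_def)
      moreover have "P = fact (outdeg V \<mu> r - 1) * (\<Prod>v\<in>S - {r}. fact (outdeg V \<mu> v - 1))"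
        unfolding P_def by (rule prod.remove[OF finS True])
      moreover have "fact (outdeg V \<mu> r) = real (outdeg V \<mu> r) * fact (outdeg V \<mu> r - 1)"
        using True by (intro fact_reduce) (simp add: S_def active_def)
      ultimately show ?thesis using eq by simp
    next
      case False
      then have "outdeg V \<mu> r = 0" using r by (simp add: S_def active_def)
      \<comment> \<open>For an inactive start the minor comprises all of \<open>S\<close>, where the
        row sums vanish.\<close>
      moreover have "det_on (S - {r}) (laplacian V \<mu>) = 0"
        using False rows s finS by (intro det_on_dependent_cols[of _ "S - {r}"]) (auto simp: S_def)
      ultimately show ?thesis using eq by simp
    qed
  qed
  then have "(\<Sum>r\<in>V. trails V L r r \<mu>) = (\<Sum>r\<in>V. real (outdeg V \<mu> r) * (\<tau> * P))" by simp
  also have "\<dots> = real L * (\<tau> * P)"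
    unfolding sum_distrib_right[symmetric] L[symmetric] by simp
  finally show ?thesis by (simp add: S_def P_def \<tau>_def mult.assoc)
qed

section \<open>Cycles, leaves and trees\<close>

text \<open>A property of edge sets, given by an injective enumeration of the vertices, so that
  deleting edges involves neither subgraphs nor isomorphisms; \<open>has_cycle_iff\<close> relates
  it to \<open>is_cycle\<close>.\<close>

definition has_cycle :: "'a set set \<Rightarrow> bool" where
  "has_cycle X \<longleftrightarrow> (\<exists>n\<ge>3. \<exists>g :: nat \<Rightarrow> 'a.
     inj_on g {..<n} \<and> (\<forall>i<n. {g i, g ((i + 1) mod n)} \<in> X))"

lemma has_cycle_mono: "has_cycle X \<Longrightarrow> X \<subseteq> Y \<Longrightarrow> has_cycle Y"
  unfolding has_cycle_def by (meson subsetD)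

text \<open>Two equal edges with different indices would be reversed copies of each other, so that
  \<open>i\<close> and \<open>j\<close> are cyclic successors of one another; this is possible only
  for \<open>n \<le> 2\<close>.\<close>

lemma cycle_edges_inj:
  fixes n :: nat
  assumes "3 \<le> n" "inj_on g {..<n}"
  shows "inj_on (\<lambda>i. {g i, g ((i + 1) mod n)}) {..<n}"
proof (rule inj_onI)
  fix i j assume ij: "i \<in> {..<n}" "j \<in> {..<n}" and eq: "{g i, g ((i + 1) mod n)} = {g j, g ((j + 1) mod n)}"
  have g: "g a = g b \<longleftrightarrow> a = b" if "a < n" "b < n" for a b
    using inj_on_eq_iff[OF assms(2)] that by simp
  have m: "(i + 1) mod n < n" "(j + 1) mod n < n" using assms(1) by auto
  from eq have "i = j \<or> i = (j + 1) mod n \<and> (i + 1) mod n = j"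
    using ij m by (auto simp: doubleton_eq_iff g)
  moreover have "\<not> (i = (j + 1) mod n \<and> (i + 1) mod n = j)"
  proof
    assume a: "i = (j + 1) mod n \<and> (i + 1) mod n = j"
    have succ: "(x + 1) mod n = (if x + 1 = n then 0 else x + 1)" if "x < n" for x
      using that by auto
    show False using a ij assms(1) succ[of i] succ[of j] by (auto split: if_splits)
  qed
  ultimately show "i = j" by blast
qed

lemma has_cycle_if_no_leaf:
  assumes fin: "finite X" and ne: "X \<noteq> {}" and two: "\<And>e. e \<in> X \<Longrightarrow> card e = 2"
    and deg: "\<And>v. v \<in> \<Union>X \<Longrightarrow> v \<noteq> r \<Longrightarrow> card {e \<in> X. v \<in> e} \<noteq> 1"
  shows "has_cycle X"
proof -
  have fX: "finite (\<Union>X)"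
  proof (rule finite_Union[OF fin])
    fix e assume "e \<in> X"
    then show "finite e" using two[of e] card_ge_0_finite[of e] by simp
  qed
  \<comment> \<open>Paths start at the exceptional vertex whenever it is covered, so the other end
    of the path is never \<open>r\<close>.\<close>
  define s where "s = (if r \<in> \<Union>X then r else SOME s. s \<in> \<Union>X)"
  have "\<exists>s. s \<in> \<Union>X"
  proof -
    obtain e where e: "e \<in> X" using ne by blast
    then have "e \<noteq> {}" using two[of e] by auto
    then show ?thesis using e by blast
  qed
  then have s: "s \<in> \<Union>X" unfolding s_def using someI_ex[of "\<lambda>s. s \<in> \<Union>X"] by auto
  define P where "P p \<longleftrightarrow> distinct p \<and> 2 \<le> length p \<and> p ! 0 = s \<and> set p \<subseteq> \<Union>X \<and>
    (\<forall>i. Suc i < length p \<longrightarrow> {p ! i, p ! Suc i} \<in> X)" for p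
  obtain e where e: "e \<in> X" "s \<in> e" using s by auto
  then obtain y where y: "e = {s, y}" "s \<noteq> y" using two[OF e(1)] by (auto simp: card_2_iff doubleton_eq_iff)
  have P0: "P [s, y]" using e y by (auto simp: P_def)
  have bound: "length p < Suc (card (\<Union>X))" if "P p" for p
    using that card_mono[OF fX, of "set p"] distinct_card[of p] by (simp add: P_def)
  obtain p where p: "P p" and max: "\<And>q. P q \<Longrightarrow> length q \<le> length p"
    using ex_has_greatest_nat[of P "[s, y]" length "Suc (card (\<Union>X))"] P0 bound by (metis less_imp_le)
  define k where "k = length p - 1"
  have len: "length p = Suc k" and k: "1 \<le> k" using p by (auto simp: P_def k_def)
  define v where "v = p ! k"
  have dist: "p ! i = p ! j \<longleftrightarrow> i = j" if "i \<le> k" "j \<le> k" for i j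
    using p that len by (auto simp: P_def nth_eq_iff_index_eq)
  have "v \<in> set p" using len by (simp add: v_def)
  then have vX: "v \<in> \<Union>X" using p unfolding P_def by blast
  have "v \<noteq> s" using dist[of k 0] k p by (auto simp: P_def v_def)
  moreover have "s = r" if "r \<in> \<Union>X" using that by (simp only: s_def if_True)
  ultimately have "v \<noteq> r" using vX by blast
  define e1 where "e1 = {p ! (k - 1), v}"
  have e1: "e1 \<in> X"
  proof -
    have "Suc (k - 1) = k" using k by simp
    then show ?thesis using p len unfolding P_def e1_def v_def by (metis lessI)
  qed
  have "{e \<in> X. v \<in> e} \<noteq> {e1}"
    using deg[OF vX \<open>v \<noteq> r\<close>] by (metis is_singletonI is_singleton_altdef)
  moreover have "e1 \<in> {e \<in> X. v \<in> e}" using e1 by (simp add: e1_def)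
  ultimately obtain e2 where e2: "e2 \<in> X" "v \<in> e2" "e2 \<noteq> e1" by blast
  then obtain y where y: "e2 = {v, y}" "v \<noteq> y" using two[OF e2(1)] by (auto simp: card_2_iff doubleton_eq_iff)
  have yp: "y \<noteq> p ! (k - 1)" using e2(3) y by (auto simp: e1_def doubleton_eq_iff)
  have "y \<in> set p"
  proof (rule ccontr)
    assume new: "y \<notin> set p"
    have "P (p @ [y])"
      unfolding P_def
    proof (intro conjI allI impI)
      fix i assume i: "Suc i < length (p @ [y])"
      show "{(p @ [y]) ! i, (p @ [y]) ! Suc i} \<in> X"
      proof (cases "Suc i < length p")
        case True
        then show ?thesis using p by (auto simp: P_def nth_append)
      next
        case False
        then have "i = k" using i len by simp
        then show ?thesis using e2(1) y len by (simp add: nth_append v_def)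
      qed
    qed (use p new e2(1) y len in \<open>auto simp: P_def nth_append\<close>)
    then show False using max by fastforce
  qed
  then obtain j where j: "j \<le> k" "p ! j = y" using len by (auto simp: in_set_conv_nth less_Suc_eq_le)
  have "j \<noteq> k" "j \<noteq> k - 1" using j y yp by (auto simp: v_def)
  \<comment> \<open>\<open>y\<close> is neither the last vertex nor its predecessor, so the cycle
    closed by \<open>e2\<close> has at least three vertices.\<close>
  then have jk: "j + 2 \<le> k" using j k by simp
  define n where "n = k - j + 1"
  define g where "g i = p ! (j + i)" for i
  have "3 \<le> n" using jk by (simp add: n_def)
  moreover have "inj_on g {..<n}"
    by (rule inj_onI) (use dist j in \<open>auto simp: g_def n_def\<close>)
  moreover have "{g i, g ((i + 1) mod n)} \<in> X" if i: "i < n" for i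
  proof (cases "i + 1 < n")
    case True
    then show ?thesis using p len by (auto simp: g_def n_def P_def)
  next
    case False
    then have "i = k - j" using i by (simp add: n_def)
    then show ?thesis using e2(1) y j by (simp add: g_def n_def v_def)
  qed
  ultimately show ?thesis unfolding has_cycle_def by blast
qed

lemma acyclic_leaf:
  assumes "finite X" "X \<noteq> {}" "\<And>e. e \<in> X \<Longrightarrow> card e = 2" "\<not> has_cycle X"
  obtains v w where "v \<noteq> r" "v \<noteq> w" "{v, w} \<in> X" "\<And>e. e \<in> X \<Longrightarrow> v \<in> e \<Longrightarrow> e = {v, w}"
proof -
  obtain v where v: "v \<noteq> r" "card {e \<in> X. v \<in> e} = 1"
    using has_cycle_if_no_leaf[OF assms(1-3), of r] assms(4) by auto
  then obtain e where e: "{e \<in> X. v \<in> e} = {e}" by (auto simp: card_1_singleton_iff)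
  then have "e \<in> X" "v \<in> e" by auto
  then obtain w where w: "e = {v, w}" "v \<noteq> w" using assms(3)[of e] by (auto simp: card_2_iff doubleton_eq_iff)
  show ?thesis
  proof (rule that[OF v(1) w(2)])
    show "{v, w} \<in> X" using \<open>e \<in> X\<close> w(1) by simp
    fix e' assume "e' \<in> X" "v \<in> e'"
    then have "e' \<in> {e}" unfolding e[symmetric] by simp
    then show "e' = {v, w}" using w(1) by simp
  qed
qed

text \<open>Deleting a leaf together with its edge lowers both sides by one. The leaf is chosen
  different from a fixed \<open>r\<close>, which keeps \<open>V\<close> nonempty.\<close>

lemma acyclic_card:
  assumes "finite V" "V \<noteq> {}" "\<And>e. e \<in> X \<Longrightarrow> e \<subseteq> V \<and> card e = 2" "\<not> has_cycle X"
  shows "card X + 1 \<le> card V"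
proof -
  have "finite X" by (rule finite_subset[of _ "Pow V"]) (use assms in auto)
  then show ?thesis using assms
  proof (induction "card X" arbitrary: X V)
    case 0
    then show ?case by (simp add: Suc_le_eq card_gt_0_iff)
  next
    case (Suc n)
    obtain r where r: "r \<in> V" using Suc.prems by blast
    have X: "X \<noteq> {}" using Suc.hyps(2) by auto
    have two: "\<And>e. e \<in> X \<Longrightarrow> card e = 2" using Suc.prems(4) by blast
    obtain v w where v: "v \<noteq> r" "{v, w} \<in> X" "\<And>e. e \<in> X \<Longrightarrow> v \<in> e \<Longrightarrow> e = {v, w}"
      using acyclic_leaf[OF Suc.prems(1) X two Suc.prems(5), of r] by blast
    have vV: "v \<in> V" using Suc.prems(4) v(2) by blast
    have "card (X - {{v, w}}) + 1 \<le> card (V - {v})"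
    proof (rule Suc.hyps(1))
      show "n = card (X - {{v, w}})" using Suc.hyps(2) v(2) Suc.prems(1) by simp
      show "e \<subseteq> V - {v} \<and> card e = 2" if "e \<in> X - {{v, w}}" for e
        using that Suc.prems(4)[of e] v(3)[of e] by blast
      show "\<not> has_cycle (X - {{v, w}})" using Suc.prems(5) has_cycle_mono[of "X - {{v, w}}" X] by blast
      show "V - {v} \<noteq> {}" using r v(1) by blast
    qed (use Suc.prems(1,2) in auto)
    moreover have "card X = card (X - {{v, w}}) + 1"
      using card_Suc_Diff1[OF Suc.prems(1) v(2)] by simp
    moreover have "card V = card (V - {v}) + 1"
      using card_Suc_Diff1[OF Suc.prems(2) vV] by simp
    ultimately show ?case by linarith
  qed
qed

text \<open>Each vertex other than \<open>r\<close> has a neighbour \<open>p v\<close> whose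
  distance \<open>h\<close> from \<open>r\<close> is smaller by one. The edges
  \<open>{p v, v}\<close> are distinct because the distance grows from \<open>p v\<close> to
  \<open>v\<close>.\<close>

lemma connected_card:
  assumes G: "simple_graph G" and conn: "connected_graph G"
  shows "card (verts G) \<le> card (edges G) + 1"
proof -
  define R where "R = {(x, y). {x, y} \<in> edges G}"
  obtain r where r: "r \<in> verts G" using conn by (auto simp: connected_graph_def)
  have reach: "\<exists>n. (r, v) \<in> R ^^ n" if "v \<in> verts G" for v
    using conn r that unfolding connected_graph_def R_def[symmetric] by (meson rtrancl_imp_relpow)
  define h where "h v = (LEAST n. (r, v) \<in> R ^^ n)" for v
  have parent: "\<exists>u. {u, v} \<in> edges G \<and> h v = Suc (h u)" if v: "v \<in> verts G - {r}" for v
  proof -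
    have hv: "(r, v) \<in> R ^^ h v" unfolding h_def using reach v by (metis DiffD1 LeastI)
    have "h v \<noteq> 0"
    proof
      assume "h v = 0"
      then show False using hv v by simp
    qed
    then obtain n where n: "h v = Suc n" using not0_implies_Suc by blast
    then obtain u where u: "(r, u) \<in> R ^^ n" "(u, v) \<in> R" using hv by auto
    have "h u \<le> n" unfolding h_def by (rule Least_le) (rule u(1))
    moreover have "(r, u) \<in> R ^^ h u" unfolding h_def using u(1) by (rule LeastI)
    then have "(r, v) \<in> R ^^ Suc (h u)" using u(2) by auto
    then have "h v \<le> Suc (h u)" unfolding h_def by (rule Least_le)
    ultimately show ?thesis using u(2) n by (auto simp: R_def)
  qed
  then obtain p where p: "\<And>v. v \<in> verts G - {r} \<Longrightarrow> {p v, v} \<in> edges G \<and> h v = Suc (h (p v))"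
    by metis
  have "inj_on (\<lambda>v. {p v, v}) (verts G - {r})"
  proof (rule inj_onI)
    fix v v' assume v: "v \<in> verts G - {r}" "v' \<in> verts G - {r}" "{p v, v} = {p v', v'}"
    then consider "v = v'" | "v = p v'" "v' = p v" by (auto simp: doubleton_eq_iff)
    then show "v = v'"
    proof cases
      case 2
      have "h v = h (p v')" "h v' = h (p v)" using arg_cong[OF 2(1), of h] arg_cong[OF 2(2), of h] .
      then show ?thesis using p[OF v(1)] p[OF v(2)] by linarith
    qed
  qed
  moreover have "(\<lambda>v. {p v, v}) ` (verts G - {r}) \<subseteq> edges G" using p by auto
  moreover have "finite (edges G)"
    by (rule finite_subset[of _ "Pow (verts G)"]) (use G in \<open>auto simp: uniform_hypergraph_def\<close>)
  ultimately have "card (verts G - {r}) \<le> card (edges G)" by (rule card_inj_on_le)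
  then show ?thesis using r by (simp add: card_Diff_singleton)
qed

lemma uniform_hypergraph_finite_edges: "uniform_hypergraph k G \<Longrightarrow> finite (edges G)"
  by (rule finite_subset[of _ "Pow (verts G)"]) (auto simp: uniform_hypergraph_def)

lemma is_cycle_param:
  assumes "is_cycle C" "simple_graph C"
  obtains g where "3 \<le> card (verts C)" "bij_betw g {..<card (verts C)} (verts C)"
    "edges C = (\<lambda>i. {g i, g ((i + 1) mod card (verts C))}) ` {..<card (verts C)}"
proof -
  obtain n :: nat and f where n: "3 \<le> n" and f: "bij_betw f (verts C) {..<n}"
    and e: "(\<lambda>e. f ` e) ` edges C = {{i, (i + 1) mod n} | i. i < n}"
    using assms(1) by (auto simp: is_cycle_def isomorphic_def cycle_graph_def)
  have c: "card (verts C) = n" using bij_betw_same_card[OF f] by simp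
  define g where "g = inv_into (verts C) f"
  have "bij_betw g {..<n} (verts C)" unfolding g_def by (rule bij_betw_inv_into[OF f])
  moreover have "edges C = (\<lambda>i. {g i, g ((i + 1) mod n)}) ` {..<n}"
  proof -
    have "edges C = (\<lambda>e. g ` f ` e) ` edges C"
    proof -
      have "g ` f ` e = e" if "e \<in> edges C" for e
        unfolding g_def using that assms(2) bij_betw_imp_inj_on[OF f]
        by (intro inv_into_image_cancel) (auto simp: uniform_hypergraph_def)
      then show ?thesis by simp
    qed
    also have "\<dots> = (\<lambda>e. g ` e) ` (\<lambda>e. f ` e) ` edges C" by (simp add: image_image)
    also have "\<dots> = (\<lambda>e. g ` e) ` (\<lambda>i. {i, (i + 1) mod n}) ` {..<n}"
      unfolding e by (rule arg_cong[of _ _ "image _"]) auto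
    also have "\<dots> = (\<lambda>i. {g i, g ((i + 1) mod n)}) ` {..<n}" by (simp add: image_image)
    finally show ?thesis .
  qed
  ultimately show ?thesis using that n c by simp
qed

lemma has_cycle_iff:
  assumes G: "simple_graph G" and X: "X \<subseteq> edges G"
  shows "has_cycle X \<longleftrightarrow> (\<exists>C. subgraph C G \<and> is_cycle C \<and> edges C \<subseteq> X)"
proof
  assume "has_cycle X"
  then obtain n :: nat and g where n: "3 \<le> n" and g: "inj_on g {..<n}"
    and e: "\<And>i. i < n \<Longrightarrow> {g i, g ((i + 1) mod n)} \<in> X" by (auto simp: has_cycle_def)
  define C where "C = Hypergraph (g ` {..<n}) ((\<lambda>i. {g i, g ((i + 1) mod n)}) ` {..<n})"
  have sub: "edges C \<subseteq> X" using e by (auto simp: C_def)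
  have "simple_graph C"
    unfolding uniform_hypergraph_def
  proof (intro conjI ballI)
    fix a assume a: "a \<in> edges C"
    then show "card a = 2" using sub X G by (auto simp: uniform_hypergraph_def)
    show "a \<subseteq> verts C" using a n by (auto simp: C_def)
  qed (simp add: C_def)
  moreover have "verts C \<subseteq> verts G"
  proof
    fix v assume "v \<in> verts C"
    then obtain i where "i < n" "v = g i" by (auto simp: C_def)
    then have "v \<in> {g i, g ((i + 1) mod n)}" "{g i, g ((i + 1) mod n)} \<in> edges G" using e X by auto
    then show "v \<in> verts G" using G unfolding uniform_hypergraph_def by blast
  qed
  ultimately have "subgraph C G" using sub X by (auto simp: subgraph_def)
  moreover have "isomorphic C (cycle_graph n)"
    unfolding isomorphic_def
  proof (intro exI conjI)
    let ?f = "inv_into {..<n} g"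
    show "bij_betw ?f (verts C) (verts (cycle_graph n))"
      using g by (auto simp: C_def cycle_graph_def intro!: bij_betw_inv_into inj_on_imp_bij_betw)
    have "?f ` {g i, g ((i + 1) mod n)} = {i, (i + 1) mod n}" if "i < n" for i
      using g that n by simp
    then show "(\<lambda>e. ?f ` e) ` edges C = edges (cycle_graph n)"
      unfolding C_def cycle_graph_def by (auto simp: image_iff simp del: image_insert)
  qed
  ultimately show "\<exists>C. subgraph C G \<and> is_cycle C \<and> edges C \<subseteq> X"
    using n sub by (auto simp: is_cycle_def)
next
  assume "\<exists>C. subgraph C G \<and> is_cycle C \<and> edges C \<subseteq> X"
  then obtain C where C: "simple_graph C" "is_cycle C" "edges C \<subseteq> X" by (auto simp: subgraph_def)
  obtain g where "3 \<le> card (verts C)" "bij_betw g {..<card (verts C)} (verts C)"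
    "edges C = (\<lambda>i. {g i, g ((i + 1) mod card (verts C))}) ` {..<card (verts C)}"
    using is_cycle_param[OF C(2,1)] .
  then show "has_cycle X" using C(3) unfolding has_cycle_def bij_betw_def by blast
qed

lemma tree_iff: "tree T \<longleftrightarrow> simple_graph T \<and> connected_graph T \<and> \<not> has_cycle (edges T)"
  using has_cycle_iff[of T "edges T"] by (auto simp: tree_def subgraph_def)

lemma tree_card:
  assumes "tree T"
  shows "card (verts T) = card (edges T) + 1"
proof (rule antisym)
  show "card (verts T) \<le> card (edges T) + 1" using assms by (intro connected_card) (auto simp: tree_iff)
  show "card (edges T) + 1 \<le> card (verts T)"
  proof (rule acyclic_card)
    show "finite (verts T)" "verts T \<noteq> {}" "\<not> has_cycle (edges T)"
      using assms by (auto simp: tree_iff uniform_hypergraph_def connected_graph_def)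
    show "e \<subseteq> verts T \<and> card e = 2" if "e \<in> edges T" for e
      using assms that by (simp add: tree_iff uniform_hypergraph_def)
  qed
qed

text \<open>Uniqueness of the cycle enters the proof through this lemma only.\<close>

lemma unicyclic_has_cycle:
  assumes "unicyclic U" "subgraph C U" "is_cycle C" "X \<subseteq> edges U" "has_cycle X"
  shows "edges C \<subseteq> X"
proof -
  have "simple_graph U" and unique: "\<exists>!C. subgraph C U \<and> is_cycle C"
    using assms(1) by (simp_all add: unicyclic_def)
  then obtain C' where C': "subgraph C' U" "is_cycle C'" "edges C' \<subseteq> X"
    using has_cycle_iff[OF _ assms(4)] assms(5) by blast
  have "C' = C" using unique C'(1,2) assms(2,3) by blast
  then show ?thesis using C'(3) by simp
qed

text \<open>Without one edge \<open>e0\<close> of the cycle the graph stays connected, because the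
  rest of the cycle is a detour, and becomes acyclic. The bounds for connected and for acyclic
  graphs then meet.\<close>

lemma unicyclic_card:
  assumes U: "unicyclic U" and C: "subgraph C U" "is_cycle C"
  shows "card (verts U) = card (edges U)"
proof -
  have simple: "simple_graph U" and conn: "connected_graph U" using U by (auto simp: unicyclic_def)
  have finE: "finite (edges U)" using simple by (rule uniform_hypergraph_finite_edges)
  have sC: "simple_graph C" and subC: "edges C \<subseteq> edges U" using C by (auto simp: subgraph_def)
  define n where "n = card (verts C)"
  obtain g where n: "3 \<le> n" and g: "bij_betw g {..<n} (verts C)"
    and eC: "edges C = (\<lambda>i. {g i, g ((i + 1) mod n)}) ` {..<n}"
    using is_cycle_param[OF C(2) sC] unfolding n_def .
  have inj: "inj_on (\<lambda>i. {g i, g ((i + 1) mod n)}) {..<n}"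
    by (rule cycle_edges_inj[OF n bij_betw_imp_inj_on[OF g]])
  define e0 where "e0 = {g (n - 1), g ((n - 1 + 1) mod n)}"
  have e0: "e0 \<in> edges C" unfolding e0_def eC using n by (intro image_eqI[of _ _ "n - 1"]) auto
  define U' where "U' = Hypergraph (verts U) (edges U - {e0})"
  have simple': "simple_graph U'" using simple by (auto simp: U'_def uniform_hypergraph_def)
  define R where "R = {(x, y). {x, y} \<in> edges U}"
  define R' where "R' = {(x, y). {x, y} \<in> edges U'}"
  have sym: "sym (R'\<^sup>*)" by (rule sym_rtrancl) (auto simp: R'_def sym_def insert_commute)
  have path: "(g 0, g i) \<in> R'\<^sup>*" if "i < n" for i
    using that
  proof (induction i)
    case (Suc i)
    have "{g i, g (Suc i)} \<in> edges C" unfolding eC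
      using Suc.prems by (intro image_eqI[of _ _ i]) auto
    moreover have "{g i, g (Suc i)} \<noteq> e0"
      using inj_onD[OF inj, of i "n - 1"] Suc.prems by (auto simp: e0_def)
    ultimately have "(g i, g (Suc i)) \<in> R'" using subC by (auto simp: R'_def U'_def)
    then show ?case using Suc by auto
  qed simp
  have e0': "e0 = {g (n - 1), g 0}" using n by (simp add: e0_def)
  have "R \<subseteq> R'\<^sup>*"
  proof
    fix a assume "a \<in> R"
    then obtain x y where a: "a = (x, y)" "{x, y} \<in> edges U" by (auto simp: R_def)
    show "a \<in> R'\<^sup>*"
    proof (cases "{x, y} = e0")
      case True
      then have "x = g (n - 1) \<and> y = g 0 \<or> x = g 0 \<and> y = g (n - 1)"
        by (auto simp: e0' doubleton_eq_iff)
      then show ?thesis using path[of "n - 1"] n sym a(1) by (auto dest: symD)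
    next
      case False
      then show ?thesis using a by (auto simp: R'_def U'_def)
    qed
  qed
  then have "R\<^sup>* \<subseteq> R'\<^sup>*" by (metis rtrancl_mono rtrancl_idemp)
  then have "connected_graph U'"
    using conn unfolding connected_graph_def R_def[symmetric] R'_def[symmetric]
    by (auto simp: U'_def)
  then have "card (verts U') \<le> card (edges U') + 1" by (rule connected_card[OF simple'])
  moreover have "card (edges U') + 1 \<le> card (verts U')"
  proof (rule acyclic_card)
    have "\<not> edges C \<subseteq> edges U - {e0}" using e0 by blast
    then show "\<not> has_cycle (edges U')"
      using unicyclic_has_cycle[OF U C, of "edges U - {e0}"] by (auto simp: U'_def)
    show "finite (verts U')" "verts U' \<noteq> {}"
      using simple' conn by (auto simp: uniform_hypergraph_def U'_def connected_graph_def)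
    show "e \<subseteq> verts U' \<and> card e = 2" if "e \<in> edges U'" for e
      using simple' that by (simp add: uniform_hypergraph_def)
  qed
  moreover have "card (edges U') + 1 = card (edges U)"
    using card_Suc_Diff1[OF finE subsetD[OF subC e0]] unfolding U'_def hypergraph.sel by linarith
  ultimately show ?thesis by (simp add: U'_def)
qed

section \<open>Sums over isomorphism classes of trees\<close>

lemma isomorphic_refl: "isomorphic G G"
  unfolding isomorphic_def by (intro exI[of _ id]) auto

lemma isomorphic_trans:
  assumes "isomorphic G H" "isomorphic H K"
  shows "isomorphic G K"
proof -
  obtain f f' where "bij_betw f (verts G) (verts H)" "(\<lambda>e. f ` e) ` edges G = edges H"
    "bij_betw f' (verts H) (verts K)" "(\<lambda>e. f' ` e) ` edges H = edges K"
    using assms by (auto simp: isomorphic_def)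
  moreover from this have "(\<lambda>e. (f' \<circ> f) ` e) ` edges G = edges K"
    by (metis (no_types, lifting) image_comp image_cong image_image)
  ultimately show ?thesis
    unfolding isomorphic_def by (intro exI[of _ "f' \<circ> f"]) (auto intro: bij_betw_trans)
qed

text \<open>Edges have to lie in the vertex set for the inverse of \<open>f\<close> to undo
  \<open>f\<close> on them.\<close>

lemma isomorphic_sym:
  assumes "simple_graph G" "isomorphic G H"
  shows "isomorphic H G"
proof -
  obtain f where f: "bij_betw f (verts G) (verts H)" "(\<lambda>e. f ` e) ` edges G = edges H"
    using assms by (auto simp: isomorphic_def)
  have "inv_into (verts G) f ` f ` e = e" if "e \<in> edges G" for e
    using that assms(1) bij_betw_imp_inj_on[OF f(1)]
    by (intro inv_into_image_cancel) (auto simp: uniform_hypergraph_def)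
  then have "(\<lambda>e. inv_into (verts G) f ` e) ` edges H = edges G"
    unfolding f(2)[symmetric] image_image by simp
  then show ?thesis
    using bij_betw_inv_into[OF f(1)] by (auto simp: isomorphic_def)
qed

lemma isomorphic_edges_bij:
  assumes "simple_graph G" "bij_betw f (verts G) (verts H)" "(\<lambda>e. f ` e) ` edges G = edges H"
  shows "bij_betw (\<lambda>e. f ` e) (edges G) (edges H)"
proof -
  have "inj_on (\<lambda>e. f ` e) (edges G)"
    by (rule inj_on_subset[OF inj_on_image_Pow[OF bij_betw_imp_inj_on[OF assms(2)]]])
      (use assms(1) in \<open>auto simp: uniform_hypergraph_def\<close>)
  then show ?thesis using assms(3) by (simp add: bij_betw_def)
qed

lemma isomorphic_tree:
  assumes "tree G" "isomorphic G H"
  shows "tree H" "card (edges H) = card (edges G)"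
proof -
  obtain f where f: "bij_betw f (verts G) (verts H)" "(\<lambda>e. f ` e) ` edges G = edges H"
    using assms by (auto simp: isomorphic_def)
  have G: "simple_graph G" "connected_graph G" "\<not> has_cycle (edges G)" using assms by (auto simp: tree_iff)
  have inj: "inj_on f (verts G)" using f by (rule_tac bij_betw_imp_inj_on)
  have bij: "bij_betw (\<lambda>e. f ` e) (edges G) (edges H)" by (rule isomorphic_edges_bij[OF G(1) f])
  then show "card (edges H) = card (edges G)" by (simp add: bij_betw_same_card)
  have sub: "e \<subseteq> verts G" if "e \<in> edges G" for e using that G(1) by (auto simp: uniform_hypergraph_def)
  have H: "simple_graph H"
    unfolding uniform_hypergraph_def
  proof (intro conjI ballI)
    show "finite (verts H)" using f(1) G(1) bij_betw_finite by (auto simp: uniform_hypergraph_def)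
    fix e assume "e \<in> edges H"
    then have "e \<in> (\<lambda>e. f ` e) ` edges G" using f(2) by simp
    then obtain a where a: "a \<in> edges G" "e = f ` a" by blast
    then show "e \<subseteq> verts H" using sub[of a] f(1) by (auto simp: bij_betw_def)
    show "card e = 2" using a G(1) card_image[OF inj_on_subset[OF inj sub[OF a(1)]]]
      by (auto simp: uniform_hypergraph_def)
  qed
  moreover have "connected_graph H"
    unfolding connected_graph_def
  proof (intro conjI ballI)
    show "verts H \<noteq> {}" using G(2) f(1) by (auto simp: connected_graph_def bij_betw_def)
    have path: "(f x, f y) \<in> {(x, y). {x, y} \<in> edges H}\<^sup>*"
      if "(x, y) \<in> {(x, y). {x, y} \<in> edges G}\<^sup>*" for x y
      using that
    proof (induction rule: rtrancl_induct)
      case (step y z)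
      then have "f ` {y, z} \<in> edges H" using f(2) by blast
      then show ?case using step.IH by (simp add: rtrancl_into_rtrancl)
    qed simp
    fix u v assume "u \<in> verts H" "v \<in> verts H"
    then have "u \<in> f ` verts G" "v \<in> f ` verts G" using f(1) by (simp_all add: bij_betw_def)
    then obtain x y where "x \<in> verts G" "y \<in> verts G" "u = f x" "v = f y" by blast
    then show "(u, v) \<in> {(x, y). {x, y} \<in> edges H}\<^sup>*"
      using path G(2) by (simp add: connected_graph_def)
  qed
  moreover have "\<not> has_cycle (edges H)"
  proof
    assume "has_cycle (edges H)"
    then obtain n :: nat and g where n: "3 \<le> n" and g: "inj_on g {..<n}"
      and e: "\<And>i. i < n \<Longrightarrow> {g i, g ((i + 1) mod n)} \<in> edges H" by (auto simp: has_cycle_def)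
    let ?h = "inv_into (verts G) f"
    have gv: "g i \<in> verts H" if "i < n" for i
      using e[OF that] H by (auto simp: uniform_hypergraph_def)
    have "inj_on (?h \<circ> g) {..<n}"
    proof (rule comp_inj_on[OF g])
      have "g ` {..<n} \<subseteq> verts H" using gv by blast
      then show "inj_on ?h (g ` {..<n})"
        by (rule inj_on_subset[OF bij_betw_imp_inj_on[OF bij_betw_inv_into[OF f(1)]]])
    qed
    moreover have "{(?h \<circ> g) i, (?h \<circ> g) ((i + 1) mod n)} \<in> edges G" if i: "i < n" for i
    proof -
      have "{g i, g ((i + 1) mod n)} \<in> (\<lambda>e. f ` e) ` edges G" using e[OF i] f(2) by simp
      then obtain a where a: "a \<in> edges G" "{g i, g ((i + 1) mod n)} = f ` a" by (rule imageE)
      have "{(?h \<circ> g) i, (?h \<circ> g) ((i + 1) mod n)} = ?h ` {g i, g ((i + 1) mod n)}" by simp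
      also have "\<dots> = ?h ` f ` a" by (simp only: a(2))
      also have "\<dots> = a" by (rule inv_into_image_cancel[OF inj sub[OF a(1)]])
      finally show ?thesis using a(1) by simp
    qed
    ultimately have "has_cycle (edges G)" using n unfolding has_cycle_def by blast
    with G(3) show False by simp
  qed
  ultimately show "tree H" by (simp add: tree_iff)
qed

lemma tree_coeff_isomorphic:
  assumes G: "simple_graph G" and iso: "isomorphic G H"
  shows "tree_coeff l G = tree_coeff l H"
proof -
  obtain f where f: "bij_betw f (verts G) (verts H)" "(\<lambda>e. f ` e) ` edges G = edges H"
    using iso by (auto simp: isomorphic_def)
  define \<phi> where "\<phi> = (\<lambda>e. f ` e)"
  have bij: "bij_betw \<phi> (edges G) (edges H)" unfolding \<phi>_def by (rule isomorphic_edges_bij[OF G f])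
  define \<psi> where "\<psi> = inv_into (edges G) \<phi>"
  have \<psi>: "\<psi> (\<phi> e) = e" if "e \<in> edges G" for e
    using bij that by (simp add: \<psi>_def bij_betw_inv_into_left)
  have \<phi>: "\<phi> (\<psi> e) = e" "\<psi> e \<in> edges G" if "e \<in> edges H" for e
    using bij that bij_betw_inv_into[OF bij] by (auto simp: \<psi>_def bij_betw_inv_into_right bij_betw_def)
  have \<phi>H: "\<phi> e \<in> edges H" if "e \<in> edges G" for e using bij that by (auto simp: bij_betw_def)
  let ?\<Omega> = "\<lambda>G. {\<omega> \<in> edges G \<rightarrow>\<^sub>E {1..}. sum \<omega> (edges G) = l}"
  have star: "bij_betw \<phi> {e \<in> edges G. v \<in> e} {e \<in> edges H. f v \<in> e}" if v: "v \<in> verts G" for v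
  proof (rule bij_betw_imageI)
    show "inj_on \<phi> {e \<in> edges G. v \<in> e}"
      by (rule inj_on_subset[OF bij_betw_imp_inj_on[OF bij]]) auto
    have "v \<in> e" if "e \<in> edges G" "f v \<in> f ` e" for e
    proof -
      have "e \<subseteq> verts G" using that G by (auto simp: uniform_hypergraph_def)
      then show ?thesis using that(2) v bij_betw_imp_inj_on[OF f(1)] by (auto dest: inj_onD)
    qed
    then show "\<phi> ` {e \<in> edges G. v \<in> e} = {e \<in> edges H. f v \<in> e}"
      unfolding f(2)[symmetric] \<phi>_def by auto
  qed
  show ?thesis
    unfolding tree_coeff_def
  proof (rule sum.reindex_bij_witness[of _ "\<lambda>\<omega>. restrict (\<omega> \<circ> \<phi>) (edges G)" "\<lambda>\<omega>. restrict (\<omega> \<circ> \<psi>) (edges H)"])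
    fix \<omega> assume \<omega>: "\<omega> \<in> ?\<Omega> G"
    let ?\<omega> = "restrict (\<omega> \<circ> \<psi>) (edges H)"
    have w: "?\<omega> (\<phi> e) = \<omega> e" if "e \<in> edges G" for e using that by (simp add: \<phi>H \<psi>)
    show "restrict (?\<omega> \<circ> \<phi>) (edges G) = \<omega>"
      by (rule PiE_ext[of _ "edges G" "\<lambda>_. {1..}"]) (use \<omega> w in \<open>auto simp: PiE_iff\<close>)
    have "sum ?\<omega> (edges H) = sum \<omega> (edges G)"
      unfolding sum.reindex_bij_betw[OF bij, symmetric] using w by (intro sum.cong) auto
    then show "?\<omega> \<in> ?\<Omega> H" using \<omega> \<phi> by (auto simp: PiE_iff)
    have "wdegree G \<omega> v = wdegree H ?\<omega> (f v)" if "v \<in> verts G" for v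
      unfolding wdegree_def sum.reindex_bij_betw[OF star[OF that], symmetric]
      using w by (intro sum.cong) auto
    moreover have "wfact G \<omega> v = wfact H ?\<omega> (f v)" if "v \<in> verts G" for v
      unfolding wfact_def prod.reindex_bij_betw[OF star[OF that], symmetric]
      using w by (intro prod.cong) auto
    ultimately have "(\<Prod>v\<in>verts G. fact (wdegree G \<omega> v - 1) / real (wfact G \<omega> v)) =
        (\<Prod>v\<in>verts H. fact (wdegree H ?\<omega> v - 1) / real (wfact H ?\<omega> v))"
      unfolding prod.reindex_bij_betw[OF f(1), symmetric] by (intro prod.cong) auto
    moreover have "(\<Prod>e\<in>edges G. real (\<omega> e)) = (\<Prod>e\<in>edges H. real (?\<omega> e))"
      unfolding prod.reindex_bij_betw[OF bij, symmetric] using w by (intro prod.cong) auto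
    ultimately show "(\<Prod>e\<in>edges H. real (?\<omega> e)) * (\<Prod>v\<in>verts H. fact (wdegree H ?\<omega> v - 1) / real (wfact H ?\<omega> v)) =
      (\<Prod>e\<in>edges G. real (\<omega> e)) * (\<Prod>v\<in>verts G. fact (wdegree G \<omega> v - 1) / real (wfact G \<omega> v))"
      by simp
  next
    fix \<omega> assume \<omega>: "\<omega> \<in> ?\<Omega> H"
    let ?\<omega> = "restrict (\<omega> \<circ> \<phi>) (edges G)"
    show "restrict (?\<omega> \<circ> \<psi>) (edges H) = \<omega>"
      by (rule PiE_ext[of _ "edges H" "\<lambda>_. {1..}"]) (use \<omega> \<phi> in \<open>auto simp: PiE_iff\<close>)
    have "sum ?\<omega> (edges G) = sum \<omega> (edges H)"
      unfolding sum.reindex_bij_betw[OF bij, symmetric] by (intro sum.cong) auto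
    then show "?\<omega> \<in> ?\<Omega> G" using \<omega> \<phi>H by (auto simp: PiE_iff)
  qed
qed

lemma finite_subgraphs:
  assumes "simple_graph G"
  shows "finite {H. subgraph H G}"
proof (rule finite_subset)
  show "{H. subgraph H G} \<subseteq> (\<lambda>(V, E). Hypergraph V E) ` (Pow (verts G) \<times> Pow (edges G))"
  proof
    fix H assume "H \<in> {H. subgraph H G}"
    then show "H \<in> (\<lambda>(V, E). Hypergraph V E) ` (Pow (verts G) \<times> Pow (edges G))"
      by (intro image_eqI[of _ _ "(verts H, edges H)"]) (auto simp: subgraph_def)
  qed
  show "finite ((\<lambda>(V, E). Hypergraph V E) ` (Pow (verts G) \<times> Pow (edges G)))"
    using assms uniform_hypergraph_finite_edges[OF assms] by (auto simp: uniform_hypergraph_def)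
qed

lemma isomorphic_image:
  assumes "inj_on f (verts G)"
  shows "isomorphic G (Hypergraph (f ` verts G) ((\<lambda>e. f ` e) ` edges G))"
  unfolding isomorphic_def using assms by (intro exI[of _ f]) (auto simp: inj_on_imp_bij_betw)

text \<open>Every isomorphism class of trees with \<open>k\<close> edges thus has a member on the
  vertex set \<open>{..k}\<close>, which makes the number of classes finite.\<close>

lemma isomorphic_nat_tree:
  assumes "tree H"
  obtains T :: "nat hypergraph" where "isomorphic H T" "verts T = {..card (edges H)}"
proof -
  have "finite (verts H)" using assms by (auto simp: tree_iff uniform_hypergraph_def)
  then obtain f where "bij_betw f (verts H) {0..<card (verts H)}" using ex_bij_betw_finite_nat by blast
  moreover have "{0..<card (verts H)} = {..card (edges H)}" using tree_card[OF assms] by auto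
  ultimately have f: "bij_betw f (verts H) {..card (edges H)}" by simp
  show ?thesis
  proof (rule that)
    show "isomorphic H (Hypergraph (f ` verts H) ((\<lambda>e. f ` e) ` edges H))"
      by (rule isomorphic_image[OF bij_betw_imp_inj_on[OF f]])
  qed (use f in \<open>simp add: bij_betw_def\<close>)
qed

text \<open>Every subtree of \<open>U\<close> with \<open>k\<close> edges is isomorphic to the
  representative of exactly one class, and \<open>tree_coeff\<close> is constant on classes, so the
  sum can be taken over the subtrees themselves.\<close>

lemma tree_sum_subtrees:
  fixes U :: "'a hypergraph"
  assumes U: "simple_graph U"
  shows "tree_sum k l U = (\<Sum>H\<in>{H. subgraph H U \<and> tree H \<and> card (edges H) = k}. tree_coeff l H)"
proof -
  define S where "S = {T :: nat hypergraph. tree T \<and> card (edges T) = k}"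
  define R where "R = {(T, T'). T \<in> S \<and> T' \<in> S \<and> isomorphic T T'}"
  have classes: "tree_classes k = S // R" by (simp add: tree_classes_def S_def R_def Let_def)
  have simpleS: "simple_graph T" if "T \<in> S" for T using that by (simp add: S_def tree_iff)
  have eq: "equiv S R"
  proof (rule equivI)
    show "R \<subseteq> S \<times> S" by (auto simp: R_def)
    show "refl_on S R" by (auto simp: refl_on_def R_def isomorphic_refl)
    show "sym R" by (auto simp: sym_def R_def intro: isomorphic_sym simpleS)
    show "trans R" by (auto simp: trans_def R_def intro: isomorphic_trans)
  qed
  \<comment> \<open>The finitely many graphs on \<open>{..k}\<close> meet every class. Finiteness
    matters, as the sum over an infinite set of classes would be 0 by default.\<close>
  define F where "F = (\<lambda>E. Hypergraph {..k} E) ` Pow (Pow {..k})"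
  have "tree_classes k \<subseteq> (\<lambda>T. R `` {T}) ` F"
  proof
    fix \<tau> assume "\<tau> \<in> tree_classes k"
    then obtain T where T: "T \<in> S" "\<tau> = R `` {T}" unfolding classes by (rule quotientE)
    obtain T' :: "nat hypergraph" where T': "isomorphic T T'" "verts T' = {..k}"
      using isomorphic_nat_tree[of T] T(1) unfolding S_def by auto
    have "T' \<in> S" using isomorphic_tree[OF _ T'(1)] T(1) by (simp add: S_def)
    then have "(T, T') \<in> R" using T T' by (simp add: R_def)
    then have "\<tau> = R `` {T'}" unfolding T(2) using eq by (rule equiv_class_eq[rotated])
    moreover have "T' = Hypergraph {..k} (edges T')" using T'(2) by (cases T') simp
    moreover have "edges T' \<subseteq> Pow {..k}" using simpleS[OF \<open>T' \<in> S\<close>] T'(2) by (auto simp: uniform_hypergraph_def)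
    ultimately show "\<tau> \<in> (\<lambda>T. R `` {T}) ` F" unfolding F_def by blast
  qed
  moreover have "finite F" by (simp add: F_def)
  ultimately have finC: "finite (tree_classes k)" using finite_surj by blast
  have rep: "representative \<tau> \<in> \<tau>" "representative \<tau> \<in> S" if "\<tau> \<in> tree_classes k" for \<tau>
  proof -
    have "\<tau> \<noteq> {}" using that in_quotient_imp_non_empty[OF eq] by (simp add: classes)
    then show "representative \<tau> \<in> \<tau>" unfolding representative_def by (simp add: some_in_eq)
    then show "representative \<tau> \<in> S"
      using in_quotient_imp_subset[OF eq] that by (auto simp: classes)
  qed
  define \<H> :: "nat hypergraph set \<Rightarrow> 'a hypergraph set" where "\<H> \<tau> = {H. subgraph H U \<and> isomorphic H (representative \<tau>)}" for \<tau>
  have fin\<H>: "finite (\<H> \<tau>)" for \<tau>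
    by (rule finite_subset[OF _ finite_subgraphs[OF U]]) (auto simp: \<H>_def)
  have iso_rep: "isomorphic (representative \<tau>) H" if "H \<in> \<H> \<tau>" for \<tau> H
    using that by (auto simp: \<H>_def subgraph_def intro: isomorphic_sym)
  have "tree_sum k l U = (\<Sum>\<tau>\<in>tree_classes k. \<Sum>H\<in>\<H> \<tau>. tree_coeff l H)"
    unfolding tree_sum_def
  proof (rule sum.cong[OF refl])
    fix \<tau> assume "\<tau> \<in> tree_classes k"
    have "(\<Sum>H\<in>\<H> \<tau>. tree_coeff l H) = (\<Sum>H\<in>\<H> \<tau>. tree_coeff l (representative \<tau>))"
      by (intro sum.cong refl tree_coeff_isomorphic) (auto simp: \<H>_def subgraph_def)
    then show "tree_coeff l (representative \<tau>) * real (subgraph_count U (representative \<tau>)) =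
        (\<Sum>H\<in>\<H> \<tau>. tree_coeff l H)"
      by (simp add: subgraph_count_def \<H>_def)
  qed
  also have "\<dots> = (\<Sum>H\<in>(\<Union>\<tau>\<in>tree_classes k. \<H> \<tau>). tree_coeff l H)"
  proof (rule sum.UNION_disjoint[symmetric, OF finC])
    show "\<forall>\<tau>\<in>tree_classes k. finite (\<H> \<tau>)" using fin\<H> by simp
    show "\<forall>\<tau>\<in>tree_classes k. \<forall>\<tau>'\<in>tree_classes k. \<tau> \<noteq> \<tau>' \<longrightarrow> \<H> \<tau> \<inter> \<H> \<tau>' = {}"
    proof (intro ballI impI, rule ccontr)
      fix \<tau> \<tau>' assume \<tau>: "\<tau> \<in> tree_classes k" "\<tau>' \<in> tree_classes k" "\<tau> \<noteq> \<tau>'" and "\<H> \<tau> \<inter> \<H> \<tau>' \<noteq> {}"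
      then obtain H where H: "H \<in> \<H> \<tau>" "H \<in> \<H> \<tau>'" by blast
      then have "isomorphic (representative \<tau>) (representative \<tau>')"
        using isomorphic_trans[OF iso_rep[OF H(1)]] by (simp add: \<H>_def)
      then have "(representative \<tau>, representative \<tau>') \<in> R" using rep \<tau> by (simp add: R_def)
      then have "\<tau> = \<tau>'" using quotient_eqI[OF eq _ _ rep(1) rep(1)] \<tau> by (simp add: classes)
      with \<tau> show False by simp
    qed
  qed
  also have "(\<Union>\<tau>\<in>tree_classes k. \<H> \<tau>) = {H. subgraph H U \<and> tree H \<and> card (edges H) = k}"
  proof (intro equalityI subsetI)
    fix H assume "H \<in> (\<Union>\<tau>\<in>tree_classes k. \<H> \<tau>)"
    then obtain \<tau> where \<tau>: "\<tau> \<in> tree_classes k" "H \<in> \<H> \<tau>" by auto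
    then show "H \<in> {H. subgraph H U \<and> tree H \<and> card (edges H) = k}"
      using isomorphic_tree[OF _ iso_rep[OF \<tau>(2)]] rep(2)[OF \<tau>(1)] by (auto simp: S_def \<H>_def)
  next
    fix H assume H: "H \<in> {H. subgraph H U \<and> tree H \<and> card (edges H) = k}"
    then obtain T :: "nat hypergraph" where T: "isomorphic H T" using isomorphic_nat_tree[of H] by blast
    then have TS: "T \<in> S" using isomorphic_tree[OF _ T] H by (auto simp: S_def)
    let ?\<tau> = "R `` {T}"
    have \<tau>: "?\<tau> \<in> tree_classes k" unfolding classes using TS by (rule quotientI)
    then have "isomorphic T (representative ?\<tau>)" using rep(1)[OF \<tau>] by (auto simp: R_def)
    then have "H \<in> \<H> ?\<tau>" using H isomorphic_trans[OF T] by (simp add: \<H>_def)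
    then show "H \<in> (\<Union>\<tau>\<in>tree_classes k. \<H> \<tau>)" using \<tau> by blast
  qed
  finally show ?thesis .
qed

lemma connected_verts:
  assumes G: "simple_graph G" "connected_graph G" "edges G \<noteq> {}"
  shows "verts G = \<Union>(edges G)"
proof
  show "\<Union>(edges G) \<subseteq> verts G" using G by (auto simp: uniform_hypergraph_def)
  show "verts G \<subseteq> \<Union>(edges G)"
  proof
    fix v assume v: "v \<in> verts G"
    obtain e where e: "e \<in> edges G" using G by blast
    then have "e \<noteq> {}" using G by (auto simp: uniform_hypergraph_def)
    then obtain u where u: "u \<in> e" by blast
    have "u \<in> verts G" using u e G by (auto simp: uniform_hypergraph_def)
    then have "(v, u) \<in> {(x, y). {x, y} \<in> edges G}\<^sup>*" using v G(2) by (simp add: connected_graph_def)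
    then show "v \<in> \<Union>(edges G)"
    proof (cases rule: converse_rtranclE)
      case base
      then show ?thesis using u e by blast
    next
      case (step y)
      then show ?thesis by blast
    qed
  qed
qed

definition edge_graph :: "'a set set \<Rightarrow> 'a hypergraph" where
  "edge_graph X = Hypergraph (\<Union>X) X"

text \<open>A connected graph with at least one edge has no isolated vertex and is determined by its
  edges. The bound on \<open>k\<close> excludes the trees with a single vertex, which all have the
  empty edge set.\<close>

lemma tree_sum_edge_sets:
  assumes U: "simple_graph U" and k: "1 \<le> k"
  shows "tree_sum k l U = (\<Sum>X\<in>{X. X \<subseteq> edges U \<and> tree (edge_graph X) \<and> card X = k}. tree_coeff l (edge_graph X))"
proof -
  have "{H. subgraph H U \<and> tree H \<and> card (edges H) = k} =
     edge_graph ` {X. X \<subseteq> edges U \<and> tree (edge_graph X) \<and> card X = k}"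
  proof (intro equalityI subsetI)
    fix H assume H: "H \<in> {H. subgraph H U \<and> tree H \<and> card (edges H) = k}"
    then have "edges H \<noteq> {}" using k by auto
    then have "verts H = \<Union>(edges H)" using H by (intro connected_verts) (auto simp: tree_iff)
    then have "H = edge_graph (edges H)" by (cases H) (simp add: edge_graph_def)
    then show "H \<in> edge_graph ` {X. X \<subseteq> edges U \<and> tree (edge_graph X) \<and> card X = k}"
      using H by (intro image_eqI[of _ _ "edges H"]) (auto simp: subgraph_def)
  next
    fix H assume "H \<in> edge_graph ` {X. X \<subseteq> edges U \<and> tree (edge_graph X) \<and> card X = k}"
    then obtain X where "X \<subseteq> edges U" "tree H" "card X = k" "H = edge_graph X" by auto
    then show "H \<in> {H. subgraph H U \<and> tree H \<and> card (edges H) = k}"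
      using U by (auto simp: subgraph_def tree_iff edge_graph_def uniform_hypergraph_def)
  qed
  moreover have "inj_on edge_graph {X. X \<subseteq> edges U \<and> tree (edge_graph X) \<and> card X = k}"
    by (auto simp: inj_on_def edge_graph_def)
  ultimately show ?thesis
    unfolding tree_sum_subtrees[OF U] by (simp add: sum.reindex o_def)
qed

section \<open>Evaluation of Laplacian minors\<close>

lemma det_on_reindex:
  assumes "finite S" "inj_on f S"
  shows "det_on (f ` S) M = det_on S (\<lambda>i j. M (f i) (f j))"
proof -
  have bij: "bij_betw f S (f ` S)" using assms(2) by (rule inj_on_imp_bij_betw)
  have "bij_betw (map_permutation S f) {p. p permutes S} {p. p permutes (f ` S)}"
  proof -
    have "map_permutation S f = (\<lambda>p x. if x \<in> f ` S then f (p (inv_into S f x)) else x)"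
      by (auto simp: map_permutation_def restrict_id_def fun_eq_iff)
    then show ?thesis using bij_betw_permutations[OF bij] by simp
  qed
  then have "det_on (f ` S) M = (\<Sum>p | p permutes S. of_int (sign (map_permutation S f p)) *
      (\<Prod>i\<in>f ` S. M i (map_permutation S f p i)))"
    unfolding det_on_def by (rule sum.reindex_bij_betw[symmetric])
  also have "\<dots> = det_on S (\<lambda>i j. M (f i) (f j))"
    unfolding det_on_def
  proof (rule sum.cong[OF refl], goal_cases)
    case (1 p)
    then have p: "p permutes S" by simp
    have "sign (map_permutation S f p) = sign p"
      by (rule sign_map_permutation[OF assms(2) p assms(1)])
    moreover have "(\<Prod>i\<in>f ` S. M i (map_permutation S f p i)) = (\<Prod>i\<in>S. M (f i) (f (p i)))"
      using assms(2) by (simp add: prod.reindex map_permutation_apply)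
    ultimately show ?case by simp
  qed
  finally show ?thesis .
qed

text \<open>Each elimination of a vertex from a block of size \<open>c\<close> leaves a block of the same form with
  \<open>w\<close> replaced by \<open>w c / (c - 1)\<close> and \<open>c\<close> by \<open>c - 1\<close>.\<close>

lemma det_on_eliminate_clique:
  assumes "finite A" "finite Q" "A \<inter> Q = {}" "real (card A) < c" "w \<noteq> 0"
    and "\<And>v a. v \<in> A \<Longrightarrow> a \<in> A \<Longrightarrow> M v a = (if v = a then w * (c - 1) else - w)"
    and "\<And>v b. v \<in> A \<Longrightarrow> b \<in> Q \<Longrightarrow> M v b = - w * \<chi> b"
    and "\<And>b v. b \<in> Q \<Longrightarrow> v \<in> A \<Longrightarrow> M b v = - x b"
  shows "det_on (A \<union> Q) M = w ^ card A * c ^ card A * (c - real (card A)) / c *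
    det_on Q (\<lambda>b b'. M b b' - x b * \<chi> b' * real (card A) / (c - real (card A)))"
  using assms(1,3-)
proof (induction A arbitrary: M w c x)
  case empty
  then show ?case by simp
next
  case (insert v A)
  define s where "s = real (card A)"
  have card: "real (card (insert v A)) = s + 1" using insert.hyps by (simp add: s_def)
  have s: "0 \<le> s" "s + 1 < c" using insert.prems(2) unfolding card by (simp_all add: s_def)
  define w' where "w' = w * c / (c - 1)"
  have c: "c - 1 \<noteq> 0" "c \<noteq> 0" "c - 1 - s \<noteq> 0" using s by auto
  have w: "w \<noteq> 0" by (rule insert.prems(3))
  have Mvv: "M v v = w * (c - 1)" using insert.prems(4) by simp
  let ?M = "\<lambda>i j. M i j - M i v * M v j / M v v"
  have eq: "(A \<union> Q) = insert v A \<union> Q - {v}" using insert.hyps insert.prems(1) by auto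
  have "det_on (insert v A \<union> Q) M = M v v * det_on (insert v A \<union> Q - {v}) ?M"
    by (rule det_on_schur) (use insert.hyps assms(2) Mvv w c in auto)
  also have "det_on (insert v A \<union> Q - {v}) ?M = w' ^ card A * (c - 1) ^ card A * (c - 1 - real (card A)) / (c - 1) *
    det_on Q (\<lambda>b b'. ?M b b' - (x b * c / (c - 1)) * \<chi> b' * real (card A) / (c - 1 - real (card A)))"
    unfolding eq[symmetric]
  proof (rule insert.IH)
    show "A \<inter> Q = {}" using insert.prems(1) by auto
    show "real (card A) < c - 1" using s by (simp add: s_def)
    show "w' \<noteq> 0" using w c by (simp add: w'_def)
    fix a assume a: "a \<in> A"
    have av: "a \<noteq> v" using a insert.hyps by auto
    have M: "M a v = - w" "M v a = - w" using insert.prems(4)[of a v] insert.prems(4)[of v a] a av by auto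
    show "?M a b = (if a = b then w' * (c - 1 - 1) else - w')" if b: "b \<in> A" for b
    proof -
      have bv: "b \<noteq> v" using b insert.hyps by auto
      have "M v b = - w" using insert.prems(4)[of v b] b bv by auto
      moreover have "M a b = (if a = b then w * (c - 1) else - w)" using insert.prems(4)[of a b] a b by auto
      ultimately show ?thesis using M w c by (simp add: Mvv w'_def field_simps)
    qed
    show "?M a b = - w' * \<chi> b" if "b \<in> Q" for b
      using insert.prems(5)[of a b] insert.prems(5)[of v b] a that M w c by (simp add: Mvv w'_def field_simps)
    show "?M b a = - (x b * c / (c - 1))" if "b \<in> Q" for b
      using insert.prems(6)[of b a] insert.prems(6)[of b v] a that M w c by (simp add: Mvv field_simps)
  qed
  also have "det_on Q (\<lambda>b b'. ?M b b' - (x b * c / (c - 1)) * \<chi> b' * real (card A) / (c - 1 - real (card A))) =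
    det_on Q (\<lambda>b b'. M b b' - x b * \<chi> b' * (s + 1) / (c - (s + 1)))"
  proof (rule det_on_cong[OF refl])
    fix b b' assume b: "b \<in> Q" "b' \<in> Q"
    have "M b v = - x b" "M v b' = - w * \<chi> b'" using insert.prems(5)[of v b'] insert.prems(6)[of b v] b by auto
    \<comment> \<open>The first term is the correction caused by the pivot \<open>v\<close>, the
      second that of the \<open>s\<close> remaining vertices, whose columns were scaled by
      \<open>c / (c - 1)\<close>. Together they are the correction for \<open>s + 1\<close>
      vertices.\<close>
    moreover have "x b * (w * \<chi> b') / (w * (c - 1)) + (x b * c / (c - 1)) * \<chi> b' * s / (c - 1 - s) =
      x b * \<chi> b' * (s + 1) / (c - 1 - s)"
    proof -
      have "x b * (w * \<chi> b') / (w * (c - 1)) = x b * \<chi> b' * (1 / (c - 1))" using w by simp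
      moreover have "(x b * c / (c - 1)) * \<chi> b' * s / (c - 1 - s) = x b * \<chi> b' * (c * s / ((c - 1) * (c - 1 - s)))"
        by simp
      moreover have "1 / (c - 1) + c * s / ((c - 1) * (c - 1 - s)) = (s + 1) / (c - 1 - s)"
        using c by (simp add: divide_simps) (simp add: algebra_simps)
      ultimately show ?thesis by (metis distrib_left times_divide_eq_right)
    qed
    ultimately show "?M b b' - (x b * c / (c - 1)) * \<chi> b' * real (card A) / (c - 1 - real (card A)) =
      M b b' - x b * \<chi> b' * (s + 1) / (c - (s + 1))"
      unfolding Mvv s_def[symmetric] by (simp add: diff_diff_eq add.commute)
  qed
  finally have *: "det_on (insert v A \<union> Q) M =
    M v v * (w' ^ card A * (c - 1) ^ card A * (c - 1 - real (card A)) / (c - 1) *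
    det_on Q (\<lambda>b b'. M b b' - x b * \<chi> b' * (s + 1) / (c - (s + 1))))" .
  have "M v v * (w' ^ card A * (c - 1) ^ card A * (c - 1 - real (card A)) / (c - 1)) =
    w ^ card (insert v A) * c ^ card (insert v A) * (c - (s + 1)) / c"
  proof -
    have "w' ^ card A * (c - 1) ^ card A = w ^ card A * c ^ card A"
      using c by (simp add: w'_def power_mult_distrib[symmetric])
    then show ?thesis using c insert.hyps unfolding Mvv s_def[symmetric] by (simp add: diff_diff_eq add.commute)
  qed
  then show ?case unfolding * card by (simp only: mult.assoc[symmetric])
qed

text \<open>There are no entries between different blocks, so the blocks can be eliminated one after
  the other and their corrections on \<open>Q\<close> add up.\<close>

lemma det_on_eliminate_cliques:
  assumes "finite X" "finite Q" "\<And>e. e \<in> X \<Longrightarrow> finite (N e) \<and> card (N e) = s"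
    and "\<And>e. e \<in> X \<Longrightarrow> N e \<inter> Q = {}"
    and "\<And>e e'. e \<in> X \<Longrightarrow> e' \<in> X \<Longrightarrow> e \<noteq> e' \<Longrightarrow> N e \<inter> N e' = {}"
    and "real s < c" and "\<And>e. e \<in> X \<Longrightarrow> w e \<noteq> 0"
    and "\<And>e v a. e \<in> X \<Longrightarrow> v \<in> N e \<Longrightarrow> a \<in> N e \<Longrightarrow> M v a = (if v = a then w e * (c - 1) else - w e)"
    and "\<And>e e' v a. e \<in> X \<Longrightarrow> e' \<in> X \<Longrightarrow> e \<noteq> e' \<Longrightarrow> v \<in> N e \<Longrightarrow> a \<in> N e' \<Longrightarrow> M v a = 0"
    and "\<And>e v b. e \<in> X \<Longrightarrow> v \<in> N e \<Longrightarrow> b \<in> Q \<Longrightarrow> M v b = - w e * \<chi> e b"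
    and "\<And>e b v. e \<in> X \<Longrightarrow> b \<in> Q \<Longrightarrow> v \<in> N e \<Longrightarrow> M b v = - x e b"
  shows "det_on (\<Union>(N ` X) \<union> Q) M = (\<Prod>e\<in>X. w e ^ s * c ^ s * (c - real s) / c) *
    det_on Q (\<lambda>b b'. M b b' - (\<Sum>e\<in>X. x e b * \<chi> e b') * real s / (c - real s))"
  using assms(1,3-)
proof (induction X arbitrary: M)
  case empty
  then show ?case by simp
next
  case (insert f X)
  let ?Q = "\<Union>(N ` X) \<union> Q"
  \<comment> \<open>Cut down to \<open>Q\<close>: entries between \<open>N f\<close> and the other
    blocks are zero, so the correction changes neither those blocks nor their links to
    \<open>Q\<close>.\<close>
  let ?x = "\<lambda>b. if b \<in> Q then x f b else 0"
  let ?\<chi> = "\<lambda>b. if b \<in> Q then \<chi> f b else 0"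
  have Nf: "finite (N f)" "card (N f) = s" using insert.prems(1) by auto
  have disj: "N f \<inter> ?Q = {}"
  proof -
    have "N f \<inter> N e = {}" if "e \<in> X" for e using insert.prems(3)[of f e] insert.hyps that by auto
    then show ?thesis using insert.prems(2)[of f] by auto
  qed
  have NQ: "a \<notin> Q" if "a \<in> N e" "e \<in> insert f X" for a e using insert.prems(2) that by auto
  have step: "det_on (N f \<union> ?Q) M = w f ^ card (N f) * c ^ card (N f) * (c - real (card (N f))) / c *
    det_on ?Q (\<lambda>b b'. M b b' - ?x b * ?\<chi> b' * real (card (N f)) / (c - real (card (N f))))"
  proof (rule det_on_eliminate_clique)
    show "finite (N f)" by (rule Nf(1))
    show "finite ?Q" using insert.hyps(1) assms(2) insert.prems(1) by auto
    show "N f \<inter> ?Q = {}" by (rule disj)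
    show "real (card (N f)) < c" using insert.prems(4) Nf by simp
    show "w f \<noteq> 0" using insert.prems(5) by simp
    show "M v a = (if v = a then w f * (c - 1) else - w f)" if "v \<in> N f" "a \<in> N f" for v a
      using insert.prems(6)[of f v a] that by simp
    show "M v b = - w f * ?\<chi> b" if v: "v \<in> N f" and b: "b \<in> ?Q" for v b
    proof (cases "b \<in> Q")
      case True
      then show ?thesis using insert.prems(8)[of f v b] v by simp
    next
      case False
      then obtain e where e: "e \<in> X" "b \<in> N e" using b by auto
      then have "M v b = 0" using insert.prems(7)[of f e v b] v insert.hyps by auto
      then show ?thesis using False by simp
    qed
    show "M b v = - ?x b" if b: "b \<in> ?Q" and v: "v \<in> N f" for b v
    proof (cases "b \<in> Q")
      case True
      then show ?thesis using insert.prems(9)[of f b v] v by simp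
    next
      case False
      then obtain e where e: "e \<in> X" "b \<in> N e" using b by auto
      then have "M b v = 0" using insert.prems(7)[of e f b v] v insert.hyps by auto
      then show ?thesis using False by simp
    qed
  qed
  let ?M = "\<lambda>b b'. M b b' - ?x b * ?\<chi> b' * real s / (c - real s)"
  have "det_on ?Q ?M = (\<Prod>e\<in>X. w e ^ s * c ^ s * (c - real s) / c) *
    det_on Q (\<lambda>b b'. ?M b b' - (\<Sum>e\<in>X. x e b * \<chi> e b') * real s / (c - real s))"
  proof (rule insert.IH)
    show "finite (N e) \<and> card (N e) = s" if "e \<in> X" for e using insert.prems(1) that by simp
    show "N e \<inter> Q = {}" if "e \<in> X" for e using insert.prems(2) that by simp
    show "N e \<inter> N e' = {}" if "e \<in> X" "e' \<in> X" "e \<noteq> e'" for e e' using insert.prems(3) that by simp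
    show "real s < c" by (rule insert.prems(4))
    show "w e \<noteq> 0" if "e \<in> X" for e using insert.prems(5) that by simp
    show "?M v a = (if v = a then w e * (c - 1) else - w e)" if "e \<in> X" "v \<in> N e" "a \<in> N e" for e v a
      using insert.prems(6)[of e v a] NQ[of v e] that by simp
    show "?M v a = 0" if "e \<in> X" "e' \<in> X" "e \<noteq> e'" "v \<in> N e" "a \<in> N e'" for e e' v a
      using insert.prems(7)[of e e' v a] NQ[of v e] that by simp
    show "?M v b = - w e * \<chi> e b" if "e \<in> X" "v \<in> N e" "b \<in> Q" for e v b
      using insert.prems(8)[of e v b] NQ[of v e] that by simp
    show "?M b v = - x e b" if "e \<in> X" "b \<in> Q" "v \<in> N e" for e b v
      using insert.prems(9)[of e b v] NQ[of v e] that by simp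
  qed
  also have "det_on Q (\<lambda>b b'. ?M b b' - (\<Sum>e\<in>X. x e b * \<chi> e b') * real s / (c - real s)) =
    det_on Q (\<lambda>b b'. M b b' - (\<Sum>e\<in>insert f X. x e b * \<chi> e b') * real s / (c - real s))"
    by (rule det_on_cong[OF refl]) (use insert.hyps in \<open>simp add: ring_distribs add_divide_distrib\<close>)
  finally have "det_on ?Q ?M = (\<Prod>e\<in>X. w e ^ s * c ^ s * (c - real s) / c) *
    det_on Q (\<lambda>b b'. M b b' - (\<Sum>e\<in>insert f X. x e b * \<chi> e b') * real s / (c - real s))" .
  moreover have "\<Union>(N ` insert f X) \<union> Q = N f \<union> ?Q" by auto
  ultimately show ?case
    using step insert.hyps unfolding Nf(2) by simp
qed

text \<open>The weight \<open>k u e\<close> may depend on the end \<open>u\<close> of the edge,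
  since the two ends may select \<open>e\<close> unequally often; the matrix is then not symmetric,
  but for edges with two ends its rows still sum to zero.\<close>

definition edge_laplacian :: "'a set set \<Rightarrow> ('a \<Rightarrow> 'a set \<Rightarrow> real) \<Rightarrow> 'a \<Rightarrow> 'a \<Rightarrow> real" where
  "edge_laplacian X k u v = (if u = v then \<Sum>e\<in>{e \<in> X. u \<in> e}. k u e
     else - (\<Sum>e\<in>{e \<in> X. u \<in> e \<and> v \<in> e}. k u e))"

text \<open>The pivot at a leaf \<open>v\<close> is the weight of its edge \<open>{v, w}\<close>,
  and the Schur complement subtracts this weight from the diagonal entry of \<open>w\<close>, which
  leaves the Laplacian of the tree without the leaf.\<close>

lemma edge_laplacian_tree:
  assumes "finite S" "r \<in> S" "finite X" "\<And>e. e \<in> X \<Longrightarrow> e \<subseteq> S \<and> card e = 2" "\<not> has_cycle X"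
    "card S = card X + 1" "\<And>e. e \<in> X \<Longrightarrow> \<omega> e \<noteq> (0::real)"
  shows "det_on (S - {r}) (edge_laplacian X (\<lambda>_. \<omega>)) = (\<Prod>e\<in>X. \<omega> e)"
  using assms
proof (induction "card X" arbitrary: X S)
  case 0
  then have "X = {}" "card S = 1" by auto
  then obtain x where "S = {x}" by (auto simp: card_1_singleton_iff)
  then have "S = {r}" using "0.prems"(2) by simp
  then show ?case using \<open>X = {}\<close> by simp
next
  case (Suc n)
  have ne: "X \<noteq> {}" using Suc.hyps(2) by auto
  have two: "\<And>e. e \<in> X \<Longrightarrow> card e = 2" using Suc.prems(4) by blast
  obtain v w where v: "v \<noteq> r" "v \<noteq> w" "{v, w} \<in> X" and leaf: "\<And>e. e \<in> X \<Longrightarrow> v \<in> e \<Longrightarrow> e = {v, w}"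
    using acyclic_leaf[OF Suc.prems(3) ne two Suc.prems(5), of r] by blast
  let ?f = "{v, w}"
  have vS: "v \<in> S" using Suc.prems(4) v(3) by blast
  let ?L = "edge_laplacian X (\<lambda>_. \<omega>)"
  have star: "{e \<in> X. v \<in> e} = {?f}" using leaf v(3) by blast
  have Lvv: "?L v v = \<omega> ?f" by (simp add: edge_laplacian_def star)
  have mem: "e \<in> X \<and> a \<in> e \<and> v \<in> e \<longleftrightarrow> a = w \<and> e = ?f" if "a \<noteq> v" for a e
    using leaf[of e] v(3) that by blast
  have pair: "{e \<in> X. a \<in> e \<and> v \<in> e} = (if a = w then {?f} else {})" if "a \<noteq> v" for a
    unfolding mem[OF that] by simp
  have pair': "{e \<in> X. v \<in> e \<and> a \<in> e} = (if a = w then {?f} else {})" if "a \<noteq> v" for a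
    using pair[OF that] by (simp only: conj_commute)
  have Lv: "?L a v = (if a = w then - \<omega> ?f else 0)" "?L v a = (if a = w then - \<omega> ?f else 0)" if "a \<noteq> v" for a
    using that by (simp_all add: edge_laplacian_def pair pair')
  have "det_on (S - {r}) ?L = ?L v v * det_on (S - {r} - {v}) (\<lambda>i j. ?L i j - ?L i v * ?L v j / ?L v v)"
    by (rule det_on_schur) (use Suc.prems(1) vS v(1,3) Suc.prems(7) Lvv in auto)
  also have "det_on (S - {r} - {v}) (\<lambda>i j. ?L i j - ?L i v * ?L v j / ?L v v) =
      det_on (S - {v} - {r}) (edge_laplacian (X - {?f}) (\<lambda>_. \<omega>))"
  proof (rule det_on_cong)
    fix a b assume "a \<in> S - {r} - {v}" "b \<in> S - {r} - {v}"
    then have a: "a \<noteq> v" and b: "b \<noteq> v" by auto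
    have nz: "\<omega> ?f \<noteq> 0" using Suc.prems(7) v(3) by blast
    have del: "(\<Sum>e\<in>{e \<in> X. P e}. \<omega> e) = (\<Sum>e\<in>{e \<in> X - {?f}. P e}. \<omega> e) + (if P ?f then \<omega> ?f else 0)" for P
    proof (cases "P ?f")
      case True
      have "{e \<in> X. P e} - {?f} = {e \<in> X - {?f}. P e}" by auto
      then show ?thesis using True v(3) Suc.prems(3) by (simp add: sum.remove[of _ ?f])
    next
      case False
      then have "{e \<in> X. P e} = {e \<in> X - {?f}. P e}" by auto
      then show ?thesis using False by simp
    qed
    show "?L a b - ?L a v * ?L v b / ?L v v = edge_laplacian (X - {?f}) (\<lambda>_. \<omega>) a b"
    proof (cases "a = b")
      case True
      have "?L a a = edge_laplacian (X - {?f}) (\<lambda>_. \<omega>) a a + (if a = w then \<omega> ?f else 0)"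
        using a by (simp add: edge_laplacian_def del[of "\<lambda>e. a \<in> e"])
      then show ?thesis using True a nz by (simp add: Lv Lvv)
    next
      case False
      have "?L a b = edge_laplacian (X - {?f}) (\<lambda>_. \<omega>) a b"
        using a b False by (auto simp: edge_laplacian_def del[of "\<lambda>e. a \<in> e \<and> b \<in> e"])
      then show ?thesis using False a b by (auto simp: Lv)
    qed
  qed auto
  also have "\<dots> = (\<Prod>e\<in>X - {?f}. \<omega> e)"
  proof (rule Suc.hyps(1))
    show "n = card (X - {?f})" using Suc.hyps(2) v(3) Suc.prems(3) by simp
    show "r \<in> S - {v}" using Suc.prems(2) v(1) by simp
    show "e \<subseteq> S - {v} \<and> card e = 2" if "e \<in> X - {?f}" for e
      using that Suc.prems(4)[of e] leaf[of e] by blast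
    show "\<not> has_cycle (X - {?f})" using Suc.prems(5) has_cycle_mono[of "X - {?f}" X] by blast
    have "card X = card (X - {?f}) + 1" using card_Suc_Diff1[OF Suc.prems(3) v(3)] by simp
    moreover have "card S = card (S - {v}) + 1" using card_Suc_Diff1[OF Suc.prems(1) vS] by simp
    ultimately show "card (S - {v}) = card (X - {?f}) + 1" using Suc.prems(6) by linarith
  qed (use Suc.prems in auto)
  finally show ?case using Lvv prod.remove[OF Suc.prems(3) v(3), of \<omega>] by simp
qed

text \<open>\<open>Z\<close> is a union of components that avoids the root. Its columns sum to zero:
  a row outside \<open>Z\<close> has no entries there, and a row inside \<open>Z\<close> has all its
  entries there.\<close>

lemma edge_laplacian_disconnected:
  assumes "finite S" "Z \<subseteq> S" "Z \<noteq> {}" "finite X" "\<And>e. e \<in> X \<Longrightarrow> card e = 2"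
    and closed: "\<And>e. e \<in> X \<Longrightarrow> e \<inter> Z \<noteq> {} \<Longrightarrow> e \<subseteq> Z"
  shows "det_on S (edge_laplacian X k) = 0"
proof (rule det_on_dependent_cols[OF assms(1-3)])
  fix a assume "a \<in> S"
  have finZ: "finite Z" by (rule finite_subset[OF assms(2,1)])
  show "(\<Sum>z\<in>Z. edge_laplacian X k a z) = 0"
  proof (cases "a \<in> Z")
    case True
    have "(\<Sum>z\<in>Z - {a}. \<Sum>e\<in>{e \<in> X. a \<in> e \<and> z \<in> e}. k a e) =
        (\<Sum>z\<in>Z - {a}. \<Sum>e\<in>{e \<in> X. a \<in> e}. if z \<in> e then k a e else 0)"
      using assms(4) by (intro sum.cong refl sum.mono_neutral_cong_left) auto
    also have "\<dots> = (\<Sum>e\<in>{e \<in> X. a \<in> e}. \<Sum>z\<in>Z - {a}. if z \<in> e then k a e else 0)"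
      by (rule sum.swap)
    also have "\<dots> = (\<Sum>e\<in>{e \<in> X. a \<in> e}. k a e)"
    proof (rule sum.cong[OF refl])
      fix e assume "e \<in> {e \<in> X. a \<in> e}"
      then have e: "e \<in> X" "a \<in> e" by auto
      obtain b where b: "e = {a, b}" "a \<noteq> b"
        using assms(5)[OF e(1)] e(2) by (auto simp: card_2_iff doubleton_eq_iff)
      have "b \<in> Z" using closed[OF e(1)] e(2) True b by blast
      have "(\<Sum>z\<in>Z - {a}. if z \<in> e then k a e else 0) = (\<Sum>z\<in>Z - {a}. if z = b then k a e else 0)"
        using b by (intro sum.cong) auto
      then show "(\<Sum>z\<in>Z - {a}. if z \<in> e then k a e else 0) = k a e"
        using finZ \<open>b \<in> Z\<close> b by simp
    qed
    also have "(\<Sum>z\<in>Z - {a}. \<Sum>e\<in>{e \<in> X. a \<in> e \<and> z \<in> e}. k a e) =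
        - (\<Sum>z\<in>Z - {a}. edge_laplacian X k a z)"
      unfolding sum_negf[symmetric] by (rule sum.cong) (auto simp: edge_laplacian_def)
    finally have "(\<Sum>z\<in>Z - {a}. edge_laplacian X k a z) = - (\<Sum>e\<in>{e \<in> X. a \<in> e}. k a e)"
      by simp
    then show ?thesis
      using finZ True by (simp add: sum.remove[of Z a]) (simp add: edge_laplacian_def)
  next
    case False
    have "edge_laplacian X k a z = 0" if "z \<in> Z" for z
    proof -
      have "{e \<in> X. a \<in> e \<and> z \<in> e} = {}" using closed that False by blast
      moreover have "a \<noteq> z" using that False by blast
      ultimately show ?thesis by (simp add: edge_laplacian_def del: Collect_empty_eq)
    qed
    then show ?thesis by simp
  qed
qed

text \<open>The corner entry \<open>(a + 1) / a\<close> is the pivot reached after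
  \<open>a - 1\<close> eliminations in the matrix with 2 on the diagonal and -1 beside it; for
  \<open>a = 1\<close> it is 2. The product of the pivots telescopes.\<close>

lemma det_tridiagonal:
  assumes "1 \<le> a" "a \<le> n"
  shows "det_on {a..<n} (\<lambda>i j. if i = j then if i = a then (real a + 1) / real a else 2
    else if j = Suc i \<or> i = Suc j then - 1 else 0) = real n / real a"
  using assms(2,1)
proof (induction a rule: inc_induct)
  case base
  then show ?case by simp
next
  case (step a)
  let ?M = "\<lambda>i j. if i = j then if i = a then (real a + 1) / real a else 2
    else if j = Suc i \<or> i = Suc j then - 1 else (0 :: real)"
  have "det_on {a..<n} ?M = ?M a a * det_on ({a..<n} - {a}) (\<lambda>i j. ?M i j - ?M i a * ?M a j / ?M a a)"
    by (rule det_on_schur) (use step in auto)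
  also have "det_on ({a..<n} - {a}) (\<lambda>i j. ?M i j - ?M i a * ?M a j / ?M a a) =
    det_on {Suc a..<n} (\<lambda>i j. if i = j then if i = Suc a then (real (Suc a) + 1) / real (Suc a) else 2
    else if j = Suc i \<or> i = Suc j then - 1 else 0)"
  proof (rule det_on_cong)
    have pivot: "2 - 1 / ((real a + 1) / real a) = (real (Suc a) + 1) / real (Suc a)"
      using step by (simp add: field_simps)
    fix i j assume ij: "i \<in> {a..<n} - {a}" "j \<in> {a..<n} - {a}"
    show "?M i j - ?M i a * ?M a j / ?M a a = (if i = j then if i = Suc a then
        (real (Suc a) + 1) / real (Suc a) else 2 else if j = Suc i \<or> i = Suc j then - 1 else 0)"
    proof (cases "i = Suc a \<and> j = Suc a")
      case True
      then show ?thesis using pivot by simp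
    next
      case False
      then have "?M i a * ?M a j = 0" using ij by auto
      then show ?thesis using False ij by auto
    qed
  qed auto
  also have "\<dots> = real n / real (Suc a)" by (rule step.IH) simp
  also have "?M a a * (real n / real (Suc a)) = real n / real a" using step by (simp add: add.commute)
  finally show ?case .
qed

lemma det_bidiagonal:
  assumes "a \<le> n"
  shows "det_on {a..<n} (\<lambda>i j. if i = j then 2 else if j = Suc i then - 2 else 0) = 2 ^ (n - a)"
  using assms
proof (induction a rule: inc_induct)
  case base
  then show ?case by simp
next
  case (step a)
  let ?M = "\<lambda>i j. if i = j then 2 else if j = Suc i then - 2 else (0 :: real)"
  have "det_on {a..<n} ?M = ?M a a * det_on ({a..<n} - {a}) ?M"
    by (rule det_on_remove) (use step in auto)
  also have "{a..<n} - {a} = {Suc a..<n}" by auto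
  also have "det_on {Suc a..<n} ?M = 2 ^ (n - Suc a)" by (rule step.IH)
  also have "?M a a * 2 ^ (n - Suc a) = 2 ^ Suc (n - Suc a)" by simp
  also have "Suc (n - Suc a) = n - a" using step by simp
  finally show ?case .
qed

section \<open>The trace of a power hypergraph as a sum over edge multiplicities\<close>

locale power_graph =
  fixes U :: "'a hypergraph" and m :: nat
  assumes simple: "simple_graph U" and m: "3 \<le> m"
begin

definition "V = verts (power_hypergraph U m)"

definition hyp :: "'a set \<Rightarrow> ('a + 'a set \<times> nat) set" where
  "hyp e = Inl ` e \<union> (\<lambda>j. Inr (e, j)) ` {1..m-2}"

definition "inc i = {e \<in> edges U. i \<in> hyp e}"

text \<open>An assignment \<open>K\<close> records how often the row operator of the vertex \<open>i\<close> selects the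
  hyperedge of \<open>e\<close>; \<open>arcs K\<close> is the resulting multigraph.\<close>

definition assignments :: "nat \<Rightarrow> ('a + 'a set \<times> nat \<Rightarrow> 'a set \<Rightarrow> nat) set" where
  "assignments d = {K \<in> \<Pi>\<^sub>E i\<in>V. inc i \<rightarrow>\<^sub>E UNIV. (\<Sum>i\<in>V. sum (K i) (inc i)) = d}"

definition wdeg :: "('a + 'a set \<times> nat \<Rightarrow> 'a set \<Rightarrow> nat) \<Rightarrow> 'a + 'a set \<times> nat \<Rightarrow> nat" where
  "wdeg K i = sum (K i) (inc i)"

definition arcs :: "('a + 'a set \<times> nat \<Rightarrow> 'a set \<Rightarrow> nat) \<Rightarrow>
    ('a + 'a set \<times> nat) \<times> ('a + 'a set \<times> nat) \<Rightarrow>\<^sub>0 nat" where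
  "arcs K = (\<Sum>i\<in>V. \<Sum>e\<in>inc i. \<Sum>_<K i e. \<Sum>j\<in>hyp e - {i}. Poly_Mapping.single (i, j) 1)"

definition weight :: "nat \<Rightarrow> ('a + 'a set \<times> nat \<Rightarrow> 'a set \<Rightarrow> nat) \<Rightarrow> real" where
  "weight d K = (\<Prod>i\<in>V. multinom (inc i) (K i) / fact (wdeg K i * (m - 1))) *
     (\<Sum>r\<in>V. trails V (d * (m - 1)) r r (arcs K))"

lemma V_eq: "V = Inl ` verts U \<union> Inr ` (edges U \<times> {1..m-2})"
  by (simp add: V_def power_hypergraph_def)

lemma finite_verts: "finite (verts U)"
  using simple by (simp add: uniform_hypergraph_def)

lemma finite_edges: "finite (edges U)"
  using simple by (rule uniform_hypergraph_finite_edges)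

lemma edge_subset: "e \<in> edges U \<Longrightarrow> e \<subseteq> verts U"
  using simple by (simp add: uniform_hypergraph_def)

lemma edge_card: "e \<in> edges U \<Longrightarrow> card e = 2"
  using simple by (simp add: uniform_hypergraph_def)

lemma finite_V: "finite V"
  using finite_verts finite_edges by (simp add: V_eq)

lemma finite_inc: "finite (inc i)"
  using finite_edges by (simp add: inc_def)

lemma card_V: "card V = card (verts U) + card (edges U) * (m - 2)"
proof -
  have "card V = card (Inl ` verts U :: ('a + 'a set \<times> nat) set) + card (Inr ` (edges U \<times> {1..m-2}) :: ('a + 'a set \<times> nat) set)"
    unfolding V_eq using finite_verts finite_edges by (intro card_Un_disjoint) auto
  then show ?thesis by (simp add: card_image card_cartesian_product)
qed

lemma hyp_subset: "e \<in> edges U \<Longrightarrow> hyp e \<subseteq> V"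
  using edge_subset by (auto simp: hyp_def V_eq)

lemma finite_edge: "e \<in> edges U \<Longrightarrow> finite e"
  using finite_subset[OF edge_subset finite_verts] .

lemma finite_hyp: "e \<in> edges U \<Longrightarrow> finite (hyp e)"
  using finite_subset[OF hyp_subset finite_V] .

lemma card_hyp:
  assumes "e \<in> edges U"
  shows "card (hyp e) = m"
proof -
  have "card (hyp e) = card (Inl ` e :: ('a + 'a set \<times> nat) set) + card ((\<lambda>j. Inr (e, j)) ` {1..m-2} :: ('a + 'a set \<times> nat) set)"
    unfolding hyp_def using finite_edge[OF assms] by (intro card_Un_disjoint) auto
  also have "\<dots> = card e + (m - 2)" by (simp add: card_image inj_on_def)
  finally show ?thesis using edge_card[OF assms] m by simp
qed

lemma inj_hyp: "inj hyp"
proof (rule injI)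
  fix e f assume eq: "hyp e = hyp f"
  have "Inr (e, 1) \<in> hyp e" using m by (auto simp: hyp_def)
  then show "e = f" unfolding eq by (auto simp: hyp_def)
qed

lemma Inl_in_hyp: "Inl u \<in> hyp e \<longleftrightarrow> u \<in> e"
  by (auto simp: hyp_def)

lemma Inr_in_hyp: "Inr (f, t) \<in> hyp e \<longleftrightarrow> f = e \<and> t \<in> {1..m-2}"
  by (auto simp: hyp_def)

lemma inc_Inl: "inc (Inl u) = {e \<in> edges U. u \<in> e}"
  by (simp add: inc_def Inl_in_hyp)

lemma inc_Inr: "e \<in> edges U \<Longrightarrow> t \<in> {1..m-2} \<Longrightarrow> inc (Inr (e, t)) = {e}"
  by (auto simp: inc_def Inr_in_hyp)

lemma edges_power: "edges (power_hypergraph U m) = hyp ` edges U"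
  by (simp add: power_hypergraph_def hyp_def)

lemma uniform_power: "uniform_hypergraph m (power_hypergraph U m)"
  unfolding uniform_hypergraph_def edges_power V_def[symmetric]
  using finite_V hyp_subset card_hyp by auto

text \<open>Hyperedges are replaced by the edges of \<open>U\<close> as indices, which is possible
  because \<open>hyp\<close> is injective.\<close>

lemma taylor_row_operator_power:
  "taylor (row_operator m V (adjacency_tensor m (power_hypergraph U m)) i p) \<mu> =
    (\<Sum>e\<in>inc i. taylor p (\<mu> + (\<Sum>j\<in>hyp e - {i}. Poly_Mapping.single (i, j) 1)))"
proof -
  have "{h \<in> hyp ` edges U. i \<in> h} = hyp ` inc i" by (auto simp: inc_def)
  then show ?thesis
    using taylor_row_operator_adjacency[OF uniform_power, of i p \<mu>] m
    unfolding V_def[symmetric] edges_power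
    by (simp add: sum.reindex[OF inj_on_subset[OF inj_hyp subset_UNIV]] o_def)
qed

lemma trace_expansion:
  "hypergraph_trace m (power_hypergraph U m) d =
     real (m - 1) ^ (card V - 1) * (\<Sum>K\<in>assignments d. weight d K)"
proof -
  have "hypergraph_trace m (power_hypergraph U m) d =
    tensor_trace m V (adjacency_tensor m (power_hypergraph U m)) d"
    by (simp add: hypergraph_trace_def V_def)
  also have "\<dots> = real (m - 1) ^ (card V - 1) * (\<Sum>K\<in>assignments d. weight d K)"
    unfolding assignments_def weight_def trails_def wdeg_def arcs_def
    by (rule tensor_trace_expansion[OF finite_V finite_inc taylor_row_operator_power])
  finally show ?thesis .
qed

lemma finite_assignments: "finite (assignments d)"
proof (rule finite_subset)
  show "assignments d \<subseteq> (\<Pi>\<^sub>E i\<in>V. inc i \<rightarrow>\<^sub>E {..d})"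
  proof
    fix K assume K: "K \<in> assignments d"
    have "K i e \<le> d" if "i \<in> V" "e \<in> inc i" for i e
    proof -
      have "K i e \<le> sum (K i) (inc i)" by (rule member_le_sum) (use that finite_inc in auto)
      also have "\<dots> \<le> (\<Sum>i\<in>V. sum (K i) (inc i))"
        by (rule member_le_sum[of i V "\<lambda>i. sum (K i) (inc i)"]) (use that finite_V in auto)
      finally show ?thesis using K by (simp add: assignments_def)
    qed
    then show "K \<in> (\<Pi>\<^sub>E i\<in>V. inc i \<rightarrow>\<^sub>E {..d})"
      using K by (auto simp: assignments_def PiE_iff)
  qed
  show "finite (\<Pi>\<^sub>E i\<in>V. inc i \<rightarrow>\<^sub>E {..d})"
    using finite_V finite_inc by (intro finite_PiE) auto
qed

lemma lookup_arcs:
  "Poly_Mapping.lookup (arcs K) (i, j) =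
     (if i \<in> V then \<Sum>e\<in>inc i. if j \<in> hyp e - {i} then K i e else 0 else 0)"
proof -
  have inner: "(\<Sum>_<K i' e. \<Sum>j'\<in>hyp e - {i'}. Poly_Mapping.lookup (Poly_Mapping.single (i', j') (1::nat)) (i, j)) =
      (if i' = i then if j \<in> hyp e - {i} then K i e else 0 else 0)" if "e \<in> edges U" for i' e
  proof -
    have "(\<Sum>j'\<in>hyp e - {i'}. Poly_Mapping.lookup (Poly_Mapping.single (i', j') (1::nat)) (i, j)) =
      (\<Sum>j'\<in>hyp e - {i'}. if j' = j then if i' = i then 1 else 0 else 0)"
      by (intro sum.cong) (auto simp: lookup_single when_def)
    then show ?thesis using finite_hyp[OF that] by simp
  qed
  have "Poly_Mapping.lookup (arcs K) (i, j) =
     (\<Sum>i'\<in>V. \<Sum>e\<in>inc i'. if i' = i then if j \<in> hyp e - {i} then K i e else 0 else 0)"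
    unfolding arcs_def lookup_sum
    by (intro sum.cong refl inner) (simp add: inc_def)
  also have "\<dots> = (\<Sum>i'\<in>V. if i' = i then \<Sum>e\<in>inc i. if j \<in> hyp e - {i} then K i e else 0 else 0)"
    by (intro sum.cong) auto
  also have "\<dots> = (if i \<in> V then \<Sum>e\<in>inc i. if j \<in> hyp e - {i} then K i e else 0 else 0)"
    using finite_V by simp
  finally show ?thesis .
qed

lemma keys_arcs: "Poly_Mapping.keys (arcs K) \<subseteq> V \<times> V"
proof
  fix x assume "x \<in> Poly_Mapping.keys (arcs K)"
  then obtain i j where x: "x = (i, j)" "Poly_Mapping.lookup (arcs K) (i, j) \<noteq> 0"
    by (cases x) (auto simp: in_keys_iff)
  then have i: "i \<in> V" and "(\<Sum>e\<in>inc i. if j \<in> hyp e - {i} then K i e else 0) \<noteq> 0"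
    by (auto simp: lookup_arcs split: if_splits)
  then obtain e where "e \<in> inc i" "(if j \<in> hyp e - {i} then K i e else 0) \<noteq> 0"
    by (rule_tac sum.not_neutral_contains_not_neutral)
  then have "j \<in> hyp e" "e \<in> edges U" by (auto simp: inc_def split: if_splits)
  then show "x \<in> V \<times> V" using hyp_subset i x by auto
qed

lemma outdeg_arcs:
  assumes "i \<in> V"
  shows "outdeg V (arcs K) i = (m - 1) * wdeg K i"
proof -
  have "outdeg V (arcs K) i = (\<Sum>e\<in>inc i. \<Sum>b\<in>V. if b \<in> hyp e - {i} then K i e else 0)"
    unfolding outdeg_def lookup_arcs using assms by (simp add: sum.swap[of _ V])
  also have "\<dots> = (\<Sum>e\<in>inc i. (m - 1) * K i e)"
  proof (rule sum.cong[OF refl])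
    fix e assume e: "e \<in> inc i"
    then have eU: "e \<in> edges U" "i \<in> hyp e" by (auto simp: inc_def)
    have "(\<Sum>b\<in>V. if b \<in> hyp e - {i} then K i e else 0) = (\<Sum>b\<in>hyp e - {i}. K i e)"
      using finite_V hyp_subset[OF eU(1)] by (intro sum.mono_neutral_cong_right) auto
    then show "(\<Sum>b\<in>V. if b \<in> hyp e - {i} then K i e else 0) = (m - 1) * K i e"
      using eU card_hyp[OF eU(1)] by (simp add: card_Diff_singleton)
  qed
  finally show ?thesis by (simp add: wdeg_def sum_distrib_left)
qed

section \<open>Balanced assignments and their edge multiplicities\<close>

definition total :: "('a + 'a set \<times> nat \<Rightarrow> 'a set \<Rightarrow> nat) \<Rightarrow> 'a set \<Rightarrow> nat" where
  "total K e = (\<Sum>i\<in>hyp e. K i e)"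

text \<open>Every selection of \<open>e\<close> by a vertex other than \<open>j\<close> produces one
  arc into \<open>j\<close>; adding \<open>wdeg K j\<close> supplies the selections made by
  \<open>j\<close> itself.\<close>

lemma indeg_arcs: "indeg V (arcs K) j + wdeg K j = (\<Sum>e\<in>inc j. total K e)"
proof -
  have "indeg V (arcs K) j = (\<Sum>a\<in>V. \<Sum>e\<in>inc a. if j \<in> hyp e - {a} then K a e else 0)"
    by (simp add: indeg_def lookup_arcs)
  also have "\<dots> = (\<Sum>a\<in>V. \<Sum>e\<in>edges U. if e \<in> inc j \<and> a \<in> hyp e - {j} then K a e else 0)"
    using finite_edges by (intro sum.cong refl sum.mono_neutral_cong_left) (auto simp: inc_def)
  also have "\<dots> = (\<Sum>e\<in>edges U. \<Sum>a\<in>V. if e \<in> inc j \<and> a \<in> hyp e - {j} then K a e else 0)"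
    by (rule sum.swap)
  also have "\<dots> = (\<Sum>e\<in>inc j. \<Sum>a\<in>V. if a \<in> hyp e - {j} then K a e else 0)"
    using finite_edges finite_V by (intro sum.mono_neutral_cong_right) (auto simp: inc_def)
  also have "\<dots> = (\<Sum>e\<in>inc j. \<Sum>a\<in>hyp e - {j}. K a e)"
    using finite_V hyp_subset
    by (intro sum.cong refl sum.mono_neutral_cong_right) (auto simp: inc_def)
  finally have "indeg V (arcs K) j + wdeg K j = (\<Sum>e\<in>inc j. (\<Sum>a\<in>hyp e - {j}. K a e) + K j e)"
    by (simp add: wdeg_def sum.distrib)
  also have "\<dots> = (\<Sum>e\<in>inc j. total K e)"
  proof (rule sum.cong[OF refl])
    fix e assume "e \<in> inc j"
    then have "e \<in> edges U" "j \<in> hyp e" by (auto simp: inc_def)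
    then show "(\<Sum>a\<in>hyp e - {j}. K a e) + K j e = total K e"
      using sum.remove[OF finite_hyp, of e j "\<lambda>a. K a e"] by (simp add: total_def)
  qed
  finally show ?thesis .
qed

text \<open>Equality of out-degree \<open>(m - 1) * wdeg K j\<close> and in-degree, with
  \<open>wdeg K j\<close> added on both sides; see \<open>balanced_iff\<close>.\<close>

definition balanced :: "('a + 'a set \<times> nat \<Rightarrow> 'a set \<Rightarrow> nat) \<Rightarrow> bool" where
  "balanced K \<longleftrightarrow> (\<forall>j\<in>V. m * wdeg K j = (\<Sum>e\<in>inc j. total K e))"

lemma balanced_iff:
  assumes "j \<in> V"
  shows "m * wdeg K j = (\<Sum>e\<in>inc j. total K e) \<longleftrightarrow> outdeg V (arcs K) j = indeg V (arcs K) j"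
proof -
  have "m * wdeg K j = (m - 1) * wdeg K j + wdeg K j"
    using m by (cases m) simp_all
  then show ?thesis unfolding outdeg_arcs[OF assms] indeg_arcs[symmetric] by linarith
qed

lemma weight_unbalanced:
  assumes "\<not> balanced K"
  shows "weight d K = 0"
proof -
  obtain j where j: "j \<in> V" "outdeg V (arcs K) j \<noteq> indeg V (arcs K) j"
    using assms balanced_iff unfolding balanced_def by blast
  have "trails V (d * (m - 1)) r r (arcs K) = 0" if "r \<in> V" for r
    using trails_balanced[OF finite_V that that _ j(1), of "d * (m - 1)" "arcs K"] j(2) by auto
  then show ?thesis by (simp add: weight_def)
qed

text \<open>The multiplicity of an edge is read off at its first new vertex, which exists because
  \<open>3 \<le> m\<close>; for balanced \<open>K\<close> all new vertices of \<open>e\<close> agree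
  by \<open>balanced_new_eq\<close>.\<close>

definition emult :: "('a + 'a set \<times> nat \<Rightarrow> 'a set \<Rightarrow> nat) \<Rightarrow> 'a set \<Rightarrow> nat" where
  "emult K e = K (Inr (e, 1)) e"

definition support :: "('a + 'a set \<times> nat \<Rightarrow> 'a set \<Rightarrow> nat) \<Rightarrow> 'a set set" where
  "support K = {e \<in> edges U. 0 < emult K e}"

text \<open>A new vertex lies in a single hyperedge, so its balance condition concerns that
  hyperedge alone.\<close>

lemma balanced_new:
  assumes "balanced K" "e \<in> edges U" "t \<in> {1..m-2}"
  shows "m * K (Inr (e, t)) e = total K e"
proof -
  have "Inr (e, t) \<in> V" using assms(2,3) by (auto simp: V_eq)
  then show ?thesis
    using assms(1) inc_Inr[OF assms(2,3)] by (auto simp: balanced_def wdeg_def)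
qed

lemma balanced_edge_total:
  assumes "balanced K" "e \<in> edges U"
  shows "total K e = m * emult K e"
  using balanced_new[OF assms, of 1] m by (simp add: emult_def)

lemma balanced_new_eq:
  assumes "balanced K" "e \<in> edges U" "t \<in> {1..m-2}"
  shows "K (Inr (e, t)) e = emult K e"
  using balanced_new[OF assms] balanced_edge_total[OF assms(1,2)] m by simp

lemma total_eq:
  assumes "e \<in> edges U" "e = {u, v}" "u \<noteq> v"
  shows "total K e = K (Inl u) e + K (Inl v) e + (\<Sum>t\<in>{1..m-2}. K (Inr (e, t)) e)"
proof -
  have "total K e = (\<Sum>i\<in>Inl ` e. K i e) + (\<Sum>i\<in>(\<lambda>j. Inr (e, j)) ` {1..m-2}. K i e)"
    unfolding total_def hyp_def using finite_edge[OF assms(1)] by (intro sum.union_disjoint) auto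
  also have "(\<Sum>i\<in>Inl ` e. K i e) = K (Inl u) e + K (Inl v) e"
    using assms(3) by (subst sum.reindex) (auto simp: assms(2))
  also have "(\<Sum>i\<in>(\<lambda>j. Inr (e, j)) ` {1..m-2}. K i e) = (\<Sum>t\<in>{1..m-2}. K (Inr (e, t)) e)"
    by (subst sum.reindex) (auto simp: inj_on_def)
  finally show ?thesis .
qed

text \<open>Of the \<open>m * emult K e\<close> selections of \<open>e\<close> the new vertices make
  \<open>(m - 2) * emult K e\<close>. Hence the deviations of the two ends from
  \<open>emult K e\<close> are opposite, so that they form a flow along \<open>e\<close>.\<close>

lemma balanced_old:
  assumes "balanced K" "e \<in> edges U" "e = {u, v}" "u \<noteq> v"
  shows "K (Inl u) e + K (Inl v) e = 2 * emult K e"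
proof -
  have "total K e = m * emult K e" by (rule balanced_edge_total[OF assms(1,2)])
  moreover have "(\<Sum>t\<in>{1..m-2}. K (Inr (e, t)) e) = (m - 2) * emult K e"
    using balanced_new_eq[OF assms(1,2)] by simp
  moreover have "m * emult K e = (m - 2) * emult K e + 2 * emult K e"
    using m by (metis Suc_leD add_mult_distrib le_add_diff_inverse2 numeral_2_eq_2 numeral_3_eq_3)
  ultimately show ?thesis using total_eq[OF assms(2-4), of K] by linarith
qed

text \<open>At an old vertex this says that the deviations from \<open>emult\<close> sum to zero,
  the conservation law of the circulation.\<close>

lemma balanced_wdeg:
  assumes "balanced K" "j \<in> V"
  shows "wdeg K j = (\<Sum>e\<in>inc j. emult K e)"
proof -
  have "(\<Sum>e\<in>inc j. total K e) = (\<Sum>e\<in>inc j. m * emult K e)"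
    using balanced_edge_total[OF assms(1)] by (intro sum.cong) (auto simp: inc_def)
  then have "m * wdeg K j = m * (\<Sum>e\<in>inc j. emult K e)"
    using assms by (simp add: balanced_def sum_distrib_left)
  then show ?thesis using m by simp
qed

lemma balanced_total:
  assumes "balanced K"
  shows "(\<Sum>i\<in>V. wdeg K i) = m * (\<Sum>e\<in>edges U. emult K e)"
proof -
  have "(\<Sum>i\<in>V. wdeg K i) = (\<Sum>i\<in>V. \<Sum>e\<in>edges U. if i \<in> hyp e then K i e else 0)"
    unfolding wdeg_def inc_def using finite_edges
    by (intro sum.cong refl sum.mono_neutral_cong_left) auto
  also have "\<dots> = (\<Sum>e\<in>edges U. \<Sum>i\<in>V. if i \<in> hyp e then K i e else 0)"
    by (rule sum.swap)
  also have "\<dots> = (\<Sum>e\<in>edges U. total K e)"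
    unfolding total_def using finite_V hyp_subset
    by (intro sum.cong refl sum.mono_neutral_cong_right) auto
  also have "\<dots> = (\<Sum>e\<in>edges U. m * emult K e)"
    using balanced_edge_total[OF assms] by (intro sum.cong) auto
  finally show ?thesis by (simp add: sum_distrib_left)
qed

lemma balanced_K_zero:
  assumes "balanced K" "e \<in> edges U" "i \<in> hyp e" "e \<notin> support K"
  shows "K i e = 0"
proof -
  have "total K e = 0"
    using balanced_edge_total[OF assms(1,2)] assms(2,4) by (simp add: support_def)
  then show ?thesis using finite_hyp[OF assms(2)] assms(3) by (simp add: total_def)
qed

section \<open>The active vertices and the weight of a balanced assignment\<close>

lemma wdeg_pos_iff:
  assumes "balanced K" "j \<in> V"
  shows "0 < wdeg K j \<longleftrightarrow> j \<in> Inl ` \<Union>(support K) \<union> Inr ` (support K \<times> {1..m-2})"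
proof -
  have "0 < wdeg K j \<longleftrightarrow> \<not> (\<forall>e\<in>inc j. emult K e = 0)"
    unfolding balanced_wdeg[OF assms] sum_eq_0_iff[OF finite_inc, symmetric] by simp
  also have "\<dots> \<longleftrightarrow> (\<exists>e\<in>inc j. e \<in> support K)"
    by (auto simp: support_def inc_def)
  also have "\<dots> \<longleftrightarrow> j \<in> Inl ` \<Union>(support K) \<union> Inr ` (support K \<times> {1..m-2})"
  proof (cases j)
    case (Inl u)
    have "(\<exists>e\<in>inc j. e \<in> support K) \<longleftrightarrow> u \<in> \<Union>(support K)"
      unfolding Inl inc_Inl by (auto simp: support_def)
    then show ?thesis unfolding Inl by auto
  next
    case (Inr b)
    then obtain f t where j: "j = Inr (f, t)" by (cases b) auto
    have ft: "f \<in> edges U" "t \<in> {1..m-2}" using assms(2) unfolding j V_eq by auto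
    then show ?thesis unfolding j inc_Inr[OF ft] by auto
  qed
  finally show ?thesis .
qed

lemma active_arcs:
  assumes "balanced K"
  shows "active V (arcs K) = Inl ` \<Union>(support K) \<union> Inr ` (support K \<times> {1..m-2})"
proof -
  have "active V (arcs K) = {j \<in> V. 0 < wdeg K j}"
    unfolding active_def using outdeg_arcs m by auto
  also have "\<dots> = V \<inter> (Inl ` \<Union>(support K) \<union> Inr ` (support K \<times> {1..m-2}))"
    using wdeg_pos_iff[OF assms] by auto
  also have "\<dots> = Inl ` \<Union>(support K) \<union> Inr ` (support K \<times> {1..m-2})"
    using edge_subset by (auto simp: V_eq support_def)
  finally show ?thesis .
qed

text \<open>The new vertices of an edge form a block as in \<open>det_on_eliminate_cliques\<close>
  with \<open>c = m\<close>, \<open>w = emult K e\<close> and \<open>s = m - 2\<close>, so that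
  \<open>c - s = 2\<close>. What remains on the old vertices is a multiple of the edge
  Laplacian.\<close>

lemma det_arcs:
  assumes bal: "balanced K" and r: "r \<in> \<Union>(support K)"
  shows "det_on (active V (arcs K) - {Inl r}) (laplacian V (arcs K)) =
    (\<Prod>e\<in>support K. real (emult K e) ^ (m - 2) * real m ^ (m - 2) * 2 / real m) *
    ((real m / 2) ^ (card (\<Union>(support K)) - 1) *
     det_on (\<Union>(support K) - {r}) (edge_laplacian (support K) (\<lambda>u e. real (K (Inl u) e))))"
proof -
  let ?X = "support K"
  let ?N = "\<lambda>e. Inr ` ({e} \<times> {1..m-2}) :: ('a + 'a set \<times> nat) set"
  let ?Q = "Inl ` (\<Union>?X - {r}) :: ('a + 'a set \<times> nat) set"
  let ?L = "laplacian V (arcs K)"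
  define \<chi> :: "'a set \<Rightarrow> 'a + 'a set \<times> nat \<Rightarrow> real" where "\<chi> = (\<lambda>e b. if b \<in> hyp e then 1 else 0)"
  define x :: "'a set \<Rightarrow> 'a + 'a set \<times> nat \<Rightarrow> real" where "x = (\<lambda>e b. if b \<in> hyp e then real (K b e) else 0)"
  have X: "e \<in> edges U" if "e \<in> ?X" for e using that by (simp add: support_def)
  have finX: "finite ?X" using finite_edges by (simp add: support_def)
  have finUX: "finite (\<Union>?X)" using finX finite_edge X by auto
  have NV: "Inr (e, t) \<in> V" if "e \<in> ?X" "t \<in> {1..m-2}" for e t using that X by (auto simp: V_eq)
  have QV: "Inl u \<in> V" if "u \<in> \<Union>?X" for u using that X edge_subset by (auto simp: V_eq)
  have new: "K (Inr (e, t)) e = emult K e" if "e \<in> ?X" "t \<in> {1..m-2}" for e t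
    using balanced_new_eq[OF bal X] that by blast
  have Lnew: "?L (Inr (e, t)) b = (if Inr (e, t) = b then real (m - 1) * real (emult K e) else
      if b \<in> hyp e then - real (emult K e) else 0)" if e: "e \<in> ?X" and t: "t \<in> {1..m-2}" for e t b
  proof -
    have "wdeg K (Inr (e, t)) = emult K e"
      using new[OF e t] inc_Inr[OF X[OF e] t] by (simp add: wdeg_def)
    moreover have "Poly_Mapping.lookup (arcs K) (Inr (e, t), b) =
        (if b \<in> hyp e - {Inr (e, t)} then emult K e else 0)"
      using NV[OF e t] new[OF e t] inc_Inr[OF X[OF e] t] by (auto simp: lookup_arcs)
    ultimately show ?thesis using outdeg_arcs[OF NV[OF e t], of K] by (auto simp: laplacian_def)
  qed
  have Lold: "?L (Inl u) b = (if Inl u = b then real (m - 1) * (\<Sum>e\<in>{e \<in> ?X. u \<in> e}. real (K (Inl u) e)) else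
      - (\<Sum>e\<in>?X. if u \<in> e \<and> b \<in> hyp e then real (K (Inl u) e) else 0))" if u: "u \<in> \<Union>?X" for u b
  proof -
    have zero: "K (Inl u) e = 0" if "e \<in> edges U" "u \<in> e" "e \<notin> ?X" for e
      using balanced_K_zero[OF bal that(1) _ that(3)] that(2) by (simp add: Inl_in_hyp)
    have "wdeg K (Inl u) = (\<Sum>e\<in>{e \<in> ?X. u \<in> e}. K (Inl u) e)"
      unfolding wdeg_def inc_Inl
    proof (rule sum.mono_neutral_right)
      show "\<forall>e\<in>{e \<in> edges U. u \<in> e} - {e \<in> ?X. u \<in> e}. K (Inl u) e = 0" using zero by blast
    qed (use finite_edges X in auto)
    moreover have "Poly_Mapping.lookup (arcs K) (Inl u, b) =
        (\<Sum>e\<in>?X. if u \<in> e \<and> b \<in> hyp e - {Inl u} then K (Inl u) e else 0)"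
    proof -
      have "Poly_Mapping.lookup (arcs K) (Inl u, b) =
         (\<Sum>e\<in>{e \<in> edges U. u \<in> e}. if b \<in> hyp e - {Inl u} then K (Inl u) e else 0)"
        using QV[OF u] by (simp add: lookup_arcs inc_Inl)
      also have "\<dots> = (\<Sum>e\<in>edges U. if u \<in> e \<and> b \<in> hyp e - {Inl u} then K (Inl u) e else 0)"
        using finite_edges by (intro sum.mono_neutral_cong_left) auto
      also have "\<dots> = (\<Sum>e\<in>?X. if u \<in> e \<and> b \<in> hyp e - {Inl u} then K (Inl u) e else 0)"
        using finite_edges X zero by (intro sum.mono_neutral_right) auto
      finally show ?thesis .
    qed
    ultimately show ?thesis
      using outdeg_arcs[OF QV[OF u], of K]
      by (auto simp: laplacian_def sum_negf[symmetric] of_nat_sum intro!: sum.cong)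
  qed
  have set_eq: "active V (arcs K) - {Inl r} = \<Union>(?N ` ?X) \<union> ?Q"
    unfolding active_arcs[OF bal] by auto
  have s: "real (m - 2) < real m" using m by simp
  have sub1: "real (m - Suc 0) = real m - 1" using m by (simp add: of_nat_diff)
  have "det_on (\<Union>(?N ` ?X) \<union> ?Q) ?L =
    (\<Prod>e\<in>?X. real (emult K e) ^ (m - 2) * real m ^ (m - 2) * (real m - real (m - 2)) / real m) *
    det_on ?Q (\<lambda>b b'. ?L b b' - (\<Sum>e\<in>?X. x e b * \<chi> e b') * real (m - 2) / (real m - real (m - 2)))"
  proof (rule det_on_eliminate_cliques[OF finX])
    show "finite ?Q" using finUX by simp
    show "finite (?N e) \<and> card (?N e) = m - 2" for e
      by (simp add: card_image card_cartesian_product)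
    show "real (m - 2) < real m" by (rule s)
    show "real (emult K e) \<noteq> 0" if "e \<in> ?X" for e using that by (simp add: support_def)
    show "?N e \<inter> ?Q = {}" for e by auto
    show "?N e \<inter> ?N e' = {}" if "e \<noteq> e'" for e e' using that by auto
    show "?L v a = (if v = a then real (emult K e) * (real m - 1) else - real (emult K e))"
      if e: "e \<in> ?X" and v: "v \<in> ?N e" and a: "a \<in> ?N e" for e v a
    proof -
      obtain t t' where t: "v = Inr (e, t)" "t \<in> {1..m-2}" "a = Inr (e, t')" "t' \<in> {1..m-2}" using v a by auto
      then show ?thesis using Lnew[OF e t(2)] by (simp add: sub1 Inr_in_hyp mult.commute del: atLeastAtMost_iff)
    qed
    show "?L v a = 0" if e: "e \<in> ?X" and "e' \<in> ?X" and ne: "e \<noteq> e'" and v: "v \<in> ?N e" and a: "a \<in> ?N e'" for e e' v a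
    proof -
      obtain t t' where t: "v = Inr (e, t)" "t \<in> {1..m-2}" "a = Inr (e', t')" using v a by auto
      then show ?thesis using Lnew[OF e t(2)] ne by (simp add: Inr_in_hyp)
    qed
    show "?L v b = - real (emult K e) * \<chi> e b" if e: "e \<in> ?X" and v: "v \<in> ?N e" and b: "b \<in> ?Q" for e v b
    proof -
      obtain t u where t: "v = Inr (e, t)" "t \<in> {1..m-2}" "b = Inl u" using v b by blast
      then show ?thesis using Lnew[OF e t(2)] by (simp add: \<chi>_def)
    qed
    show "?L b v = - x e b" if e: "e \<in> ?X" and b: "b \<in> ?Q" and v: "v \<in> ?N e" for e b v
    proof -
      obtain t u where t: "v = Inr (e, t)" "t \<in> {1..m-2}" "b = Inl u" "u \<in> \<Union>?X" using v b by blast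
      have "(\<Sum>f\<in>?X. if u \<in> f \<and> Inr (e, t) \<in> hyp f then real (K (Inl u) f) else 0) =
        (\<Sum>f\<in>?X. if f = e then if u \<in> e then real (K (Inl u) e) else 0 else 0)"
        using t(2) by (intro sum.cong) (auto simp: Inr_in_hyp)
      then show ?thesis using Lold[OF t(4)] t(1,3) e finX by (simp add: x_def Inl_in_hyp)
    qed
  qed
  also have "real m - real (m - 2) = 2" using m by (simp add: of_nat_diff)
  also have "det_on ?Q (\<lambda>b b'. ?L b b' - (\<Sum>e\<in>?X. x e b * \<chi> e b') * real (m - 2) / 2) =
    det_on (\<Union>?X - {r}) (\<lambda>u v. ?L (Inl u) (Inl v) - (\<Sum>e\<in>?X. x e (Inl u) * \<chi> e (Inl v)) * real (m - 2) / 2)"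
    using finUX by (intro det_on_reindex) auto
  \<comment> \<open>The factor is the same everywhere: \<open>(m - 1) - (m - 2) / 2 = m / 2\<close>
    on the diagonal and \<open>1 + (m - 2) / 2 = m / 2\<close> off it.\<close>
  also have "\<dots> = det_on (\<Union>?X - {r}) (\<lambda>u v. real m / 2 * edge_laplacian ?X (\<lambda>u e. real (K (Inl u) e)) u v)"
  proof (rule det_on_cong[OF refl])
    fix u v assume "u \<in> \<Union>?X - {r}"
    then have u: "u \<in> \<Union>?X" by simp
    have sub2: "real (m - 2) = real m - 2" using m by (simp add: of_nat_diff)
    have S: "(\<Sum>e\<in>?X. x e (Inl u) * \<chi> e (Inl v)) = (\<Sum>e\<in>{e \<in> ?X. u \<in> e \<and> v \<in> e}. real (K (Inl u) e))" for v
      using finX by (intro sum.mono_neutral_cong_right) (auto simp: x_def \<chi>_def Inl_in_hyp)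
    show "?L (Inl u) (Inl v) - (\<Sum>e\<in>?X. x e (Inl u) * \<chi> e (Inl v)) * real (m - 2) / 2 =
      real m / 2 * edge_laplacian ?X (\<lambda>u e. real (K (Inl u) e)) u v"
    proof (cases "u = v")
      case True
      then show ?thesis unfolding S sub2
        using Lold[OF u, of "Inl v"] by (simp add: edge_laplacian_def sub1 field_simps)
    next
      case False
      have "(\<Sum>e\<in>?X. if u \<in> e \<and> Inl v \<in> hyp e then real (K (Inl u) e) else 0) =
        (\<Sum>e\<in>{e \<in> ?X. u \<in> e \<and> v \<in> e}. real (K (Inl u) e))"
        using finX by (intro sum.mono_neutral_cong_right) (auto simp: Inl_in_hyp)
      then show ?thesis unfolding S sub2
        using False Lold[OF u, of "Inl v"] by (simp add: edge_laplacian_def field_simps)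
    qed
  qed
  also have "\<dots> = (real m / 2) ^ card (\<Union>?X - {r}) * det_on (\<Union>?X - {r}) (edge_laplacian ?X (\<lambda>u e. real (K (Inl u) e)))"
    by (rule det_on_scale) (use finUX in simp)
  also have "card (\<Union>?X - {r}) = card (\<Union>?X) - 1" using r finUX by (simp add: card_Diff_singleton)
  finally show ?thesis unfolding set_eq .
qed

text \<open>At every active vertex the factorials leave \<open>1 / ((m - 1) * wdeg)\<close>. For the
  new vertices of \<open>e\<close> this is \<open>1 / ((m - 1) * emult K e)\<close>, and the powers
  of \<open>emult K e\<close> cancel those of \<open>det_arcs\<close>, so each edge contributes a
  constant.\<close>

lemma weight_balanced:
  assumes K: "K \<in> assignments d" and bal: "balanced K" and r: "r \<in> \<Union>(support K)"
  shows "weight d K = real d * real (m - 1) * ((real m / real (m - 1)) ^ (m - 2) * 2 / real m) ^ card (support K) *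
    (real m / 2) ^ (card (\<Union>(support K)) - 1) / real (m - 1) ^ card (\<Union>(support K)) *
    (\<Prod>u\<in>\<Union>(support K). multinom (inc (Inl u)) (K (Inl u)) / real (wdeg K (Inl u))) *
    det_on (\<Union>(support K) - {r}) (edge_laplacian (support K) (\<lambda>u e. real (K (Inl u) e)))"
proof -
  let ?X = "support K"
  let ?S = "active V (arcs K)"
  let ?D = "det_on (\<Union>?X - {r}) (edge_laplacian ?X (\<lambda>u e. real (K (Inl u) e)))"
  have X: "e \<in> edges U" if "e \<in> ?X" for e using that by (simp add: support_def)
  have finX: "finite ?X" using finite_edges by (simp add: support_def)
  have finUX: "finite (\<Union>?X)" using finX finite_edge X by auto
  have SV: "?S \<subseteq> V" by (auto simp: active_def)
  have L: "sum (outdeg V (arcs K)) V = d * (m - 1)"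
  proof -
    have "sum (outdeg V (arcs K)) V = (\<Sum>i\<in>V. (m - 1) * wdeg K i)"
      using outdeg_arcs by (intro sum.cong) auto
    then show ?thesis using K by (simp add: sum_distrib_left[symmetric] assignments_def wdeg_def mult.commute)
  qed
  have "(\<Sum>s\<in>V. trails V (d * (m - 1)) s s (arcs K)) = real (d * (m - 1)) *
     det_on (?S - {Inl r}) (laplacian V (arcs K)) * (\<Prod>v\<in>?S. fact (outdeg V (arcs K) v - 1))"
  proof (rule closed_trails[OF finite_V keys_arcs _ L])
    show "outdeg V (arcs K) v = indeg V (arcs K) v" if "v \<in> V" for v
      using bal balanced_iff[OF that, of K] that by (simp add: balanced_def)
    show "Inl r \<in> ?S" unfolding active_arcs[OF bal] using r by blast
  qed
  moreover have "(\<Prod>i\<in>V. multinom (inc i) (K i) / fact (wdeg K i * (m - 1))) =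
    (\<Prod>i\<in>?S. multinom (inc i) (K i) / fact (wdeg K i * (m - 1)))"
  proof (rule prod.mono_neutral_right[OF finite_V SV], rule ballI)
    fix i assume i: "i \<in> V - ?S"
    then have "wdeg K i = 0" using outdeg_arcs[of i K] m by (auto simp: active_def)
    moreover from this have "\<And>e. e \<in> inc i \<Longrightarrow> K i e = 0" using finite_inc by (simp add: wdeg_def)
    ultimately show "multinom (inc i) (K i) / fact (wdeg K i * (m - 1)) = 1"
      by (simp add: multinom_def)
  qed
  ultimately have "weight d K = real d * real (m - 1) * det_on (?S - {Inl r}) (laplacian V (arcs K)) *
    ((\<Prod>i\<in>?S. multinom (inc i) (K i) / fact (wdeg K i * (m - 1))) * (\<Prod>v\<in>?S. fact (outdeg V (arcs K) v - 1)))"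
    by (simp add: weight_def mult_ac)
  also have "(\<Prod>i\<in>?S. multinom (inc i) (K i) / fact (wdeg K i * (m - 1))) * (\<Prod>v\<in>?S. fact (outdeg V (arcs K) v - 1)) =
    (\<Prod>i\<in>?S. multinom (inc i) (K i) / (real (m - 1) * real (wdeg K i)))"
    unfolding prod.distrib[symmetric]
  proof (rule prod.cong[OF refl])
    fix i assume i: "i \<in> ?S"
    then have o: "outdeg V (arcs K) i = wdeg K i * (m - 1)" "0 < outdeg V (arcs K) i"
      using outdeg_arcs[of i K] by (auto simp: active_def mult.commute)
    then have "fact (wdeg K i * (m - 1)) = real (wdeg K i * (m - 1)) * fact (wdeg K i * (m - 1) - 1)"
      by (intro fact_reduce) simp
    then show "multinom (inc i) (K i) / fact (wdeg K i * (m - 1)) * fact (outdeg V (arcs K) i - 1) =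
      multinom (inc i) (K i) / (real (m - 1) * real (wdeg K i))"
      unfolding o(1) by simp
  qed
  also have "\<dots> = (\<Prod>u\<in>\<Union>?X. multinom (inc (Inl u)) (K (Inl u)) / (real (m - 1) * real (wdeg K (Inl u)))) *
    (\<Prod>e\<in>?X. (1 / (real (m - 1) * real (emult K e))) ^ (m - 2))"
  proof -
    have "(\<Prod>i\<in>?S. multinom (inc i) (K i) / (real (m - 1) * real (wdeg K i))) =
      (\<Prod>i\<in>Inl ` \<Union>?X. multinom (inc i) (K i) / (real (m - 1) * real (wdeg K i))) *
      (\<Prod>i\<in>Inr ` (?X \<times> {1..m-2}). multinom (inc i) (K i) / (real (m - 1) * real (wdeg K i)))"
      unfolding active_arcs[OF bal] using finX finUX by (intro prod.union_disjoint) auto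
    also have "(\<Prod>i\<in>Inr ` (?X \<times> {1..m-2}). multinom (inc i) (K i) / (real (m - 1) * real (wdeg K i))) =
      (\<Prod>i\<in>?X \<times> {1..m-2}. 1 / (real (m - 1) * real (emult K (fst i))))"
    proof (subst prod.reindex, simp, unfold o_def, rule prod.cong[OF refl])
      fix i assume "i \<in> ?X \<times> {1..m-2}"
      then obtain e t where i: "i = (e, t)" "e \<in> ?X" "t \<in> {1..m-2}" by (cases i) auto
      show "multinom (inc (Inr i)) (K (Inr i)) / (real (m - 1) * real (wdeg K (Inr i))) =
        1 / (real (m - 1) * real (emult K (fst i)))"
        unfolding i(1) multinom_def wdeg_def inc_Inr[OF X[OF i(2)] i(3)]
        using balanced_new_eq[OF bal X[OF i(2)] i(3)] by simp
    qed
    also have "\<dots> = (\<Prod>e\<in>?X. \<Prod>t\<in>{1..m-2}. 1 / (real (m - 1) * real (emult K e)))"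
      by (subst prod.cartesian_product) (simp add: case_prod_unfold)
    also have "\<dots> = (\<Prod>e\<in>?X. (1 / (real (m - 1) * real (emult K e))) ^ (m - 2))" by simp
    finally show ?thesis by (simp add: prod.reindex)
  qed
  also have "(\<Prod>u\<in>\<Union>?X. multinom (inc (Inl u)) (K (Inl u)) / (real (m - 1) * real (wdeg K (Inl u)))) =
    (\<Prod>u\<in>\<Union>?X. multinom (inc (Inl u)) (K (Inl u)) / real (wdeg K (Inl u))) / real (m - 1) ^ card (\<Union>?X)"
  proof -
    have "(\<Prod>u\<in>\<Union>?X. multinom (inc (Inl u)) (K (Inl u)) / (real (m - 1) * real (wdeg K (Inl u)))) =
      (\<Prod>u\<in>\<Union>?X. multinom (inc (Inl u)) (K (Inl u)) / real (wdeg K (Inl u)) / real (m - 1))"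
      by (intro prod.cong) (auto simp: field_simps)
    then show ?thesis by (simp only: prod_dividef prod_constant)
  qed
  finally have "weight d K = real d * real (m - 1) *
    ((\<Prod>e\<in>?X. real (emult K e) ^ (m - 2) * real m ^ (m - 2) * 2 / real m) *
     (\<Prod>e\<in>?X. (1 / (real (m - 1) * real (emult K e))) ^ (m - 2))) *
    ((real m / 2) ^ (card (\<Union>?X) - 1) * ?D) *
    ((\<Prod>u\<in>\<Union>?X. multinom (inc (Inl u)) (K (Inl u)) / real (wdeg K (Inl u))) / real (m - 1) ^ card (\<Union>?X))"
    unfolding det_arcs[OF bal r] by (simp only: mult_ac)
  also have "(\<Prod>e\<in>?X. real (emult K e) ^ (m - 2) * real m ^ (m - 2) * 2 / real m) *
     (\<Prod>e\<in>?X. (1 / (real (m - 1) * real (emult K e))) ^ (m - 2)) =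
     ((real m / real (m - 1)) ^ (m - 2) * 2 / real m) ^ card ?X"
  proof -
    have "real (emult K e) ^ (m - 2) * real m ^ (m - 2) * 2 / real m * (1 / (real (m - 1) * real (emult K e))) ^ (m - 2) =
      (real m / real (m - 1)) ^ (m - 2) * 2 / real m" if "e \<in> ?X" for e
    proof -
      have "real (emult K e) \<noteq> 0" using that by (simp add: support_def)
      then show ?thesis by (simp add: power_divide power_mult_distrib)
    qed
    then have "(\<Prod>e\<in>?X. real (emult K e) ^ (m - 2) * real m ^ (m - 2) * 2 / real m *
        (1 / (real (m - 1) * real (emult K e))) ^ (m - 2)) =
        (\<Prod>e\<in>?X. (real m / real (m - 1)) ^ (m - 2) * 2 / real m)" by (rule prod.cong[OF refl])
    then show ?thesis by (simp only: prod.distrib prod_constant)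
  qed
  finally show ?thesis by (simp add: mult_ac)
qed

end

lemma edge_laplacian_cong:
  assumes "\<And>e. e \<in> X \<Longrightarrow> u \<in> e \<Longrightarrow> k u e = k' u e"
  shows "edge_laplacian X k u v = edge_laplacian X k' u v"
  unfolding edge_laplacian_def using assms
  by (auto intro!: sum.cong arg_cong[where f = uminus])

context power_graph
begin

section \<open>Assignments without circulation and their contribution\<close>

definition flat :: "('a set \<Rightarrow> nat) \<Rightarrow> 'a + 'a set \<times> nat \<Rightarrow> 'a set \<Rightarrow> nat" where
  "flat \<omega> = (\<lambda>i\<in>V. \<lambda>e\<in>inc i. \<omega> e)"

definition spread :: "'a set set \<Rightarrow> ('a set \<Rightarrow> nat) \<Rightarrow> 'a + 'a set \<times> nat \<Rightarrow> 'a set \<Rightarrow> nat" where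
  "spread X \<omega> = flat (\<lambda>e. if e \<in> X then \<omega> e else 0)"

text \<open>For the edge set of a tree this is the index set of the sum in
  \<open>tree_coeff\<close>. Weights are positive, so that \<open>X\<close> can be recovered from
  \<open>spread X \<omega>\<close> as its support.\<close>

definition weights :: "nat \<Rightarrow> 'a set set \<Rightarrow> ('a set \<Rightarrow> nat) set" where
  "weights l X = {\<omega> \<in> X \<rightarrow>\<^sub>E {1..}. sum \<omega> X = l}"

lemma flat_apply: "i \<in> V \<Longrightarrow> e \<in> inc i \<Longrightarrow> flat \<omega> i e = \<omega> e"
  by (simp add: flat_def)

lemma flat_hyp: "e \<in> edges U \<Longrightarrow> i \<in> hyp e \<Longrightarrow> flat \<omega> i e = \<omega> e"
  using hyp_subset by (intro flat_apply) (auto simp: inc_def)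

lemma wdeg_flat: "j \<in> V \<Longrightarrow> wdeg (flat \<omega>) j = (\<Sum>e\<in>inc j. \<omega> e)"
  unfolding wdeg_def by (intro sum.cong) (auto simp: flat_apply)

lemma balanced_flat: "balanced (flat \<omega>)"
  unfolding balanced_def
proof
  fix j assume j: "j \<in> V"
  have "total (flat \<omega>) e = m * \<omega> e" if "e \<in> edges U" for e
    unfolding total_def using flat_hyp[OF that] card_hyp[OF that] by simp
  then have "(\<Sum>e\<in>inc j. total (flat \<omega>) e) = (\<Sum>e\<in>inc j. m * \<omega> e)"
    by (intro sum.cong) (auto simp: inc_def)
  then show "m * wdeg (flat \<omega>) j = (\<Sum>e\<in>inc j. total (flat \<omega>) e)"
    using wdeg_flat[OF j] by (simp add: sum_distrib_left)
qed

lemma emult_flat: "e \<in> edges U \<Longrightarrow> emult (flat \<omega>) e = \<omega> e"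
  unfolding emult_def using m by (intro flat_hyp) (auto simp: hyp_def)

lemma flat_extensional: "flat \<omega> \<in> (\<Pi>\<^sub>E i\<in>V. inc i \<rightarrow>\<^sub>E UNIV)"
  by (auto simp: flat_def)

lemma balanced_assignments:
  assumes "balanced K" "K \<in> (\<Pi>\<^sub>E i\<in>V. inc i \<rightarrow>\<^sub>E UNIV)"
  shows "K \<in> assignments (m * l) \<longleftrightarrow> (\<Sum>e\<in>edges U. emult K e) = l"
  using assms(2) balanced_total[OF assms(1)] m by (auto simp: assignments_def wdeg_def)

text \<open>Balance already forces the new vertices to agree with \<open>emult K\<close>, so only
  the old vertices have to be checked.\<close>

lemma flat_emult:
  assumes "balanced K" "K \<in> (\<Pi>\<^sub>E i\<in>V. inc i \<rightarrow>\<^sub>E UNIV)"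
    and "\<And>u e. e \<in> edges U \<Longrightarrow> u \<in> e \<Longrightarrow> K (Inl u) e = emult K e"
  shows "K = flat (emult K)"
proof (rule PiE_ext[OF assms(2) flat_extensional])
  fix i assume i: "i \<in> V"
  show "K i = flat (emult K) i"
  proof (rule PiE_ext[of _ "inc i" "\<lambda>_. UNIV"])
    show "K i \<in> inc i \<rightarrow>\<^sub>E UNIV" "flat (emult K) i \<in> inc i \<rightarrow>\<^sub>E UNIV"
      by (rule PiE_mem[OF assms(2) i], rule PiE_mem[OF flat_extensional i])
    fix e assume e: "e \<in> inc i"
    then have eU: "e \<in> edges U" "i \<in> hyp e" by (auto simp: inc_def)
    have "K i e = emult K e"
    proof (cases i)
      case (Inl u)
      then show ?thesis using assms(3)[OF eU(1), of u] eU(2) by (simp add: Inl_in_hyp)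
    next
      case (Inr b)
      then obtain t where "i = Inr (e, t)" "t \<in> {1..m-2}" using eU(2) by (cases b) (auto simp: Inr_in_hyp)
      then show ?thesis using balanced_new_eq[OF assms(1) eU(1)] by simp
    qed
    then show "K i e = flat (emult K) i e" using flat_apply[OF i e] by simp
  qed
qed

lemma emult_spread: "e \<in> edges U \<Longrightarrow> emult (spread X \<omega>) e = (if e \<in> X then \<omega> e else 0)"
  unfolding spread_def by (rule emult_flat)

lemma support_spread:
  assumes "X \<subseteq> edges U" "\<omega> \<in> weights l X"
  shows "support (spread X \<omega>) = X"
proof -
  have "e \<in> support (spread X \<omega>) \<longleftrightarrow> e \<in> X" for e
    using assms emult_spread[of e X \<omega>] by (auto simp: support_def weights_def PiE_iff Suc_le_eq split: if_splits)
  then show ?thesis by blast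
qed

lemma spread_assignments:
  assumes "X \<subseteq> edges U" "\<omega> \<in> weights l X"
  shows "spread X \<omega> \<in> assignments (m * l)"
proof -
  have "(\<Sum>e\<in>edges U. emult (spread X \<omega>) e) = (\<Sum>e\<in>X. \<omega> e)"
    using finite_edges assms(1) emult_spread by (intro sum.mono_neutral_cong_right) auto
  then show ?thesis
    using assms(2) balanced_assignments[OF balanced_flat flat_extensional]
    by (simp add: spread_def weights_def)
qed

lemma finite_weights:
  assumes "finite X"
  shows "finite (weights l X)"
  by (rule finite_subset[OF _ finite_compositions[OF assms, of l]])
    (auto simp: weights_def compositions_def PiE_iff)

text \<open>An assignment without circulation is the same as its support together with a positive
  weighting of it.\<close>

lemma sum_flat:
  "(\<Sum>K\<in>assignments (m * l) \<inter> range flat. f K) =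
     (\<Sum>X\<in>Pow (edges U). \<Sum>\<omega>\<in>weights l X. f (spread X \<omega>))"
proof -
  have "(\<Sum>X\<in>Pow (edges U). \<Sum>\<omega>\<in>weights l X. f (spread X \<omega>)) =
     (\<Sum>(X, \<omega>)\<in>Sigma (Pow (edges U)) (weights l). f (spread X \<omega>))"
    using finite_edges by (intro sum.Sigma) (auto intro: finite_weights finite_subset)
  also have "\<dots> = (\<Sum>K\<in>assignments (m * l) \<inter> range flat. f K)"
  proof (rule sum.reindex_bij_witness[of _ "\<lambda>K. (support K, restrict (emult K) (support K))" "\<lambda>(X, \<omega>). spread X \<omega>"])
    fix p assume "p \<in> Sigma (Pow (edges U)) (weights l)"
    then obtain X \<omega> where p: "p = (X, \<omega>)" and X: "X \<subseteq> edges U" and \<omega>: "\<omega> \<in> weights l X" by auto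
    have "restrict (emult (spread X \<omega>)) X = \<omega>"
      using \<omega> X emult_spread by (intro PiE_ext[of _ X "\<lambda>_. UNIV"]) (auto simp: weights_def PiE_iff)
    then show "(case case p of (X, \<omega>) \<Rightarrow> spread X \<omega> of K \<Rightarrow> (support K, restrict (emult K) (support K))) = p"
      using support_spread[OF X \<omega>] by (simp add: p)
    show "(case p of (X, \<omega>) \<Rightarrow> spread X \<omega>) \<in> assignments (m * l) \<inter> range flat"
      using spread_assignments[OF X \<omega>] by (simp add: p spread_def)
    show "f (case p of (X, \<omega>) \<Rightarrow> spread X \<omega>) = (case p of (X, \<omega>) \<Rightarrow> f (spread X \<omega>))" by (simp add: p)
  next
    fix K assume "K \<in> assignments (m * l) \<inter> range flat"
    then obtain \<omega> where K: "K = flat \<omega>" and l: "K \<in> assignments (m * l)" by auto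
    let ?X = "support K" and ?\<omega> = "restrict (emult K) (support K)"
    have sub: "?X \<subseteq> edges U" by (auto simp: support_def)
    have "(\<Sum>e\<in>edges U. emult K e) = l"
      using l balanced_assignments[OF balanced_flat flat_extensional] by (simp add: K)
    moreover have "(\<Sum>e\<in>edges U. emult K e) = (\<Sum>e\<in>?X. emult K e)"
      using finite_edges by (intro sum.mono_neutral_right) (auto simp: support_def)
    ultimately have "?\<omega> \<in> weights l ?X" by (auto simp: weights_def support_def)
    then show "(support K, ?\<omega>) \<in> Sigma (Pow (edges U)) (weights l)" using sub by auto
    have "spread ?X ?\<omega> = flat \<omega>"
      unfolding spread_def flat_def
    proof (intro restrict_ext)
      fix i e assume "i \<in> V" "e \<in> inc i"
      then have "emult K e = \<omega> e" "e \<in> edges U" unfolding K by (auto simp: inc_def emult_flat)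
      then show "(if e \<in> ?X then ?\<omega> e else 0) = \<omega> e" by (auto simp: support_def)
    qed
    then show "(case (support K, ?\<omega>) of (X, \<omega>) \<Rightarrow> spread X \<omega>) = K" by (simp add: K)
  qed
  finally show ?thesis by simp
qed

lemma inc_Inl_sum:
  assumes "X \<subseteq> edges U" "\<And>e. e \<in> edges U \<Longrightarrow> u \<in> e \<Longrightarrow> e \<notin> X \<Longrightarrow> h e = 0"
  shows "(\<Sum>e\<in>inc (Inl u). h e) = (\<Sum>e\<in>{e \<in> X. u \<in> e}. h e :: nat)"
  unfolding inc_Inl
proof (rule sum.mono_neutral_right)
  show "\<forall>e\<in>{e \<in> edges U. u \<in> e} - {e \<in> X. u \<in> e}. h e = 0" using assms(2) by blast
qed (use assms(1) finite_edges in auto)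

lemma inc_Inl_fact:
  assumes "X \<subseteq> edges U" "\<And>e. e \<in> edges U \<Longrightarrow> u \<in> e \<Longrightarrow> e \<notin> X \<Longrightarrow> h e = 0"
  shows "(\<Prod>e\<in>inc (Inl u). fact (h e)) = (\<Prod>e\<in>{e \<in> X. u \<in> e}. fact (h e) :: real)"
  unfolding inc_Inl
proof (rule prod.mono_neutral_right)
  show "\<forall>e\<in>{e \<in> edges U. u \<in> e} - {e \<in> X. u \<in> e}. fact (h e) = (1 :: real)"
  proof
    fix e assume "e \<in> {e \<in> edges U. u \<in> e} - {e \<in> X. u \<in> e}"
    then have "h e = 0" using assms(2) by blast
    then show "fact (h e) = (1 :: real)" by simp
  qed
qed (use assms(1) finite_edges in auto)

lemma spread_old:
  assumes "u \<in> e" "e \<in> edges U"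
  shows "spread X \<omega> (Inl u) e = (if e \<in> X then \<omega> e else 0)"
  unfolding spread_def using assms by (intro flat_hyp) (simp_all add: Inl_in_hyp)

lemma union_subset: "X \<subseteq> edges U \<Longrightarrow> u \<in> \<Union>X \<Longrightarrow> Inl u \<in> V"
  using edge_subset by (auto simp: V_eq)

text \<open>With \<open>k\<close> edges and \<open>k + 1\<close> vertices the factors
  \<open>2 / m\<close> and \<open>m / 2\<close> of \<open>weight_balanced\<close> cancel, and the
  exponent of \<open>m - 1\<close> in the denominator is \<open>k * (m - 2) + (k + 1) - 1\<close>.
  At a vertex, dividing the multinomial coefficient by the degree lowers the factorial in its
  numerator.\<close>

lemma weight_tree:
  assumes X: "X \<subseteq> edges U" and tree: "tree (edge_graph X)" and \<omega>: "\<omega> \<in> weights l X"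
  shows "weight (m * l) (spread X \<omega>) = real (m * l) * real m ^ (card X * (m - 2)) / real (m - 1) ^ (card X * (m - 1)) *
    ((\<Prod>e\<in>X. real (\<omega> e)) * (\<Prod>v\<in>\<Union>X. fact (wdegree (edge_graph X) \<omega> v - 1) / real (wfact (edge_graph X) \<omega> v)))"
proof -
  let ?K = "spread X \<omega>" and ?T = "edge_graph X"
  define k where "k = card X"
  have supp: "support ?K = X" by (rule support_spread[OF X \<omega>])
  have finX: "finite X" by (rule finite_subset[OF X finite_edges])
  have finUX: "finite (\<Union>X)" using finX finite_edge X by auto
  have card: "card (\<Union>X) = k + 1" using tree_card[OF tree] by (simp add: edge_graph_def k_def)
  have acyc: "\<not> has_cycle X" and "\<Union>X \<noteq> {}"
    using tree by (auto simp: tree_iff edge_graph_def connected_graph_def)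
  then obtain r where r: "r \<in> \<Union>X" by auto
  have pos: "0 < \<omega> e" if "e \<in> X" for e using \<omega> that by (auto simp: weights_def PiE_iff Suc_le_eq)
  have bal: "balanced ?K" unfolding spread_def by (rule balanced_flat)
  have "det_on (\<Union>X - {r}) (edge_laplacian X (\<lambda>u e. real (?K (Inl u) e))) =
    det_on (\<Union>X - {r}) (edge_laplacian X (\<lambda>_ e. real (\<omega> e)))"
    using X spread_old by (intro det_on_cong refl edge_laplacian_cong) auto
  also have "\<dots> = (\<Prod>e\<in>X. real (\<omega> e))"
  proof (rule edge_laplacian_tree)
    show "e \<subseteq> \<Union>X \<and> card e = 2" if "e \<in> X" for e using that X edge_card by auto
    show "card (\<Union>X) = card X + 1" using card by (simp add: k_def)
    show "real (\<omega> e) \<noteq> 0" if "e \<in> X" for e using pos[OF that] by simp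
  qed (use finUX r finX acyc in auto)
  finally have det: "det_on (\<Union>X - {r}) (edge_laplacian X (\<lambda>u e. real (?K (Inl u) e))) = (\<Prod>e\<in>X. real (\<omega> e))" .
  have vertex: "multinom (inc (Inl u)) (?K (Inl u)) / real (wdeg ?K (Inl u)) =
    fact (wdegree ?T \<omega> u - 1) / real (wfact ?T \<omega> u)" if u: "u \<in> \<Union>X" for u
  proof -
    have zero: "?K (Inl u) e = 0" if "e \<in> edges U" "u \<in> e" "e \<notin> X" for e
      using spread_old[OF that(2,1)] that(3) by simp
    have same: "?K (Inl u) e = \<omega> e" if "e \<in> X" "u \<in> e" for e
      using spread_old[OF that(2)] that(1) X by auto
    have wd: "wdeg ?K (Inl u) = wdegree ?T \<omega> u"
    proof -
      have "wdeg ?K (Inl u) = (\<Sum>e\<in>{e \<in> X. u \<in> e}. ?K (Inl u) e)"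
        unfolding wdeg_def by (rule inc_Inl_sum[OF X zero])
      also have "\<dots> = (\<Sum>e\<in>{e \<in> X. u \<in> e}. \<omega> e)"
        using same by (intro sum.cong) auto
      finally show ?thesis by (simp add: wdegree_def edge_graph_def)
    qed
    have wf: "(\<Prod>e\<in>inc (Inl u). fact (?K (Inl u) e)) = real (wfact ?T \<omega> u)"
    proof -
      have "(\<Prod>e\<in>inc (Inl u). fact (?K (Inl u) e)) = (\<Prod>e\<in>{e \<in> X. u \<in> e}. fact (?K (Inl u) e) :: real)"
        by (rule inc_Inl_fact[OF X zero])
      also have "\<dots> = (\<Prod>e\<in>{e \<in> X. u \<in> e}. real (fact (\<omega> e)))"
        using same by (intro prod.cong) auto
      finally show ?thesis by (simp add: wfact_def edge_graph_def)
    qed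
    obtain e where e: "e \<in> X" "u \<in> e" using u by auto
    have "\<omega> e \<le> wdegree ?T \<omega> u"
      unfolding wdegree_def edge_graph_def hypergraph.sel using e finX by (intro member_le_sum) auto
    then have "0 < wdegree ?T \<omega> u" using pos[OF e(1)] by simp
    then have "fact (wdegree ?T \<omega> u) = real (wdegree ?T \<omega> u) * fact (wdegree ?T \<omega> u - 1)"
      by (rule fact_reduce)
    then show ?thesis
      using \<open>0 < wdegree ?T \<omega> u\<close> wd unfolding multinom_def wf wdeg_def by simp
  qed
  have "weight (m * l) ?K = real (m * l) * real (m - 1) * ((real m / real (m - 1)) ^ (m - 2) * 2 / real m) ^ k *
    (real m / 2) ^ k / real (m - 1) ^ (k + 1) *
    (\<Prod>u\<in>\<Union>X. multinom (inc (Inl u)) (?K (Inl u)) / real (wdeg ?K (Inl u))) * (\<Prod>e\<in>X. real (\<omega> e))"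
    using weight_balanced[OF spread_assignments[OF X \<omega>] bal, of r] r
    unfolding supp det card k_def[symmetric] by simp
  also have "(\<Prod>u\<in>\<Union>X. multinom (inc (Inl u)) (?K (Inl u)) / real (wdeg ?K (Inl u))) =
    (\<Prod>v\<in>\<Union>X. fact (wdegree ?T \<omega> v - 1) / real (wfact ?T \<omega> v))"
    using vertex by (rule prod.cong[OF refl])
  also have "real (m * l) * real (m - 1) * ((real m / real (m - 1)) ^ (m - 2) * 2 / real m) ^ k *
    (real m / 2) ^ k / real (m - 1) ^ (k + 1) = real (m * l) * real m ^ (k * (m - 2)) / real (m - 1) ^ (k * (m - 1))"
  proof -
    have nz: "real m \<noteq> 0" "real (m - 1) \<noteq> 0" using m by auto
    have m1: "m - 1 = Suc (m - 2)" using m by simp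
    have AB: "((real m / real (m - 1)) ^ (m - 2) * 2 / real m) ^ k * (real m / 2) ^ k = (real m / real (m - 1)) ^ ((m - 2) * k)"
      using nz by (simp add: power_mult_distrib[symmetric] power_mult)
    have P: "real (m - 1) ^ (k * (m - 1)) = real (m - 1) ^ ((m - 2) * k) * real (m - 1) ^ k"
      unfolding power_add[symmetric] by (rule arg_cong[of _ _ "\<lambda>x. real (m - 1) ^ x"]) (unfold m1, simp add: mult.commute)
    have cancel: "d * p * A * B / p ^ (k + 1) = d * (A * B) / p ^ k" if "p \<noteq> 0" for d p A B :: real
      using that by simp
    note cancel[OF nz(2)]
    also have "real (m * l) * (((real m / real (m - 1)) ^ (m - 2) * 2 / real m) ^ k * (real m / 2) ^ k) / real (m - 1) ^ k =
      real (m * l) * (real m ^ ((m - 2) * k) / real (m - 1) ^ ((m - 2) * k)) / real (m - 1) ^ k"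
      unfolding AB by (simp only: power_divide)
    also have "\<dots> = real (m * l) * real m ^ (k * (m - 2)) / real (m - 1) ^ (k * (m - 1))"
      by (simp only: P mult.commute[of k "m - 2"] divide_divide_eq_left times_divide_eq_right)
    finally show ?thesis .
  qed
  finally show ?thesis by (simp add: k_def mult_ac)
qed

text \<open>The vertices that are not reachable from the root form the closed set \<open>Z\<close>
  of \<open>edge_laplacian_disconnected\<close>; closedness rests on the symmetry of
  adjacency.\<close>

lemma weight_disconnected:
  assumes X: "X \<subseteq> edges U" and "X \<noteq> {}" and disc: "\<not> connected_graph (edge_graph X)"
    and \<omega>: "\<omega> \<in> weights l X"
  shows "weight (m * l) (spread X \<omega>) = 0"
proof -
  let ?R = "{(x, y). {x, y} \<in> X}"
  have two: "card e = 2" if "e \<in> X" for e using that X edge_card by auto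
  have finX: "finite X" by (rule finite_subset[OF X finite_edges])
  have finUX: "finite (\<Union>X)" using finX finite_edge X by auto
  have "\<Union>X \<noteq> {}" using assms(2) two by fastforce
  then obtain r v where rv: "r \<in> \<Union>X" "v \<in> \<Union>X" "(r, v) \<notin> ?R\<^sup>*"
    using disc by (auto simp: connected_graph_def edge_graph_def)
  define Z where "Z = {z \<in> \<Union>X. (r, z) \<notin> ?R\<^sup>*}"
  have "det_on (\<Union>X - {r}) (edge_laplacian X k) = 0" for k
  proof (rule edge_laplacian_disconnected)
    show "Z \<subseteq> \<Union>X - {r}" by (auto simp: Z_def)
    show "Z \<noteq> {}" using rv by (auto simp: Z_def)
    fix e assume e: "e \<in> X" "e \<inter> Z \<noteq> {}"
    then obtain z where z: "z \<in> e" "z \<in> Z" by auto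
    then obtain y where y: "e = {z, y}" using two[OF e(1)] by (auto simp: card_2_iff doubleton_eq_iff)
    have "(r, y) \<notin> ?R\<^sup>*"
    proof
      assume "(r, y) \<in> ?R\<^sup>*"
      moreover have "(y, z) \<in> ?R" using e(1) y by (simp add: insert_commute)
      ultimately have "(r, z) \<in> ?R\<^sup>*" by (rule rtrancl_into_rtrancl)
      then show False using z(2) by (simp add: Z_def)
    qed
    moreover have "y \<in> \<Union>X" using e(1) y by blast
    ultimately show "e \<subseteq> Z" using y z(2) by (simp add: Z_def)
  qed (use finUX finX two in auto)
  then show ?thesis
    using weight_balanced[OF spread_assignments[OF X \<omega>], of r] rv(1) support_spread[OF X \<omega>] balanced_flat
    by (simp add: spread_def)
qed

text \<open>Only trees with 1 to \<open>l\<close> edges count: more than \<open>l\<close> positive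
  weights cannot sum to \<open>l\<close>, and the empty sum is not \<open>l \<ge> 1\<close>.\<close>

lemma sum_weight_trees:
  assumes l: "1 \<le> l"
  shows "(\<Sum>X\<in>{X. X \<subseteq> edges U \<and> tree (edge_graph X)}. \<Sum>\<omega>\<in>weights l X. weight (m * l) (spread X \<omega>)) =
    (\<Sum>k=1..l. real (m * l) * real m ^ (k * (m - 2)) / real (m - 1) ^ (k * (m - 1)) * tree_sum k l U)"
proof -
  let ?c = "\<lambda>k. real (m * l) * real m ^ (k * (m - 2)) / real (m - 1) ^ (k * (m - 1))"
  let ?\<T> = "{X. X \<subseteq> edges U \<and> tree (edge_graph X)}"
  have fin: "finite ?\<T>" by (rule finite_subset[of _ "Pow (edges U)"]) (use finite_edges in auto)
  have val: "(\<Sum>\<omega>\<in>weights l X. weight (m * l) (spread X \<omega>)) = ?c (card X) * tree_coeff l (edge_graph X)"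
    if X: "X \<in> ?\<T>" for X
  proof -
    have "(\<Sum>\<omega>\<in>weights l X. weight (m * l) (spread X \<omega>)) = (\<Sum>\<omega>\<in>weights l X. ?c (card X) *
      ((\<Prod>e\<in>X. real (\<omega> e)) * (\<Prod>v\<in>\<Union>X. fact (wdegree (edge_graph X) \<omega> v - 1) / real (wfact (edge_graph X) \<omega> v))))"
      using X weight_tree by (intro sum.cong) auto
    then show ?thesis unfolding sum_distrib_left[symmetric]
      by (simp add: tree_coeff_def edge_graph_def weights_def)
  qed
  have zero: "tree_coeff l (edge_graph X) = 0" if X: "X \<in> ?\<T>" and c: "card X \<notin> {1..l}" for X
  proof -
    have finX: "finite X" using X finite_subset[OF _ finite_edges] by auto
    have "{\<omega> \<in> X \<rightarrow>\<^sub>E {1..}. sum \<omega> X = l} = {}"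
    proof (rule ccontr)
      assume "{\<omega> \<in> X \<rightarrow>\<^sub>E {1..}. sum \<omega> X = l} \<noteq> {}"
      then obtain \<omega> :: "'a set \<Rightarrow> nat" where \<omega>: "\<omega> \<in> X \<rightarrow>\<^sub>E {1..}" "sum \<omega> X = l" by auto
      have "card X = (\<Sum>e\<in>X. 1)" by simp
      also have "\<dots> \<le> sum \<omega> X" using \<omega>(1) by (intro sum_mono) (auto simp: PiE_iff)
      finally have "card X \<le> l" using \<omega>(2) by simp
      moreover have "card X \<noteq> 0" using \<omega>(2) l finX by auto
      ultimately show False using c by simp
    qed
    then show ?thesis unfolding tree_coeff_def edge_graph_def hypergraph.sel by (simp only: sum.empty)
  qed
  have "(\<Sum>X\<in>?\<T>. \<Sum>\<omega>\<in>weights l X. weight (m * l) (spread X \<omega>)) = (\<Sum>X\<in>?\<T>. ?c (card X) * tree_coeff l (edge_graph X))"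
    using val by (rule sum.cong[OF refl])
  also have "\<dots> = (\<Sum>X\<in>{X \<in> ?\<T>. card X \<in> {1..l}}. ?c (card X) * tree_coeff l (edge_graph X))"
    using fin zero by (intro sum.mono_neutral_right) auto
  also have "\<dots> = (\<Sum>k\<in>{1..l}. \<Sum>X\<in>{X. X \<in> {X \<in> ?\<T>. card X \<in> {1..l}} \<and> card X = k}. ?c (card X) * tree_coeff l (edge_graph X))"
    by (rule sum.group[symmetric]) (auto intro: finite_subset[OF _ fin])
  also have "\<dots> = (\<Sum>k\<in>{1..l}. ?c k * tree_sum k l U)"
  proof (rule sum.cong[OF refl])
    fix k assume k: "k \<in> {1..l}"
    then have "{X. X \<in> {X \<in> ?\<T>. card X \<in> {1..l}} \<and> card X = k} =
      {X. X \<subseteq> edges U \<and> tree (edge_graph X) \<and> card X = k}" by auto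
    then have "(\<Sum>X\<in>{X. X \<in> {X \<in> ?\<T>. card X \<in> {1..l}} \<and> card X = k}. ?c (card X) * tree_coeff l (edge_graph X)) =
      (\<Sum>X\<in>{X. X \<subseteq> edges U \<and> tree (edge_graph X) \<and> card X = k}. ?c k * tree_coeff l (edge_graph X))"
      by (intro sum.cong) auto
    then show "(\<Sum>X\<in>{X. X \<in> {X \<in> ?\<T>. card X \<in> {1..l}} \<and> card X = k}. ?c (card X) * tree_coeff l (edge_graph X)) =
      ?c k * tree_sum k l U"
      using tree_sum_edge_sets[OF simple, of k l] k by (simp add: sum_distrib_left)
  qed
  finally show ?thesis .
qed

end

section \<open>Contributions of the cycle\<close>

locale unicyclic_power = power_graph +
  fixes C :: "'a hypergraph" and n :: nat and g :: "nat \<Rightarrow> 'a"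
  assumes unicyclic: "unicyclic U" and C: "subgraph C U" "is_cycle C"
    and n: "3 \<le> n" and g: "inj_on g {..<n}"
    and edges_C: "edges C = (\<lambda>i. {g i, g ((i + 1) mod n)}) ` {..<n}"
begin

section \<open>Indexing along the cycle\<close>

definition ce :: "nat \<Rightarrow> 'a set" where
  "ce i = {g i, g ((i + 1) mod n)}"

definition pre :: "nat \<Rightarrow> nat" where
  "pre i = (if i = 0 then n - 1 else i - 1)"

text \<open>The initial vertex of a cycle edge when the cycle is traversed in the direction of
  \<open>g\<close>; it is the reference for the two orientations.\<close>

definition first :: "'a set \<Rightarrow> 'a" where
  "first e = g (inv_into {..<n} ce e)"

lemma edges_ce: "edges C = ce ` {..<n}"
  using edges_C by (simp add: ce_def[abs_def])

lemma ce_inj: "inj_on ce {..<n}"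
  using cycle_edges_inj[OF n g] by (simp add: ce_def[abs_def])

lemma ce_eq_iff: "i < n \<Longrightarrow> j < n \<Longrightarrow> ce i = ce j \<longleftrightarrow> i = j"
  using inj_on_eq_iff[OF ce_inj] by simp

lemma g_eq_iff: "i < n \<Longrightarrow> j < n \<Longrightarrow> g i = g j \<longleftrightarrow> i = j"
  using inj_on_eq_iff[OF g] by simp

lemma cycle_sub: "edges C \<subseteq> edges U"
  using C(1) by (simp add: subgraph_def)

lemma finite_C: "finite (edges C)"
  by (simp add: edges_ce)

lemma card_C: "card (edges C) = n"
  unfolding edges_ce by (simp add: card_image[OF ce_inj])

lemma pre_less: "i < n \<Longrightarrow> pre i < n"
  using n by (auto simp: pre_def)

lemma succ_eq_iff: "i < n \<Longrightarrow> j < n \<Longrightarrow> (i + 1) mod n = j \<longleftrightarrow> i = pre j"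
proof -
  assume ij: "i < n" "j < n"
  have "(i + 1) mod n = (if i + 1 = n then 0 else i + 1)" using ij by auto
  then show ?thesis using ij n by (auto simp: pre_def)
qed

lemma pre_neq: "i < n \<Longrightarrow> pre i \<noteq> i"
  using n by (auto simp: pre_def)

lemma g_in_ce: "i < n \<Longrightarrow> j < n \<Longrightarrow> g j \<in> ce i \<longleftrightarrow> i = j \<or> i = pre j"
proof -
  assume ij: "i < n" "j < n"
  have "g j \<in> ce i \<longleftrightarrow> j = i \<or> j = (i + 1) mod n"
    using g_eq_iff[OF ij(2,1)] g_eq_iff[OF ij(2), of "(i + 1) mod n"] ij by (simp add: ce_def)
  then show ?thesis using succ_eq_iff[OF ij] by auto
qed

lemma star: "i < n \<Longrightarrow> {e \<in> edges C. g i \<in> e} = {ce i, ce (pre i)}"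
  unfolding edges_ce using g_in_ce pre_less by auto

lemma star_neq: "i < n \<Longrightarrow> ce i \<noteq> ce (pre i)"
  using ce_eq_iff[of i "pre i"] pre_less[of i] pre_neq[of i] by auto

lemma union_C: "\<Union>(edges C) = g ` {..<n}"
proof
  show "\<Union>(edges C) \<subseteq> g ` {..<n}" unfolding edges_ce using n by (auto simp: ce_def)
  show "g ` {..<n} \<subseteq> \<Union>(edges C)" unfolding edges_ce by (auto simp: ce_def)
qed

lemma first_ce: "i < n \<Longrightarrow> first (ce i) = g i"
  unfolding first_def using inv_into_f_f[OF ce_inj] by simp

text \<open>Deleting the root \<open>g 0\<close> cuts the cycle open to a path, so no entry wraps
  around and the matrix is tridiagonal. Each vertex gives weight \<open>a\<close> to the edge ahead
  and \<open>b\<close> to the edge behind.\<close>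

lemma cycle_laplacian:
  assumes "\<And>i. 1 \<le> i \<Longrightarrow> i < n \<Longrightarrow> k (g i) (ce i) = a \<and> k (g i) (ce (pre i)) = b"
  shows "det_on (\<Union>(edges C) - {g 0}) (edge_laplacian (edges C) k) =
    det_on {1..<n} (\<lambda>i j. if i = j then a + b else if j = Suc i then - a else if i = Suc j then - b else 0)"
proof -
  have "\<Union>(edges C) - {g 0} = g ` ({..<n} - {0})"
    unfolding union_C using inj_on_image_set_diff[OF g, of "{..<n}" "{0}"] n by auto
  also have "{..<n} - {0} = {1..<n}" by auto
  finally have "det_on (\<Union>(edges C) - {g 0}) (edge_laplacian (edges C) k) =
    det_on {1..<n} (\<lambda>i j. edge_laplacian (edges C) k (g i) (g j))"
    by (simp only:) (rule det_on_reindex, simp, rule inj_on_subset[OF g], auto)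
  also have "\<dots> = det_on {1..<n} (\<lambda>i j. if i = j then a + b else if j = Suc i then - a else if i = Suc j then - b else 0)"
  proof (rule det_on_cong[OF refl])
    fix i j assume "i \<in> {1..<n}" "j \<in> {1..<n}"
    then have i: "1 \<le> i" "i < n" and j: "1 \<le> j" "j < n" by auto
    have k: "k (g i) (ce i) = a" "k (g i) (ce (pre i)) = b" using assms[OF i] by auto
    show "edge_laplacian (edges C) k (g i) (g j) =
      (if i = j then a + b else if j = Suc i then - a else if i = Suc j then - b else 0)"
    proof (cases "i = j")
      case True
      have "edge_laplacian (edges C) k (g i) (g i) = a + b"
        using star_neq[OF i(2)] k by (simp add: edge_laplacian_def star[OF i(2)])
      then show ?thesis using True by simp
    next
      case False
      have "{e \<in> edges C. g i \<in> e \<and> g j \<in> e} = {e \<in> {e \<in> edges C. g i \<in> e}. g j \<in> e}" by auto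
      also have "\<dots> = {e \<in> {ce i, ce (pre i)}. g j \<in> e}" by (simp only: star[OF i(2)])
      finally have "(\<Sum>e\<in>{e \<in> edges C. g i \<in> e \<and> g j \<in> e}. k (g i) e) =
        (\<Sum>e\<in>{ce i, ce (pre i)}. if g j \<in> e then k (g i) e else 0)"
        by (simp only:) (rule sum.mono_neutral_cong_left, auto)
      also have "\<dots> = (if j = Suc i then a else 0) + (if i = Suc j then b else 0)"
      proof -
        have mem: "g j \<in> ce i \<longleftrightarrow> j = Suc i" "g j \<in> ce (pre i) \<longleftrightarrow> i = Suc j"
          using g_in_ce[OF i(2) j(2)] g_in_ce[OF pre_less[OF i(2)] j(2)] False i j by (auto simp: pre_def)
        have pair: "(\<Sum>e\<in>{x, y}. h e) = h x + h y" if "x \<noteq> y" for h :: "'a set \<Rightarrow> real" and x y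
          using that by simp
        show ?thesis unfolding pair[OF star_neq[OF i(2)]] mem k ..
      qed
      finally show ?thesis using False g_eq_iff[OF i(2) j(2)] by (auto simp: edge_laplacian_def)
    qed
  qed
  finally show ?thesis .
qed

text \<open>Covers the three assignments supported on the cycle at once: \<open>(a, b)\<close> is
  \<open>(1, 1)\<close>, \<open>(2, 0)\<close> or \<open>(0, 2)\<close>. Every vertex has degree 2
  and contributes \<open>fact 2 / (fact a * fact b) / 2\<close>; with as many vertices as edges one
  factor \<open>2 / m\<close> remains and meets \<open>m * n\<close>.\<close>

lemma weight_cycle:
  assumes K: "K \<in> assignments (m * n)" and bal: "balanced K" and supp: "support K = edges C"
    and a: "\<And>i. i < n \<Longrightarrow> K (Inl (g i)) (ce i) = a \<and> K (Inl (g i)) (ce (pre i)) = b"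
    and ab: "a + b = 2"
  shows "weight (m * n) K = 2 * real n * real (m - 1) * real m ^ (n * (m - 2)) / real (m - 1) ^ (n * (m - 1)) *
    (1 / (fact a * fact b)) ^ n * det_on {1..<n} (\<lambda>i j. if i = j then 2 else if j = Suc i then - real a
      else if i = Suc j then - real b else 0)"
proof -
  have zero: "K (Inl u) e = 0" if "e \<in> edges U" "u \<in> e" "e \<notin> edges C" for u e
    using balanced_K_zero[OF bal that(1)] that(2,3) by (simp add: supp Inl_in_hyp)
  have g0: "g 0 \<in> \<Union>(edges C)" unfolding union_C using n by auto
  have card: "card (\<Union>(edges C)) = n" unfolding union_C by (simp add: card_image[OF g])
  let ?D = "det_on {1..<n} (\<lambda>i j. if i = j then 2 else if j = Suc i then - real a else if i = Suc j then - real b else 0)"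
  have det: "det_on (\<Union>(edges C) - {g 0}) (edge_laplacian (edges C) (\<lambda>u e. real (K (Inl u) e))) = ?D"
  proof -
    have "real a + real b = 2" using ab by (metis of_nat_add of_nat_numeral)
    moreover have "det_on (\<Union>(edges C) - {g 0}) (edge_laplacian (edges C) (\<lambda>u e. real (K (Inl u) e))) =
      det_on {1..<n} (\<lambda>i j. if i = j then real a + real b else if j = Suc i then - real a else if i = Suc j then - real b else 0)"
      by (rule cycle_laplacian) (use a in auto)
    ultimately show ?thesis by (simp only:)
  qed
  have vertex: "multinom (inc (Inl u)) (K (Inl u)) / real (wdeg K (Inl u)) = 1 / (fact a * fact b)"
    if u: "u \<in> \<Union>(edges C)" for u
  proof -
    obtain i where i: "i < n" "u = g i" using u unfolding union_C by auto
    have wd: "wdeg K (Inl u) = 2"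
    proof -
      have "wdeg K (Inl u) = (\<Sum>e\<in>{e \<in> edges C. u \<in> e}. K (Inl u) e)"
        unfolding wdeg_def by (rule inc_Inl_sum[OF cycle_sub zero])
      then show ?thesis using i a[OF i(1)] star_neq[OF i(1)] ab by (simp add: star[OF i(1)])
    qed
    have "(\<Prod>e\<in>inc (Inl u). fact (K (Inl u) e)) = (\<Prod>e\<in>{e \<in> edges C. u \<in> e}. fact (K (Inl u) e) :: real)"
      by (rule inc_Inl_fact[OF cycle_sub zero])
    also have "\<dots> = fact a * fact b"
      using i a[OF i(1)] star_neq[OF i(1)] by (simp add: star[OF i(1)])
    finally show ?thesis using wd by (simp add: multinom_def wdeg_def)
  qed
  have "(\<Prod>u\<in>\<Union>(edges C). multinom (inc (Inl u)) (K (Inl u)) / real (wdeg K (Inl u))) =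
    (\<Prod>u\<in>\<Union>(edges C). 1 / (fact a * fact b))"
    using vertex by (rule prod.cong[OF refl])
  then have prod: "(\<Prod>u\<in>\<Union>(edges C). multinom (inc (Inl u)) (K (Inl u)) / real (wdeg K (Inl u))) =
    (1 / (fact a * fact b)) ^ n" by (simp only: prod_constant card)
  have nz: "real m \<noteq> 0" "real (m - 1) \<noteq> 0" using m by auto
  have "weight (m * n) K = real (m * n) * real (m - 1) * ((real m / real (m - 1)) ^ (m - 2) * 2 / real m) ^ n *
    (real m / 2) ^ (n - 1) / real (m - 1) ^ n * (1 / (fact a * fact b)) ^ n * ?D"
    using weight_balanced[OF K bal, of "g 0"] g0 unfolding supp det prod card card_C by simp
  also have "real (m * n) * real (m - 1) * ((real m / real (m - 1)) ^ (m - 2) * 2 / real m) ^ n *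
    (real m / 2) ^ (n - 1) / real (m - 1) ^ n =
    2 * real n * real (m - 1) * real m ^ (n * (m - 2)) / real (m - 1) ^ (n * (m - 1))"
  proof -
    have m1: "m - 1 = Suc (m - 2)" using m by simp
    have "((real m / real (m - 1)) ^ (m - 2) * 2 / real m) ^ n * (real m / 2) ^ n = (real m / real (m - 1)) ^ ((m - 2) * n)"
      using nz by (simp add: power_mult_distrib[symmetric] power_mult)
    moreover have "(real m / 2) ^ n = (real m / 2) * (real m / 2) ^ (n - 1)"
      using n by (metis One_nat_def Suc_diff_le diff_Suc_Suc diff_zero le_trans numeral_3_eq_3 power_Suc Suc_le_mono le0)
    ultimately have AB: "((real m / real (m - 1)) ^ (m - 2) * 2 / real m) ^ n * (real m / 2) ^ (n - 1) * real m =
        2 * (real m / real (m - 1)) ^ ((m - 2) * n)" by (simp only: mult_ac)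
    have P: "real (m - 1) ^ (n * (m - 1)) = real (m - 1) ^ ((m - 2) * n) * real (m - 1) ^ n"
      unfolding power_add[symmetric] by (rule arg_cong[of _ _ "\<lambda>x. real (m - 1) ^ x"]) (unfold m1, simp add: mult.commute)
    have "real (m * n) * real (m - 1) * ((real m / real (m - 1)) ^ (m - 2) * 2 / real m) ^ n *
      (real m / 2) ^ (n - 1) / real (m - 1) ^ n =
      real n * real (m - 1) * (((real m / real (m - 1)) ^ (m - 2) * 2 / real m) ^ n * (real m / 2) ^ (n - 1) * real m) / real (m - 1) ^ n"
      by (simp only: of_nat_mult mult_ac)
    also have "\<dots> = 2 * real n * real (m - 1) * (real m ^ ((m - 2) * n) / real (m - 1) ^ ((m - 2) * n)) / real (m - 1) ^ n"
      unfolding AB by (simp only: power_divide mult_ac)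
    also have "\<dots> = 2 * real n * real (m - 1) * real m ^ (n * (m - 2)) / real (m - 1) ^ (n * (m - 1))"
      by (simp only: P mult.commute[of n "m - 2"] divide_divide_eq_left times_divide_eq_right)
    finally show ?thesis .
  qed
  finally show ?thesis .
qed

text \<open>The multiplicity 1 on the cycle plus a unit circulation. For \<open>s = True\<close>
  each cycle edge is selected twice by its initial vertex and never by its terminal one;
  \<open>s = False\<close> is the reverse.\<close>

definition oriented :: "bool \<Rightarrow> 'a + 'a set \<times> nat \<Rightarrow> 'a set \<Rightarrow> nat" where
  "oriented s = (\<lambda>i\<in>V. \<lambda>e\<in>inc i. if e \<in> edges C
     then case i of Inl u \<Rightarrow> if (u = first e) = s then 2 else 0 | Inr _ \<Rightarrow> 1 else 0)"

lemma oriented_Inl: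
  "e \<in> edges U \<Longrightarrow> u \<in> e \<Longrightarrow>
     oriented s (Inl u) e = (if e \<in> edges C then if (u = first e) = s then 2 else 0 else 0)"
  using edge_subset by (auto simp: oriented_def V_eq inc_Inl)

lemma oriented_Inr:
  "e \<in> edges U \<Longrightarrow> t \<in> {1..m-2} \<Longrightarrow> oriented s (Inr (e, t)) e = (if e \<in> edges C then 1 else 0)"
  using inc_Inr by (auto simp: oriented_def V_eq)

lemma ce_in_U: "i < n \<Longrightarrow> ce i \<in> edges U"
  using cycle_sub by (auto simp: edges_ce)

lemma ce_in_C: "i < n \<Longrightarrow> ce i \<in> edges C"
  by (simp add: edges_ce)

lemma oriented_ce:
  assumes "i < n"
  shows "oriented s (Inl (g i)) (ce i) = (if s then 2 else 0)"
    and "oriented s (Inl (g i)) (ce (pre i)) = (if s then 0 else 2)"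
proof -
  have "g i \<in> ce i" by (simp add: ce_def)
  then show "oriented s (Inl (g i)) (ce i) = (if s then 2 else 0)"
    by (simp add: oriented_Inl[OF ce_in_U[OF assms]] ce_in_C[OF assms] first_ce[OF assms])
  have "g i \<noteq> g (pre i)" using g_eq_iff[OF assms pre_less[OF assms]] pre_neq[OF assms] by auto
  then show "oriented s (Inl (g i)) (ce (pre i)) = (if s then 0 else 2)"
    using assms pre_less[OF assms] g_in_ce[OF pre_less[OF assms] assms]
    by (simp add: oriented_Inl[OF ce_in_U] ce_in_C first_ce)
qed

lemma emult_oriented: "e \<in> edges U \<Longrightarrow> emult (oriented s) e = (if e \<in> edges C then 1 else 0)"
  unfolding emult_def using m by (intro oriented_Inr) auto

lemma balanced_oriented: "balanced (oriented s)"
  unfolding balanced_def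
proof
  fix j assume j: "j \<in> V"
  have tot: "total (oriented s) e = (if e \<in> edges C then m else 0)" if e: "e \<in> edges U" for e
  proof -
    obtain u v where uv: "e = {u, v}" "u \<noteq> v" using edge_card[OF e] by (auto simp: card_2_iff)
    have new: "(\<Sum>t\<in>{1..m-2}. oriented s (Inr (e, t)) e) = (if e \<in> edges C then m - 2 else 0)"
      using oriented_Inr[OF e] by simp
    have ends: "u \<in> e" "v \<in> e" using uv(1) by blast+
    note old = oriented_Inl[OF e ends(1)] oriented_Inl[OF e ends(2)]
    show ?thesis
    proof (cases "e \<in> edges C")
      case True
      then obtain i where i: "i < n" "e = ce i" unfolding edges_ce by blast
      have "first e \<in> e" unfolding i(2) first_ce[OF i(1)] by (simp add: ce_def)
      then have "first e = u \<or> first e = v" using uv(1) by blast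
      then have sum2: "oriented s (Inl u) e + oriented s (Inl v) e = 2"
        using uv(2) unfolding old by (auto simp: True)
      show ?thesis unfolding total_eq[OF e uv] sum2 new using True m by simp
    next
      case False
      then show ?thesis unfolding total_eq[OF e uv] new old by simp
    qed
  qed
  have "(\<Sum>e\<in>inc j. total (oriented s) e) = (\<Sum>e\<in>inc j. m * (if e \<in> edges C then 1 else 0))"
    using tot by (intro sum.cong) (auto simp: inc_def)
  also have "\<dots> = m * (\<Sum>e\<in>inc j. if e \<in> edges C then 1 else 0)" by (simp add: sum_distrib_left)
  also have "(\<Sum>e\<in>inc j. if e \<in> edges C then 1 else 0) = wdeg (oriented s) j"
  proof (cases j)
    case (Inl u)
    have "(\<Sum>e\<in>inc j. if e \<in> edges C then 1 else 0) = (\<Sum>e\<in>{e \<in> edges C. u \<in> e}. if e \<in> edges C then 1 else 0 :: nat)"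
      unfolding Inl
      by (rule inc_Inl_sum[OF cycle_sub, where h = "\<lambda>e. if e \<in> edges C then 1 else 0"]) simp
    moreover have "wdeg (oriented s) j = (\<Sum>e\<in>{e \<in> edges C. u \<in> e}. oriented s (Inl u) e)"
      unfolding Inl wdeg_def
      by (rule inc_Inl_sum[OF cycle_sub, where h = "oriented s (Inl u)"]) (simp add: oriented_Inl)
    moreover have "(\<Sum>e\<in>{e \<in> edges C. u \<in> e}. if e \<in> edges C then 1 else 0 :: nat) =
      (\<Sum>e\<in>{e \<in> edges C. u \<in> e}. oriented s (Inl u) e)"
    proof (cases "u \<in> \<Union>(edges C)")
      case True
      then obtain i where i: "i < n" "u = g i" unfolding union_C by auto
      show ?thesis unfolding i(2) star[OF i(1)]
        using star_neq[OF i(1)] oriented_ce[OF i(1)] ce_in_C[OF i(1)] ce_in_C[OF pre_less[OF i(1)]] by simp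
    next
      case False
      then have "{e \<in> edges C. u \<in> e} = {}" by auto
      then show ?thesis by (simp only: sum.empty)
    qed
    ultimately show ?thesis by simp
  next
    case (Inr b)
    then obtain e t where j': "j = Inr (e, t)" by (cases b) auto
    then have "e \<in> edges U" "t \<in> {1..m-2}" using j by (auto simp: V_eq)
    then show ?thesis unfolding j' wdeg_def by (simp add: inc_Inr oriented_Inr)
  qed
  finally show "m * wdeg (oriented s) j = (\<Sum>e\<in>inc j. total (oriented s) e)" by simp
qed

lemma oriented_extensional: "oriented s \<in> (\<Pi>\<^sub>E i\<in>V. inc i \<rightarrow>\<^sub>E UNIV)"
  by (auto simp: oriented_def)

lemma oriented_assignments: "oriented s \<in> assignments (m * n)"
proof -
  have "(\<Sum>e\<in>edges U. emult (oriented s) e) = (\<Sum>e\<in>edges C. 1)"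
    using finite_edges cycle_sub emult_oriented by (intro sum.mono_neutral_cong_right) auto
  then show ?thesis
    using balanced_assignments[OF balanced_oriented oriented_extensional] card_C by simp
qed

lemma support_oriented: "support (oriented s) = edges C"
  using cycle_sub emult_oriented by (auto simp: support_def split: if_splits)

lemma oriented_not_flat: "oriented s \<notin> range flat"
proof
  assume "oriented s \<in> range flat"
  then obtain \<omega> where \<omega>: "oriented s = flat \<omega>" by auto
  have n0: "0 < n" using n by simp
  have "emult (oriented s) (ce 0) = oriented s (Inl (g 0)) (ce 0)"
    using emult_flat[OF ce_in_U[OF n0], of \<omega>] flat_hyp[OF ce_in_U[OF n0], of "Inl (g 0)" \<omega>]
    by (simp add: \<omega> Inl_in_hyp ce_def)
  then show False
    using emult_oriented[OF ce_in_U[OF n0]] ce_in_C[OF n0] oriented_ce(1)[OF n0] by (simp split: if_splits)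
qed

lemma oriented_neq: "oriented True \<noteq> oriented False"
proof
  assume eq: "oriented True = oriented False"
  have "0 < n" using n by simp
  then show False using oriented_ce(1)[of 0 True] oriented_ce(1)[of 0 False] by (simp add: eq)
qed

text \<open>\<open>Y\<close> is the support of the circulation. It has no vertex of degree one, so
  it contains the cycle, and each of its edges uses up at least one unit of the total
  \<open>l \<le> n\<close>.\<close>

lemma not_flat_cases:
  assumes K: "K \<in> assignments (m * l)" and bal: "balanced K" and nf: "K \<notin> range flat" and l: "l \<le> n"
  shows "l = n \<and> (\<exists>s. K = oriented s)"
proof -
  have ext: "K \<in> (\<Pi>\<^sub>E i\<in>V. inc i \<rightarrow>\<^sub>E UNIV)" using K by (simp add: assignments_def)
  define Y where "Y = {e \<in> edges U. \<exists>u\<in>e. K (Inl u) e \<noteq> emult K e}"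
  have YU: "Y \<subseteq> edges U" by (auto simp: Y_def)
  \<comment> \<open>By \<open>balanced_old\<close> the deviations at the two ends are opposite, so
    both are nonzero if one is.\<close>
  have other: "K (Inl v) e \<noteq> emult K e" if "e \<in> Y" "v \<in> e" for e v
  proof -
    obtain u where e: "e \<in> edges U" and u: "u \<in> e" "K (Inl u) e \<noteq> emult K e" using \<open>e \<in> Y\<close> by (auto simp: Y_def)
    show ?thesis
    proof (cases "u = v")
      case False
      then have "e = {u, v}" using edge_card[OF e] u(1) that(2) by (auto simp: card_2_iff)
      then show ?thesis using balanced_old[OF bal e _ False] u(2) by auto
    qed (use u in simp)
  qed
  have "Y \<noteq> {}"
  proof
    assume "Y = {}"
    then have "K = flat (emult K)" using flat_emult[OF bal ext] by (auto simp: Y_def)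
    then show False using nf by auto
  qed
  moreover have "card {e \<in> Y. v \<in> e} \<noteq> 1" if v: "v \<in> \<Union>Y" for v
  proof
    assume "card {e \<in> Y. v \<in> e} = 1"
    then obtain e where e: "{e \<in> Y. v \<in> e} = {e}" by (auto simp: card_1_singleton_iff)
    have eY: "e \<in> Y" "v \<in> e" using e by auto
    have eI: "e \<in> inc (Inl v)" using eY YU by (auto simp: inc_Inl)
    have "Inl v \<in> V" using union_subset[OF YU v] .
    then have "(\<Sum>e\<in>inc (Inl v). K (Inl v) e) = (\<Sum>e\<in>inc (Inl v). emult K e)"
      using balanced_wdeg[OF bal] by (simp add: wdeg_def)
    moreover have "(\<Sum>f\<in>inc (Inl v) - {e}. K (Inl v) f) = (\<Sum>f\<in>inc (Inl v) - {e}. emult K f)"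
    proof (rule sum.cong[OF refl])
      fix f assume f: "f \<in> inc (Inl v) - {e}"
      then have "f \<in> edges U" "v \<in> f" "f \<notin> Y" using e by (auto simp: inc_Inl)
      then show "K (Inl v) f = emult K f" by (auto simp: Y_def)
    qed
    ultimately have "K (Inl v) e = emult K e"
      unfolding sum.remove[OF finite_inc eI] by simp
    then show False using other[OF eY] by simp
  qed
  ultimately have "has_cycle Y"
    using YU edge_card finite_subset[OF YU finite_edges] by (intro has_cycle_if_no_leaf) auto
  then have CY: "edges C \<subseteq> Y" by (rule unicyclic_has_cycle[OF unicyclic C YU])
  \<comment> \<open>Multiplicity 0 makes the two end values sum to 0, hence both vanish and there is
    no deviation.\<close>
  have pos: "1 \<le> emult K e" if "e \<in> Y" for e
  proof (rule ccontr)
    assume "\<not> 1 \<le> emult K e"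
    then have 0: "emult K e = 0" by simp
    have e: "e \<in> edges U" using that YU by auto
    obtain u v where uv: "e = {u, v}" "u \<noteq> v" using edge_card[OF e] by (auto simp: card_2_iff)
    then have "K (Inl u) e = 0" using balanced_old[OF bal e uv] 0 by simp
    then show False using other[OF that, of u] uv 0 by simp
  qed
  have sum_l: "(\<Sum>e\<in>edges U. emult K e) = l" using K balanced_assignments[OF bal ext] by simp
  have split: "(\<Sum>e\<in>edges U. emult K e) = (\<Sum>e\<in>edges C. emult K e) + (\<Sum>e\<in>edges U - edges C. emult K e)"
    using sum.subset_diff[OF cycle_sub finite_edges, of "emult K"] by simp
  have ge: "(\<Sum>e\<in>edges C. emult K e) = n + (\<Sum>e\<in>edges C. emult K e - 1)"
  proof -
    have "(\<Sum>e\<in>edges C. emult K e) = (\<Sum>e\<in>edges C. 1 + (emult K e - 1))"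
    proof (rule sum.cong[OF refl])
      fix e assume "e \<in> edges C"
      then have "1 \<le> emult K e" using pos CY by blast
      then show "emult K e = 1 + (emult K e - 1)" by simp
    qed
    then show ?thesis using card_C by (simp only: sum.distrib) simp
  qed
  \<comment> \<open>The bound \<open>l \<le> n\<close> leaves no room: multiplicity 1 on the cycle
    and 0 off it.\<close>
  then have ln: "l = n" and one: "(\<Sum>e\<in>edges C. emult K e - 1) = 0" and zero: "(\<Sum>e\<in>edges U - edges C. emult K e) = 0"
    using sum_l split l by linarith+
  have em: "emult K e = (if e \<in> edges C then 1 else 0)" if "e \<in> edges U" for e
  proof (cases "e \<in> edges C")
    case True
    then have "emult K e - 1 = 0" using one finite_C by simp
    then show ?thesis using True pos[of e] CY by auto
  next
    case False
    then show ?thesis using zero finite_edges that by simp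
  qed
  have edge: "K (Inl (g i)) (ce i) + K (Inl (g ((i + 1) mod n))) (ce i) = 2" if "i < n" for i
  proof -
    have m': "(i + 1) mod n < n" using n by simp
    have "i \<noteq> (i + 1) mod n" using succ_eq_iff[OF that that] pre_neq[OF that] by auto
    then have "g i \<noteq> g ((i + 1) mod n)" using g_eq_iff[OF that m'] by simp
    then show ?thesis
      using balanced_old[OF bal ce_in_U[OF that] ce_def] em[OF ce_in_U[OF that]] ce_in_C[OF that] by simp
  qed
  have vertex: "K (Inl (g i)) (ce i) + K (Inl (g i)) (ce (pre i)) = 2" if i: "i < n" for i
  proof -
    have gV: "Inl (g i) \<in> V" using union_subset[OF cycle_sub, of "g i"] i by (auto simp: union_C)
    have z: "K (Inl (g i)) e = 0" "emult K e = 0" if "e \<in> edges U" "g i \<in> e" "e \<notin> edges C" for e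
    proof -
      show "emult K e = 0" using em that by simp
      then show "K (Inl (g i)) e = 0"
        using balanced_K_zero[OF bal that(1), of "Inl (g i)"] that(2) by (simp add: support_def Inl_in_hyp)
    qed
    have "wdeg K (Inl (g i)) = (\<Sum>e\<in>{e \<in> edges C. g i \<in> e}. K (Inl (g i)) e)"
      unfolding wdeg_def by (rule inc_Inl_sum[OF cycle_sub z(1)])
    moreover have "wdeg K (Inl (g i)) = (\<Sum>e\<in>{e \<in> edges C. g i \<in> e}. emult K e)"
      unfolding balanced_wdeg[OF bal gV] by (rule inc_Inl_sum[OF cycle_sub z(2)])
    ultimately show ?thesis
      using star_neq[OF i] em[OF ce_in_U[OF i]] em[OF ce_in_U[OF pre_less[OF i]]]
        ce_in_C[OF i] ce_in_C[OF pre_less[OF i]] by (simp add: star[OF i])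
  qed
  \<comment> \<open>Both equations involve the value of \<open>g (Suc i)\<close> at
    \<open>ce i\<close>; eliminating it shows that the value at the initial vertex is carried along
    the cycle.\<close>
  have const: "K (Inl (g i)) (ce i) = K (Inl (g 0)) (ce 0)" if "i < n" for i
    using that
  proof (induction i)
    case (Suc i)
    have "K (Inl (g (Suc i))) (ce (Suc i)) + K (Inl (g (Suc i))) (ce i) = 2"
      using vertex[OF Suc.prems] by (simp add: pre_def)
    moreover have "K (Inl (g i)) (ce i) + K (Inl (g (Suc i))) (ce i) = 2"
      using edge[of i] Suc.prems by simp
    ultimately show ?case using Suc by simp
  qed simp
  define s where "s \<longleftrightarrow> K (Inl (g 0)) (ce 0) = 2"
  have n0: "0 < n" using n by simp
  \<comment> \<open>The value 1 would be no deviation, but \<open>ce 0\<close> belongs to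
    \<open>Y\<close>. This leaves 0 and 2, the two orientations.\<close>
  have "K (Inl (g 0)) (ce 0) \<noteq> 1"
    using other[of "ce 0" "g 0"] CY ce_in_C[OF n0] em[OF ce_in_U[OF n0]] by (auto simp: ce_def)
  moreover have "K (Inl (g 0)) (ce 0) \<le> 2" using edge[OF n0] by simp
  ultimately have s: "K (Inl (g 0)) (ce 0) = (if s then 2 else 0)" unfolding s_def by auto
  have "K = oriented s"
  proof (rule PiE_ext[OF ext oriented_extensional])
    fix i assume i: "i \<in> V"
    show "K i = oriented s i"
    proof (rule PiE_ext[OF PiE_mem[OF ext i] PiE_mem[OF oriented_extensional i]])
      fix e assume "e \<in> inc i"
      then have e: "e \<in> edges U" "i \<in> hyp e" by (auto simp: inc_def)
      show "K i e = oriented s i e"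
      proof (cases "e \<in> edges C")
        case False
        have "K i e = 0" using balanced_K_zero[OF bal e] em[OF e(1)] False by (simp add: support_def)
        moreover have "oriented s i e = 0"
          using balanced_K_zero[OF balanced_oriented e] False by (simp add: support_oriented)
        ultimately show ?thesis by simp
      next
        case True
        then obtain k where k: "k < n" "e = ce k" by (auto simp: edges_ce)
        show ?thesis
        proof (cases i)
          case (Inl u)
          then have u: "u \<in> ce k" using e(2) k by (simp add: Inl_in_hyp)
          show ?thesis
          proof (cases "u = g k")
            case True
            then show ?thesis using const[OF k(1)] s oriented_ce(1)[OF k(1), of s] by (simp add: Inl k(2))
          next
            case False
            then have u': "u = g ((k + 1) mod n)" using u by (simp add: ce_def)
            have "oriented s (Inl u) e = (if s then 0 else 2)"
              using oriented_Inl[OF e(1), of u s] u False k ce_in_C[OF k(1)] first_ce[OF k(1)] by simp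
            moreover have "K (Inl u) e = (if s then 0 else 2)"
              using edge[OF k(1)] const[OF k(1)] s by (simp add: u' k(2) split: if_splits)
            ultimately show ?thesis by (simp add: Inl)
          qed
        next
          case (Inr b)
          then obtain t where t: "i = Inr (e, t)" "t \<in> {1..m-2}" using e(2) by (cases b) (auto simp: Inr_in_hyp)
          then show ?thesis using balanced_new_eq[OF bal e(1) t(2)] em[OF e(1)] oriented_Inr[OF e(1) t(2)] by simp
        qed
      qed
    qed
  qed
  then show ?thesis using ln by blast
qed

text \<open>One of \<open>a\<close> and \<open>b\<close> is zero, so the matrix is triangular with
  determinant \<open>2 ^ (n - 1)\<close>; together with the factor 2 in front this cancels
  \<open>(1 / fact 2) ^ n\<close>.\<close>

lemma weight_oriented:
  "weight (m * n) (oriented s) = real n * real (m - 1) * real m ^ (n * (m - 2)) / real (m - 1) ^ (n * (m - 1))"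
proof -
  define a b :: nat where "a = (if s then 2 else 0)" and "b = (if s then 0 else 2)"
  have *: "2 * (1 / (fact a * fact b)) ^ n * det_on {1..<n} (\<lambda>i j. if i = j then 2 else if j = Suc i then - real a
      else if i = Suc j then - real b else 0) = 1"
  proof -
    have up: "det_on {1..<n} (\<lambda>i j. if i = j then 2 else if j = Suc i then - 2 else 0) = 2 ^ (n - 1)"
      using det_bidiagonal[of 1 n] n by simp
    have "det_on {1..<n} (\<lambda>i j. if i = j then 2 else if i = Suc j then - 2 else 0) =
      det_on {1..<n} (\<lambda>i j. if j = i then 2 else if i = Suc j then - 2 else 0)"
      by (rule det_on_cong) auto
    also have "\<dots> = 2 ^ (n - 1)"
      using det_on_transpose[of "{1..<n}" "\<lambda>i j. if i = j then 2 else if j = Suc i then - 2 else 0"] up by simp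
    finally have low: "det_on {1..<n} (\<lambda>i j. if i = j then 2 else if i = Suc j then - 2 else 0) = 2 ^ (n - 1)" .
    have "det_on {1..<n} (\<lambda>i j. if i = j then 2 else if j = Suc i then - real a
      else if i = Suc j then - real b else 0) = 2 ^ (n - 1)"
    proof (cases s)
      case True
      then show ?thesis unfolding up[symmetric] a_def b_def by (intro det_on_cong) auto
    next
      case False
      then show ?thesis unfolding low[symmetric] a_def b_def by (intro det_on_cong) auto
    qed
    moreover have "fact a * fact b = (2 :: real)" by (simp add: a_def b_def)
    moreover have "2 * (2 :: real) ^ (n - 1) = 2 ^ n" using n by (cases n) auto
    ultimately show ?thesis by (simp add: power_divide)
  qed
  have "weight (m * n) (oriented s) = 2 * real n * real (m - 1) * real m ^ (n * (m - 2)) / real (m - 1) ^ (n * (m - 1)) *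
    (1 / (fact a * fact b)) ^ n * det_on {1..<n} (\<lambda>i j. if i = j then 2 else if j = Suc i then - real a
      else if i = Suc j then - real b else 0)"
    by (rule weight_cycle[OF oriented_assignments balanced_oriented support_oriented])
      (simp_all add: oriented_ce a_def b_def)
  also have "\<dots> = real n * real (m - 1) * real m ^ (n * (m - 2)) / real (m - 1) ^ (n * (m - 1)) *
    (2 * (1 / (fact a * fact b)) ^ n * det_on {1..<n} (\<lambda>i j. if i = j then 2 else if j = Suc i then - real a
      else if i = Suc j then - real b else 0))"
    by simp
  finally show ?thesis unfolding * by simp
qed

section \<open>The total weight and the trace\<close>

definition ones :: "'a set \<Rightarrow> nat" where
  "ones = (\<lambda>e\<in>edges C. 1)"

lemma ones_weights: "ones \<in> weights n (edges C)"
  using card_C by (simp add: weights_def ones_def)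

text \<open>Here the determinant is \<open>n\<close>, the number of spanning trees of the cycle, and
  the factorials are 1.\<close>

lemma weight_flat_cycle:
  "weight (m * n) (spread (edges C) ones) =
     2 * real n ^ 2 * real (m - 1) * real m ^ (n * (m - 2)) / real (m - 1) ^ (n * (m - 1))"
proof -
  have one: "spread (edges C) ones (Inl u) e = 1" if "e \<in> edges C" "u \<in> e" for u e
    using spread_old[OF that(2), of "edges C" ones] that(1) cycle_sub by (auto simp: ones_def)
  have "det_on {1..<n} (\<lambda>i j. if i = j then 2 else if j = Suc i then - real 1 else if i = Suc j then - real 1 else 0) =
    det_on {1..<n} (\<lambda>i j. if i = j then if i = 1 then (real 1 + 1) / real 1 else 2
    else if j = Suc i \<or> i = Suc j then - 1 else 0)"
    by (rule det_on_cong) auto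
  also have "\<dots> = real n" using det_tridiagonal[of 1 n] n by simp
  finally have det: "det_on {1..<n} (\<lambda>i j. if i = j then 2 else if j = Suc i then - real 1 else if i = Suc j then - real 1 else 0) =
    real n" .
  have "weight (m * n) (spread (edges C) ones) = 2 * real n * real (m - 1) * real m ^ (n * (m - 2)) / real (m - 1) ^ (n * (m - 1)) *
    (1 / (fact 1 * fact 1)) ^ n * det_on {1..<n} (\<lambda>i j. if i = j then 2 else if j = Suc i then - real 1
      else if i = Suc j then - real 1 else 0)"
  proof (rule weight_cycle)
    show "spread (edges C) ones \<in> assignments (m * n)" by (rule spread_assignments[OF cycle_sub ones_weights])
    show "balanced (spread (edges C) ones)" unfolding spread_def by (rule balanced_flat)
    show "support (spread (edges C) ones) = edges C" by (rule support_spread[OF cycle_sub ones_weights])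
    fix i assume i: "i < n"
    show "spread (edges C) ones (Inl (g i)) (ce i) = 1 \<and> spread (edges C) ones (Inl (g i)) (ce (pre i)) = 1"
      using one ce_in_C[OF i] ce_in_C[OF pre_less[OF i]] g_in_ce[OF i i] g_in_ce[OF pre_less[OF i] i] by auto
  qed simp
  then show ?thesis unfolding det by (simp add: power2_eq_square)
qed

text \<open>A cyclic \<open>X\<close> contains the \<open>n\<close> edges of the cycle, each of
  weight at least 1, while the total is at most \<open>n\<close>. Thus no cyclic support other than
  the cycle itself occurs, be it connected or not.\<close>

lemma weights_cycle:
  assumes X: "X \<subseteq> edges U" "has_cycle X" and l: "l \<le> n"
  shows "weights l X = (if l = n \<and> X = edges C then {ones} else {})"
proof -
  have finX: "finite X" by (rule finite_subset[OF X(1) finite_edges])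
  have sub: "edges C \<subseteq> X" by (rule unicyclic_has_cycle[OF unicyclic C X])
  have *: "l = n \<and> X = edges C \<and> \<omega> = ones" if \<omega>: "\<omega> \<in> weights l X" for \<omega>
  proof -
    have pos: "1 \<le> \<omega> e" if "e \<in> X" for e using \<omega> that by (auto simp: weights_def PiE_iff)
    have "l = sum \<omega> X" using \<omega> by (simp add: weights_def)
    also have "\<dots> = (\<Sum>e\<in>X. 1 + (\<omega> e - 1))"
    proof (rule sum.cong[OF refl])
      fix e assume "e \<in> X"
      then show "\<omega> e = 1 + (\<omega> e - 1)" using pos[of e] by simp
    qed
    also have "\<dots> = card X + (\<Sum>e\<in>X. \<omega> e - 1)" by (simp only: sum.distrib) simp
    finally have "l = card X + (\<Sum>e\<in>X. \<omega> e - 1)" .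
    moreover have "n \<le> card X" using card_mono[OF finX sub] card_C by simp
    ultimately have ln: "l = n" "card X = n" "(\<Sum>e\<in>X. \<omega> e - 1) = 0" using l by auto
    then have XC: "X = edges C" using card_subset_eq[OF finX sub] card_C by simp
    have "\<omega> e = 1" if "e \<in> X" for e
    proof -
      have "\<omega> e - 1 = 0" using ln(3) finX that by simp
      then show ?thesis using pos[OF that] by simp
    qed
    moreover have "\<omega> \<in> X \<rightarrow>\<^sub>E UNIV" using \<omega> by (auto simp: weights_def PiE_iff)
    ultimately have "\<omega> = ones"
      unfolding ones_def XC by (intro PiE_ext[of _ "edges C" "\<lambda>_. UNIV"]) auto
    then show ?thesis using ln XC by simp
  qed
  show ?thesis
  proof (cases "l = n \<and> X = edges C")
    case True
    have "weights l X \<subseteq> {ones}" using * by blast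
    moreover have "ones \<in> weights l X" using ones_weights True by simp
    ultimately have "weights l X = {ones}" by blast
    then show ?thesis by (simp only: True simp_thms if_True)
  next
    case False
    then have "weights l X = {}" using * by blast
    then show ?thesis by (simp only: False if_False)
  qed
qed

text \<open>Supports are trees, cyclic, or neither. In the last case they are empty, which carries
  no weighting of total \<open>l \<ge> 1\<close>, or disconnected, which gives weight 0.\<close>

lemma sum_weight_flat:
  assumes l: "1 \<le> l" "l \<le> n"
  shows "(\<Sum>K\<in>assignments (m * l) \<inter> range flat. weight (m * l) K) =
    (\<Sum>k=1..l. real (m * l) * real m ^ (k * (m - 2)) / real (m - 1) ^ (k * (m - 1)) * tree_sum k l U) +
    (if l = n then weight (m * n) (spread (edges C) ones) else 0)"
proof -
  let ?G = "\<lambda>X. \<Sum>\<omega>\<in>weights l X. weight (m * l) (spread X \<omega>)"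
  let ?\<T> = "{X. X \<subseteq> edges U \<and> tree (edge_graph X)}"
  let ?\<C> = "{X. X \<subseteq> edges U \<and> has_cycle X}"
  have acyclic: "?G X = 0" if X: "X \<in> Pow (edges U) - (?\<T> \<union> ?\<C>)" for X
  proof (cases "X = {}")
    case True
    have "weights l {} = {}" using l by (auto simp: weights_def)
    then show ?thesis using True by simp
  next
    case False
    have "simple_graph (edge_graph X)"
      using X edge_card finite_edge finite_subset[OF _ finite_edges, of X]
      by (auto simp: uniform_hypergraph_def edge_graph_def)
    then have "\<not> connected_graph (edge_graph X)" using X by (auto simp: tree_iff edge_graph_def)
    then show ?thesis using X False weight_disconnected[of X] by simp
  qed
  have disj: "?\<T> \<inter> ?\<C> = {}" by (auto simp: tree_iff edge_graph_def)
  have fin: "finite ?\<T>" "finite ?\<C>"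
    using finite_edges by (auto intro: finite_subset[of _ "Pow (edges U)"])
  have "(\<Sum>K\<in>assignments (m * l) \<inter> range flat. weight (m * l) K) = (\<Sum>X\<in>Pow (edges U). ?G X)"
    by (rule sum_flat)
  also have "\<dots> = (\<Sum>X\<in>?\<T> \<union> ?\<C>. ?G X)"
    using finite_edges acyclic by (intro sum.mono_neutral_right) auto
  also have "\<dots> = (\<Sum>X\<in>?\<T>. ?G X) + (\<Sum>X\<in>?\<C>. ?G X)"
    by (rule sum.union_disjoint[OF fin disj])
  also have "(\<Sum>X\<in>?\<T>. ?G X) = (\<Sum>k=1..l. real (m * l) * real m ^ (k * (m - 2)) / real (m - 1) ^ (k * (m - 1)) * tree_sum k l U)"
    by (rule sum_weight_trees[OF l(1)])
  also have "(\<Sum>X\<in>?\<C>. ?G X) = (\<Sum>X\<in>?\<C>. if X = edges C then if l = n then weight (m * n) (spread (edges C) ones) else 0 else 0)"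
    using weights_cycle[OF _ _ l(2)] by (intro sum.cong) auto
  also have "\<dots> = (if l = n then weight (m * n) (spread (edges C) ones) else 0)"
  proof -
    have "has_cycle (edges C)"
      unfolding has_cycle_def edges_C using n g by blast
    then have "edges C \<in> ?\<C>" using cycle_sub by simp
    then show ?thesis using fin by simp
  qed
  finally show ?thesis .
qed

text \<open>Up to the common factor, the cycle contributes \<open>2 * n ^ 2\<close> without
  circulation and \<open>n\<close> for each of its two orientations.\<close>

lemma sum_weight:
  assumes l: "1 \<le> l" "l \<le> n"
  shows "(\<Sum>K\<in>assignments (m * l). weight (m * l) K) =
    (\<Sum>k=1..l. real (m * l) * real m ^ (k * (m - 2)) / real (m - 1) ^ (k * (m - 1)) * tree_sum k l U) +
    (if l = n then 2 * real n * (real n + 1) * real (m - 1) * real m ^ (n * (m - 2)) / real (m - 1) ^ (n * (m - 1)) else 0)"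
proof -
  let ?A = "assignments (m * l)"
  let ?O = "if l = n then {oriented True, oriented False} else {}"
  let ?c = "real (m - 1) * real m ^ (n * (m - 2)) / real (m - 1) ^ (n * (m - 1))"
  have "(\<Sum>K\<in>?A. weight (m * l) K) = (\<Sum>K\<in>?A \<inter> range flat. weight (m * l) K) + (\<Sum>K\<in>?A - range flat. weight (m * l) K)"
    by (rule sum.Int_Diff[OF finite_assignments])
  also have "(\<Sum>K\<in>?A - range flat. weight (m * l) K) = (\<Sum>K\<in>?O. weight (m * l) K)"
  proof (rule sum.mono_neutral_right)
    show "finite (?A - range flat)" using finite_assignments by simp
    show "?O \<subseteq> ?A - range flat" using oriented_assignments oriented_not_flat by auto
    show "\<forall>K\<in>?A - range flat - ?O. weight (m * l) K = 0"
    proof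
      fix K assume K: "K \<in> ?A - range flat - ?O"
      have "\<not> balanced K"
      proof
        assume "balanced K"
        then obtain s where "l = n" "K = oriented s" using not_flat_cases[of K l] K l(2) by auto
        then show False using K by (cases s) auto
      qed
      then show "weight (m * l) K = 0" by (rule weight_unbalanced)
    qed
  qed
  also have "\<dots> = (if l = n then 2 * (real n * ?c) else 0)"
    using oriented_neq weight_oriented by auto
  finally show ?thesis
    unfolding sum_weight_flat[OF l] weight_flat_cycle by (auto simp: power2_eq_square ring_distribs add_divide_distrib mult_ac)
qed

text \<open>As \<open>U\<close> has as many vertices as edges, its power has
  \<open>(m - 1) * card (edges U)\<close> vertices, and the prefactor of the trace merges with the
  denominators. The exponents are integers because for \<open>k = card (edges U)\<close> the
  exponent is -1.\<close>

lemma trace_power: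
  assumes l: "1 \<le> l" "l \<le> n"
  shows "hypergraph_trace m (power_hypergraph U m) (m * l) =
    (\<Sum>k=1..l. real (m * l) * real (m - 1) powi (int (m - 1) * (int (card (edges U)) - int k) - 1) *
       real m ^ (k * (m - 2)) * tree_sum k l U) +
    (if l = n then 2 * real n * (real n + 1) * real (m - 1) powi (int (m - 1) * (int (card (edges U)) - int n)) *
       real m ^ (n * (m - 2)) else 0)"
proof -
  let ?p = "real (m - 1)" and ?N = "card (edges U) * (m - 1)"
  have p: "?p \<noteq> 0" using m by simp
  have "card (edges U) > 0" using card_mono[OF finite_edges cycle_sub] card_C n by simp
  then have N: "0 < ?N" using m by simp
  have "card V = card (edges U) * (1 + (m - 2))"
    unfolding card_V unicyclic_card[OF unicyclic C] by simp
  also have "1 + (m - 2) = m - 1" using m by simp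
  finally have cV: "card V = ?N" .
  have pow: "?p ^ (?N - 1) / ?p ^ (k * (m - 1)) = ?p powi (int (m - 1) * (int (card (edges U)) - int k) - 1)" for k
  proof -
    have "int (m - 1) * (int (card (edges U)) - int k) - 1 = int (?N - 1) - int (k * (m - 1))"
      using N by (simp only: of_nat_diff[OF Suc_leI[OF N, simplified One_nat_def[symmetric]]] of_nat_mult) (simp add: algebra_simps)
    then show ?thesis by (simp only: power_int_diff[OF disjI1[OF p]] power_int_of_nat)
  qed
  have pow': "?p ^ (?N - 1) * (?p / ?p ^ (n * (m - 1))) = ?p powi (int (m - 1) * (int (card (edges U)) - int n))"
  proof -
    have "?p ^ (?N - 1) * ?p = ?p ^ ?N" by (rule power_minus_mult[OF N])
    moreover have "int (m - 1) * (int (card (edges U)) - int n) = int ?N - int (n * (m - 1))"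
      by (simp only: of_nat_mult right_diff_distrib mult.commute)
    ultimately show ?thesis by (simp only: power_int_diff[OF disjI1[OF p]] power_int_of_nat times_divide_eq_right)
  qed
  have tree_part: "?p ^ (?N - 1) * (real (m * l) * real m ^ (k * (m - 2)) / ?p ^ (k * (m - 1)) * tree_sum k l U) =
    real (m * l) * ?p powi (int (m - 1) * (int (card (edges U)) - int k) - 1) * real m ^ (k * (m - 2)) * tree_sum k l U" for k
    unfolding pow[symmetric] by simp
  have cycle_part: "?p ^ (?N - 1) * (2 * real n * (real n + 1) * ?p * real m ^ (n * (m - 2)) / ?p ^ (n * (m - 1))) =
    2 * real n * (real n + 1) * ?p powi (int (m - 1) * (int (card (edges U)) - int n)) * real m ^ (n * (m - 2))"
    unfolding pow'[symmetric] by simp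
  have "hypergraph_trace m (power_hypergraph U m) (m * l) =
    (\<Sum>k=1..l. ?p ^ (?N - 1) * (real (m * l) * real m ^ (k * (m - 2)) / ?p ^ (k * (m - 1)) * tree_sum k l U)) +
    (if l = n then ?p ^ (?N - 1) * (2 * real n * (real n + 1) * ?p * real m ^ (n * (m - 2)) / ?p ^ (n * (m - 1))) else 0)"
  proof -
    have "c * (x + (if l = n then y else 0)) = c * x + (if l = n then c * y else 0)" for c x y :: real
      by (simp add: distrib_left)
    then show ?thesis unfolding trace_expansion sum_weight[OF l] cV by (simp only: sum_distrib_left)
  qed
  then show ?thesis unfolding tree_part cycle_part .
qed

end

theorem corollary3p4:
  fixes U C :: "'a hypergraph" and n m d :: nat
  assumes "unicyclic U"
    and "subgraph C U" and "is_cycle C" and "card (verts C) = n"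
    and "m \<ge> 3" and "d > 0" and "m dvd d"
  shows "(d div m = n \<longrightarrow>
      hypergraph_trace m (power_hypergraph U m) d =
        (\<Sum>k=1..n. real n
            * real (m - 1) powi (int (m - 1) * (int (card (edges U)) - int k) - 1)
            * real m ^ (k * (m - 2) + 1) * tree_sum k n U)
        + 2 * real n * (real n + 1)
            * real (m - 1) powi (int (m - 1) * (int (card (edges U)) - int n))
            * real m ^ (n * (m - 2))) \<and>
    (d div m < n \<longrightarrow>
      hypergraph_trace m (power_hypergraph U m) d =
        (\<Sum>k=1..d div m. real d
            * real (m - 1) powi (int (m - 1) * (int (card (edges U)) - int k) - 1)
            * real m ^ (k * (m - 2)) * tree_sum k (d div m) U))"
proof -
  have "simple_graph C" using assms(2) by (simp add: subgraph_def)
  then obtain g where n: "3 \<le> n" and g: "bij_betw g {..<n} (verts C)"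
    and eC: "edges C = (\<lambda>i. {g i, g ((i + 1) mod n)}) ` {..<n}"
    using is_cycle_param[OF assms(3)] unfolding assms(4) by blast
  interpret unicyclic_power U m C n g
  proof
    show "simple_graph U" using assms(1) by (simp add: unicyclic_def)
  qed (use assms n bij_betw_imp_inj_on[OF g] eC in auto)
  have d: "d = m * (d div m)" using assms(7) by simp
  then have l: "1 \<le> d div m" using assms(6) by (cases "d div m") auto
  show ?thesis
  proof (intro conjI impI)
    assume "d div m = n"
    then have "d = m * n" using d by simp
    \<comment> \<open>One factor \<open>m\<close> of \<open>d = m * n\<close> moves into the power
      of \<open>m\<close>, which accounts for the exponent \<open>k * (m - 2) + 1\<close>.\<close>
    moreover have "real (m * n) * x * real m ^ (k * (m - 2)) * y = real n * x * real m ^ (k * (m - 2) + 1) * y" for k x y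
      by simp
    ultimately show "hypergraph_trace m (power_hypergraph U m) d =
        (\<Sum>k=1..n. real n
            * real (m - 1) powi (int (m - 1) * (int (card (edges U)) - int k) - 1)
            * real m ^ (k * (m - 2) + 1) * tree_sum k n U)
        + 2 * real n * (real n + 1)
            * real (m - 1) powi (int (m - 1) * (int (card (edges U)) - int n))
            * real m ^ (n * (m - 2))"
      using trace_power[of n] n by (simp only: if_True) simp
  next
    assume "d div m < n"
    then show "hypergraph_trace m (power_hypergraph U m) d =
        (\<Sum>k=1..d div m. real d
            * real (m - 1) powi (int (m - 1) * (int (card (edges U)) - int k) - 1)
            * real m ^ (k * (m - 2)) * tree_sum k (d div m) U)"
      using trace_power[OF l] d by simp
  qed
qed

end
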